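(* Let $\alpha>2$ and $\rho,r_{\mathrm{tr}},\beta>0$. Consider spatial multiplexing with MRC (maximum ratio combining) receivers, with $N$ antennas per node and $M$ data streams per transmitter, and let $\mathrm{c}_{\mathrm{MRC}}(\epsilon)$ be its transmission capacity at outage level $\epsilon$. Then, as $N\to\infty$ with $M=\kappa N$ where $0<\kappa\le 1$, the transmission capacity as $\epsilon-H(\beta-\bar\beta_{\mathrm{MRC}})\to 0$ behaves as $$\frac{\mathrm{c}_{\mathrm{MRC}}(\epsilon)}{N}\to\kappa\left(\frac{r_{\mathrm{tr}}^{\alpha}}{\rho}+1\right)^{2/\alpha}\left(\left(\bar\beta_{\mathrm{MRC}}-\beta\right)^{+}\right)^{2/\alpha}\frac{\left(\epsilon-H(\beta-\bar\beta_{\mathrm{MRC}})\right)^{+}}{\pi r_{\mathrm{tr}}^{2}\beta^{2/\alpha}}+O\left(\left(\left(\epsilon-H(\beta-\bar\beta_{\mathrm{MRC}})\right)^{2}\right)^{+}\right),$$ where $$\bar\beta_{\mathrm{MRC}}=\frac{1}{\kappa\left(\frac{r_{\mathrm{tr}}^{\alpha}}{\rho}+1\right)}.$$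
   Context: Model: the SINR of a data stream with MRC receivers is distributed as $$\gamma=\frac{W}{Y+\sum_{\ell}|X_\ell|^{-\alpha}\Psi_{\ell 0}+1},$$ where $W\sim\mathrm{Gamma}\left(N,\frac{\rho}{Mr_{\mathrm{tr}}^{\alpha}}\right)$ (signal), $Y\sim\mathrm{Gamma}\left(M-1,\frac{\rho}{Mr_{\mathrm{tr}}^{\alpha}}\right)$ (self-interference; $Y\equiv 0$ if $M=1$), $\{X_\ell\}$ is a homogeneous Poisson point process on $\mathbb{R}^2$ of intensity $\mu$ (the intensity of active transmitters), and $\Psi_{\ell 0}$ are i.i.d. $\mathrm{Gamma}\left(M,\frac{\rho}{M}\right)$ (interference from other nodes), all mutually independent. $\mathrm{Gamma}(v,\vartheta)$ has shape $v$ and scale $\vartheta$; $\rho$ is the transmit SNR, $r_{\mathrm{tr}}$ the transmitter-receiver distance, $\alpha$ the path loss exponent and $\beta$ the SINR threshold. Let $\mathrm{F}(\beta;\mu)=\Pr(\gamma\le\beta)$. The transmission capacity is $\mathrm{c}_{\mathrm{MRC}}(\epsilon)=M\,\mu(\epsilon)(1-\epsilon)$, where $\mu(\epsilon)$ is the inverse of $\epsilon=\mathrm{F}(\beta;\mu)$ with respect to $\mu$; it is zero if $\epsilon$ falls below $\Pr(W/(Y+1)\le\beta)$, since the outage constraint then cannot be met. $(a)^{+}=\max(a,0)$, and $H$ is the Heaviside step function ($H(x)=0$ for $x<0$, $H(x)=1$ for $x>0$). *)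

theory Defs
  imports "HOL-Probability.Probability" "HOL-Library.Landau_Symbols"
begin

definition gamma_density :: "real \<Rightarrow> real \<Rightarrow> real \<Rightarrow> real" where
  "gamma_density v \<theta> x =
     (if x \<le> 0 then 0 else x powr (v - 1) * exp (- x / \<theta>) / (Gamma v * \<theta> powr v))"

lemma gamma_density_eq_erlang_density:
  assumes "\<theta> > 0" and "x \<noteq> 0"
  shows "gamma_density (real (Suc k)) \<theta> x = erlang_density k (1 / \<theta>) x"
proof (cases "x < 0")
  case False
  with assms have "x > 0" by simp
  moreover have "\<theta> powr (1 + real k) = \<theta> ^ Suc k"
    using assms powr_realpow[of \<theta> "Suc k"] by simp
  ultimately show ?thesis using assms
    by (simp add: gamma_density_def erlang_density_def powr_realpow Gamma_fact field_simps)
qed (simp add: gamma_density_def erlang_density_def)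

definition gamma_distributed :: "'a measure \<Rightarrow> ('a \<Rightarrow> real) \<Rightarrow> real \<Rightarrow> real \<Rightarrow> bool" where
  "gamma_distributed P Z v \<theta> \<longleftrightarrow> distributed P lborel Z (\<lambda>x. ennreal (gamma_density v \<theta> x))"

definition points_in :: "(nat \<Rightarrow> 'a \<Rightarrow> 'b) \<Rightarrow> 'b set \<Rightarrow> 'a \<Rightarrow> nat set" where
  "points_in X B \<omega> = {l. X l \<omega> \<in> B}"

text \<open>The points are enumerated as a sequence, which is possible since for positive intensity
  there are almost surely infinitely many of them. In the first clause on \<open>points_in\<close> the
  probabilities sum to 1 over \<open>k\<close>, so the counts are almost surely finite; the convention that
  infinite sets have cardinality 0 thus affects the second clause only on a null set.\<close>

definition homogeneous_PPP ::
    "'a measure \<Rightarrow> (nat \<Rightarrow> 'a \<Rightarrow> 'b::euclidean_space) \<Rightarrow> real \<Rightarrow> bool" where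
  "homogeneous_PPP P X \<mu> \<longleftrightarrow>
     (\<forall>l. X l \<in> borel_measurable P) \<and>
     (\<forall>B k. B \<in> sets borel \<and> bounded B \<longrightarrow>
        measure P {\<omega> \<in> space P. finite (points_in X B \<omega>) \<and> card (points_in X B \<omega>) = k} =
          (\<mu> * measure lborel B) ^ k / fact k * exp (- (\<mu> * measure lborel B))) \<and>
     (\<forall>(B :: nat \<Rightarrow> 'b set) n.
        (\<forall>i<n. B i \<in> sets borel \<and> bounded (B i)) \<and> disjoint_family_on B {..<n} \<longrightarrow>
        prob_space.indep_vars P (\<lambda>_. count_space UNIV) (\<lambda>i \<omega>. card (points_in X (B i) \<omega>)) {..<n})"

definition events_of :: "'a measure \<Rightarrow> ('a \<Rightarrow> 'b) \<Rightarrow> 'b measure \<Rightarrow> 'a set set" where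
  "events_of P Z S = {Z -` A \<inter> space P | A. A \<in> sets S}"

datatype source = Signal | Self_Interference | Interferer_Locations | Interferer_Fading nat

text \<open>The families \<open>W\<close>, \<open>Y\<close>, \<open>X\<close>, \<open>\<Psi>\<close> take values in different spaces, so their mutual
  independence is expressed through the events they generate; the point process enters as one
  random sequence.\<close>

definition sources_events ::
    "'a measure \<Rightarrow> ('a \<Rightarrow> real) \<Rightarrow> ('a \<Rightarrow> real) \<Rightarrow> (nat \<Rightarrow> 'a \<Rightarrow> real^2) \<Rightarrow> (nat \<Rightarrow> 'a \<Rightarrow> real) \<Rightarrow>
     source \<Rightarrow> 'a set set" where
  "sources_events P W Y X \<Psi> s =
     (case s of
        Signal \<Rightarrow> events_of P W borel
      | Self_Interference \<Rightarrow> events_of P Y borel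
      | Interferer_Locations \<Rightarrow> events_of P (\<lambda>\<omega> l. X l \<omega>) (PiM UNIV (\<lambda>_. borel))
      | Interferer_Fading l \<Rightarrow> events_of P (\<Psi> l) borel)"

text \<open>\<open>N\<close> antennas, \<open>M\<close> streams, path loss exponent \<open>\<alpha>\<close>, transmit SNR \<open>\<rho>\<close>,
  transmitter-receiver distance \<open>r\<close>, intensity \<open>\<mu>\<close> of active transmitters.\<close>

definition mrc_model ::
    "nat \<Rightarrow> nat \<Rightarrow> real \<Rightarrow> real \<Rightarrow> real \<Rightarrow> real \<Rightarrow> 'a measure \<Rightarrow> ('a \<Rightarrow> real) \<Rightarrow> ('a \<Rightarrow> real) \<Rightarrow>
     (nat \<Rightarrow> 'a \<Rightarrow> real^2) \<Rightarrow> (nat \<Rightarrow> 'a \<Rightarrow> real) \<Rightarrow> bool" where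
  "mrc_model N M \<alpha> \<rho> r \<mu> P W Y X \<Psi> \<longleftrightarrow>
     prob_space P \<and>
     gamma_distributed P W (real N) (\<rho> / (real M * r powr \<alpha>)) \<and>
     (if M = 1 then \<forall>\<omega>\<in>space P. Y \<omega> = 0
      else gamma_distributed P Y (real M - 1) (\<rho> / (real M * r powr \<alpha>))) \<and>
     homogeneous_PPP P X \<mu> \<and>
     (\<forall>l. gamma_distributed P (\<Psi> l) (real M) (\<rho> / real M)) \<and>
     prob_space.indep_sets P (sources_events P W Y X \<Psi>) UNIV"

text \<open>For \<open>\<alpha> > 2\<close> the series converges almost surely.\<close>

definition sinr ::
    "real \<Rightarrow> ('a \<Rightarrow> real) \<Rightarrow> ('a \<Rightarrow> real) \<Rightarrow> (nat \<Rightarrow> 'a \<Rightarrow> real^2) \<Rightarrow> (nat \<Rightarrow> 'a \<Rightarrow> real) \<Rightarrow> 'a \<Rightarrow> real" where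
  "sinr \<alpha> W Y X \<Psi> \<omega> =
     W \<omega> / (Y \<omega> + (\<Sum>l. norm (X l \<omega>) powr (- \<alpha>) * \<Psi> l \<omega>) + 1)"

definition outage_prob ::
    "real \<Rightarrow> real \<Rightarrow> 'a measure \<Rightarrow> ('a \<Rightarrow> real) \<Rightarrow> ('a \<Rightarrow> real) \<Rightarrow> (real \<Rightarrow> nat \<Rightarrow> 'a \<Rightarrow> real^2) \<Rightarrow>
     (nat \<Rightarrow> 'a \<Rightarrow> real) \<Rightarrow> real \<Rightarrow> real" where
  "outage_prob \<alpha> \<beta> P W Y X \<Psi> \<mu> = measure P {\<omega> \<in> space P. sinr \<alpha> W Y (X \<mu>) \<Psi> \<omega> \<le> \<beta>}"

definition min_outage_prob :: "real \<Rightarrow> 'a measure \<Rightarrow> ('a \<Rightarrow> real) \<Rightarrow> ('a \<Rightarrow> real) \<Rightarrow> real" where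
  "min_outage_prob \<beta> P W Y = measure P {\<omega> \<in> space P. W \<omega> / (Y \<omega> + 1) \<le> \<beta>}"

text \<open>Here \<open>X \<mu>\<close> is the point process of intensity \<open>\<mu>\<close>. At \<open>\<epsilon> = min_outage_prob \<beta> P W Y\<close> the
  admissible intensity is 0, so that the capacity vanishes there as well.\<close>

definition capacity_MRC ::
    "nat \<Rightarrow> real \<Rightarrow> real \<Rightarrow> 'a measure \<Rightarrow> ('a \<Rightarrow> real) \<Rightarrow> ('a \<Rightarrow> real) \<Rightarrow>
     (real \<Rightarrow> nat \<Rightarrow> 'a \<Rightarrow> real^2) \<Rightarrow> (nat \<Rightarrow> 'a \<Rightarrow> real) \<Rightarrow> real \<Rightarrow> real" where
  "capacity_MRC M \<alpha> \<beta> P W Y X \<Psi> \<epsilon> =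
     (if \<epsilon> \<le> min_outage_prob \<beta> P W Y then 0
      else real M * inv_into {0<..} (outage_prob \<alpha> \<beta> P W Y X \<Psi>) \<epsilon> * (1 - \<epsilon>))"

definition beta_bar_MRC :: "real \<Rightarrow> real \<Rightarrow> real \<Rightarrow> real \<Rightarrow> real" where
  "beta_bar_MRC \<alpha> \<rho> r \<kappa> = 1 / (\<kappa> * (r powr \<alpha> / \<rho> + 1))"

end

(*
  All the randomness of the interference sits in one law. By the Laplace functional of the Poisson
  process and the scaling of path loss, the sum of |X_l|^(-a) Psi_l has Laplace transform
  exp(-mu E[Psi^(2/a)] c s^(2/a)), so it is distributed as (mu E[Psi^(2/a)])^(a/2) J, where J is
  a positive stable variable of index 2/a whose law depends neither on N nor on mu. So the outage
  probability is P(W / beta - Y - 1 <= (mu E[Psi^(2/a)])^(a/2) J), which is continuous and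
  increasing in mu. As N grows, W, Y and E[Psi^(2/a)] concentrate, and the inverse intensity
  converges because J charges every interval of the positive axis (stability spreads mass
  downwards from arbitrarily high intervals).
  The expansion in epsilon comes from P(J_mu > 1) = pi mu + O(mu^2): the probability of a point in
  the unit disc gives the main term, and exceeding 1 without such a point needs a pair of points,
  which is controlled by the second factorial moment measure.
*)

theory Submission
  imports Defs
begin

section \<open>Laplace transforms\<close>

text \<open>The stable law is not built by hand: it is the law of the unmarked interference at
  intensity 1, which exists because the model supplies the process. Marks only replace an intensity
  \<open>\<mu>\<close> by \<open>\<mu>\<close> times the mark moment of order
  \<open>2 / \<alpha>\<close>, so tail estimates are made for the unmarked process, and scaling
  turns estimates for all intensities into tail bounds for one law. The obstacle is that no density
  of this law is at hand, while the limit of an inverse function needs probabilities strictly on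
  either side of \<open>\<epsilon>\<close>; positive mass on intervals delivers that strictness. The
  limit in \<open>N\<close> is taken at fixed \<open>\<epsilon>\<close>. There
  \<open>W / \<beta> - Y - 1\<close> concentrates at a number \<open>v\<close> with the sign of
  \<open>beta_bar_MRC - \<beta>\<close>. For \<open>v <= 0\<close> the limit capacity is zero, so an
  expansion is required only near \<open>\<epsilon> = 0\<close>. The process is prescribed through
  counts of bounded sets only, so each formula starts there and is extended by monotone
  limits.\<close>

definition exp_neg :: "ennreal \<Rightarrow> real" where
  "exp_neg x = (if x = \<infinity> then 0 else exp (- enn2real x))"

lemma exp_neg_nonneg [simp]: "0 \<le> exp_neg x"
  and exp_neg_le_1 [simp]: "exp_neg x \<le> 1"
  and exp_neg_top [simp]: "exp_neg top = 0"
  and exp_neg_0 [simp]: "exp_neg 0 = 1"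
  by (auto simp: exp_neg_def)

lemma exp_neg_ennreal: "0 \<le> x \<Longrightarrow> exp_neg (ennreal x) = exp (- x)"
  by (simp add: exp_neg_def)

lemma exp_neg_pos: "x \<noteq> \<infinity> \<Longrightarrow> 0 < exp_neg x"
  by (simp add: exp_neg_def)

lemma exp_neg_add: "exp_neg (x + y) = exp_neg x * exp_neg y"
  by (cases x; cases y) (auto simp: exp_neg_def ennreal_plus[symmetric] exp_add[symmetric] simp del: ennreal_plus)

lemma exp_neg_sum: "exp_neg (\<Sum>i\<in>I. f i) = (\<Prod>i\<in>I. exp_neg (f i))"
  by (induction I rule: infinite_finite_induct) (auto simp: exp_neg_add)

lemma exp_neg_of_nat_mult: "exp_neg (of_nat n * x) = exp_neg x ^ n"
  by (induction n) (auto simp: exp_neg_add distrib_right)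

lemma exp_neg_antimono: "x \<le> y \<Longrightarrow> exp_neg y \<le> exp_neg x"
  by (cases x; cases y) (auto simp: exp_neg_def ennreal_le_iff top_unique)

lemma measurable_exp_neg [measurable]: "exp_neg \<in> borel_measurable borel"
  unfolding exp_neg_def by measurable

text \<open>The value 0 at infinity makes \<open>exp_neg\<close> continuous on the whole extended
  half-line, so a series can be treated before its convergence is known.\<close>

lemma tendsto_exp_neg:
  assumes "f \<longlonglongrightarrow> x"
  shows "(\<lambda>n. exp_neg (f n)) \<longlonglongrightarrow> exp_neg x"
proof (cases "x = \<infinity>")
  case False
  then have "eventually (\<lambda>n. f n < \<infinity>) sequentially"
    using order_tendstoD(2)[OF assms, of \<infinity>] by (simp add: less_top)
  moreover have "(\<lambda>n. exp (- enn2real (f n))) \<longlonglongrightarrow> exp (- enn2real x)"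
    using assms False by (intro tendsto_intros) (auto simp: less_top intro!: tendsto_enn2real)
  ultimately show ?thesis
    using False by (auto simp: exp_neg_def elim!: eventually_mono
      intro: Lim_transform_eventually)
next
  case True
  show ?thesis
  proof (rule LIMSEQ_I)
    fix e :: real assume e: "0 < e"
    define K where "K = max 0 (- ln e) + 1"
    have "eventually (\<lambda>n. f n > ennreal K) sequentially"
      using order_tendstoD(1)[OF assms] True by simp
    then obtain n0 where n0: "\<And>n. n \<ge> n0 \<Longrightarrow> f n > ennreal K"
      by (auto simp: eventually_sequentially)
    have "norm (exp_neg (f n)) < e" if "n \<ge> n0" for n
    proof (cases "f n")
      case (real a)
      then have "a > - ln e" using n0[OF that] by (simp add: ennreal_less_iff K_def del: ennreal_plus)
      then have "exp (- a) < exp (ln e)" by (subst exp_less_cancel_iff) simp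
      then show ?thesis using e real by (simp add: exp_neg_ennreal)
    qed (use e in auto)
    then show "\<exists>n0. \<forall>n\<ge>n0. norm (exp_neg (f n) - exp_neg x) < e"
      using True by auto
  qed
qed

lemma exp_neg_suminf_LIMSEQ: "(\<lambda>n. \<Prod>i<n. exp_neg (f i)) \<longlonglongrightarrow> exp_neg (\<Sum>i. f i)"
  unfolding exp_neg_sum[symmetric] by (intro tendsto_exp_neg summable_LIMSEQ) auto

text \<open>Both measures live on \<open>{0..1}\<close>, where \<open>g\<close> is a uniform limit
  of polynomials, and integrals of polynomials are combinations of moments.\<close>

lemma integral_eq_of_moments_eq:
  fixes M N :: "real measure"
  assumes "prob_space M" "prob_space N" and sets: "sets M = sets borel" "sets N = sets borel"
    and AE: "AE x in M. x \<in> {0..1}" "AE x in N. x \<in> {0..1}"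
    and mom: "\<And>k::nat. (\<integral>x. x ^ k \<partial>M) = (\<integral>x. x ^ k \<partial>N)"
    and g: "continuous_on UNIV g" and bnd: "\<And>x. \<bar>g x\<bar> \<le> (B::real)"
  shows "(\<integral>x. g x \<partial>M) = (\<integral>x. g x \<partial>N)"
proof -
  interpret M: prob_space M by fact
  interpret N: prob_space N by fact
  have gM: "g \<in> borel_measurable M" "g \<in> borel_measurable N"
    using borel_measurable_continuous_onI[OF g] by (simp_all add: measurable_cong_sets[OF sets(1) refl] measurable_cong_sets[OF sets(2) refl])
  have pw: "(\<lambda>x. x ^ k) \<in> borel_measurable M" "(\<lambda>x. x ^ k) \<in> borel_measurable N" for k :: nat
    by (simp_all add: measurable_cong_sets[OF sets(1) refl] measurable_cong_sets[OF sets(2) refl])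
  have ipw: "integrable M (\<lambda>x. x ^ k)" "integrable N (\<lambda>x. x ^ k)" for k :: nat
    using pw by (auto intro!: M.integrable_const_bound[where B=1] N.integrable_const_bound[where B=1]
       eventually_mono[OF AE(1)] eventually_mono[OF AE(2)] simp: power_abs power_le_one)
  have ig: "integrable M g" "integrable N g"
    using gM bnd by (auto intro!: M.integrable_const_bound[where B=B] N.integrable_const_bound[where B=B])
  show ?thesis
  proof (rule dense_eq0_I[where 'a=real, THEN eq_iff_diff_eq_0[THEN iffD2]])
    fix e :: real assume "0 < e"
    then have "0 < e/2" by simp
    obtain q where q: "real_polynomial_function q" and qe: "\<And>x. x \<in> {0..1} \<Longrightarrow> \<bar>g x - q x\<bar> < e/2"
      using Stone_Weierstrass_real_polynomial_function[of "{0..1}" g, OF _ _ \<open>0 < e/2\<close>] 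
        continuous_on_subset[OF g] by auto
    obtain a n where qa: "q = (\<lambda>x. \<Sum>i\<le>n. a i * x^i)"
      using q by (auto simp: real_polynomial_function_iff_sum)
    have iq: "integrable M q" "integrable N q"
      using ipw by (auto simp: qa)
    have eq: "(\<integral>x. q x \<partial>M) = (\<integral>x. q x \<partial>N)"
      using ipw mom by (simp add: qa)
    have 1: "\<bar>(\<integral>x. g x \<partial>L) - (\<integral>x. q x \<partial>L)\<bar> \<le> e/2" 
      if "prob_space L" "AE x in L. x \<in> {0..1}" "integrable L g" "integrable L q" for L
    proof -
      interpret L: prob_space L by fact
      have "\<bar>(\<integral>x. g x - q x \<partial>L)\<bar> \<le> (\<integral>x. \<bar>g x - q x\<bar> \<partial>L)"
        by (rule integral_abs_bound)
      also have "\<dots> \<le> (\<integral>x. e/2 \<partial>L)"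
        using that(3,4) by (intro integral_mono_AE) (auto intro!: eventually_mono[OF that(2)] dest!: qe)
      finally show ?thesis using that by (simp add: L.prob_space)
    qed
    show "\<bar>(\<integral>x. g x \<partial>M) - (\<integral>x. g x \<partial>N)\<bar> \<le> e"
      using 1[OF assms(1) AE(1) ig(1) iq(1)] 1[OF assms(2) AE(2) ig(2) iq(2)] eq by linarith
  qed
qed

text \<open>Cosine and sine are bounded and continuous, so equal moments give equal characteristic
  functions.\<close>

lemma prob_measure_eqI_moments:
  fixes M N :: "real measure"
  assumes "prob_space M" "prob_space N" and sets: "sets M = sets borel" "sets N = sets borel"
    and AE: "AE x in M. x \<in> {0..1}" "AE x in N. x \<in> {0..1}"
    and mom: "\<And>k::nat. (\<integral>x. x ^ k \<partial>M) = (\<integral>x. x ^ k \<partial>N)"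
  shows "M = N"
proof (rule Levy_uniqueness)
  have rd: "real_distribution M" "real_distribution N"
    using assms sets_eq_imp_space_eq[OF sets(1)] sets_eq_imp_space_eq[OF sets(2)]
    by (auto simp: real_distribution_def real_distribution_axioms_def)
  then show "real_distribution M" "real_distribution N" .
  have eq: "(\<integral>x. g x \<partial>M) = (\<integral>x. g x \<partial>N)" if "continuous_on UNIV g" "\<And>x. \<bar>g x\<bar> \<le> 1" for g :: "real \<Rightarrow> real"
    using integral_eq_of_moments_eq[OF assms that(1), of 1] that(2) by simp
  show "char M = char N"
  proof
    fix t
    interpret M: real_distribution M by fact
    interpret N: real_distribution N by fact
    have "(\<integral>x. cos (t * x) \<partial>M) = (\<integral>x. cos (t * x) \<partial>N)" "(\<integral>x. sin (t * x) \<partial>M) = (\<integral>x. sin (t * x) \<partial>N)"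
      by (rule eq; auto intro!: continuous_intros)+
    then show "char M t = char N t"
      using M.integrable_iexp[of "\<lambda>x. t * x"] N.integrable_iexp[of "\<lambda>x. t * x"]
      by (intro complex_eqI) (simp_all add: char_def Re_exp Im_exp flip: integral_Re integral_Im)
  qed
qed

text \<open>The map \<open>exp (- x)\<close> carries the half-line into \<open>{0..1}\<close> and
  turns the Laplace transform at a positive integer \<open>k\<close> into the \<open>k\<close>-th
  moment. The moment of order 0 is the total mass and is treated apart, since \<open>L\<close>
  speaks of positive \<open>s\<close>.\<close>

lemma laplace_transform_unique:
  fixes M N :: "real measure"
  assumes "prob_space M" "prob_space N" and sets: "sets M = sets borel" "sets N = sets borel"
    and AE: "AE x in M. 0 \<le> x" "AE x in N. 0 \<le> x"
    and L: "\<And>s. 0 < s \<Longrightarrow> (\<integral>x. exp (- (s * x)) \<partial>M) = (\<integral>x. exp (- (s * x)) \<partial>N)"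
  shows "M = N"
proof -
  interpret M: prob_space M by fact
  interpret N: prob_space N by fact
  let ?e = "\<lambda>x::real. exp (- x)"
  have e: "?e \<in> measurable M borel" "?e \<in> measurable N borel"
    by (simp_all add: measurable_cong_sets[OF sets(1) refl] measurable_cong_sets[OF sets(2) refl])
  have "distr M borel ?e = distr N borel ?e"
  proof (rule prob_measure_eqI_moments)
    show "prob_space (distr M borel ?e)" "prob_space (distr N borel ?e)"
      using e by (simp_all add: M.prob_space_distr N.prob_space_distr)
    show "AE x in distr M borel ?e. x \<in> {0..1}" "AE x in distr N borel ?e. x \<in> {0..1}"
      using AE e by (auto simp: AE_distr_iff elim!: eventually_mono)
    fix k :: nat
    show "(\<integral>x. x ^ k \<partial>distr M borel ?e) = (\<integral>x. x ^ k \<partial>distr N borel ?e)"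
    proof (cases "k = 0")
      case True
      then show ?thesis using e
        by (simp add: integral_distr M.prob_space N.prob_space del: Bochner_Integration.lebesgue_integral_const)
           (simp add: M.prob_space N.prob_space)
    next
      case False
      then show ?thesis using L[of "real k"] e
        by (simp add: integral_distr exp_of_nat_mult[symmetric] )
    qed
  qed auto
  \<comment> \<open>The map is injective; its inverse \<open>- ln u\<close> brings both laws back to
    the original line.\<close>
  then have "distr (distr M borel ?e) M (\<lambda>u. - ln u) = distr (distr N borel ?e) M (\<lambda>u. - ln u)"
    by simp
  moreover have "(\<lambda>u::real. - ln u) \<in> measurable borel M"
    using sets by (simp add: measurable_cong_sets[OF refl sets(1)])
  ultimately have "distr M M (\<lambda>x. x) = distr N M (\<lambda>x. x)"
    using e by (simp add: distr_distr comp_def)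
  moreover have "distr N M (\<lambda>x. x) = distr N N (\<lambda>x. x)"
    by (rule distr_cong) (use sets in auto)
  ultimately show ?thesis by (simp add: distr_id)
qed

section \<open>Path loss in the plane\<close>

definition path_loss :: "real \<Rightarrow> real^2 \<Rightarrow> real" where
  "path_loss \<alpha> x = norm x powr (- \<alpha>)"

lemma path_loss_nonneg [simp]: "0 \<le> path_loss \<alpha> x"
  by (simp add: path_loss_def)

lemma path_loss_measurable [measurable]: "path_loss \<alpha> \<in> borel_measurable borel"
  unfolding path_loss_def[abs_def] by measurable

lemma path_loss_scaleR: "0 < c \<Longrightarrow> path_loss \<alpha> (c *\<^sub>R x) = c powr (- \<alpha>) * path_loss \<alpha> x"
  by (simp add: path_loss_def powr_mult)

lemma emeasure_ball_plane:
  assumes "0 \<le> r"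
  shows "emeasure lborel (ball (0 :: real^2) r) = ennreal (pi * r\<^sup>2)"
    and "emeasure lborel (cball (0 :: real^2) r) = ennreal (pi * r\<^sup>2)"
  using emeasure_ball[OF assms, of "0 :: real^2"] emeasure_cball[OF assms, of "0 :: real^2"]
  by (simp_all add: unit_ball_vol_2)

text \<open>Since \<open>0 powr a = 0\<close>, the path loss vanishes at the origin instead of being
  infinite, so superlevel sets are punctured discs.\<close>

lemma less_path_loss_iff:
  assumes "0 < \<alpha>" "0 < t"
  shows "t < path_loss \<alpha> x \<longleftrightarrow> x \<noteq> 0 \<and> norm x < t powr (- 1 / \<alpha>)"
proof (cases "x = 0")
  case False
  have t: "(t powr (- 1 / \<alpha>)) powr (- \<alpha>) = t" using assms by (simp add: powr_powr)
  have "t < path_loss \<alpha> x \<longleftrightarrow> (t powr (- 1 / \<alpha>)) powr (- \<alpha>) < norm x powr (- \<alpha>)"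
    unfolding path_loss_def t ..
  also have "\<dots> \<longleftrightarrow> norm x < t powr (- 1 / \<alpha>)"
  proof
    assume "(t powr (- 1 / \<alpha>)) powr (- \<alpha>) < norm x powr (- \<alpha>)"
    then show "norm x < t powr (- 1 / \<alpha>)"
      using powr_mono2'[of "- \<alpha>" "t powr (- 1 / \<alpha>)" "norm x"] assms by (intro not_le_imp_less notI) simp
  qed (use assms False in \<open>auto intro: powr_less_mono2_neg\<close>)
  finally show ?thesis using False by simp
qed (use assms in \<open>simp add: path_loss_def\<close>)

text \<open>The superlevel set is a punctured disc of radius \<open>t powr (- 1 / \<alpha>)\<close>.
  Squaring the radius produces the exponent \<open>2 / \<alpha>\<close>.\<close>

lemma emeasure_path_loss_gt:
  assumes "0 < \<alpha>" "0 < t"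
  shows "emeasure lborel {x. t < path_loss \<alpha> x} = ennreal (pi * t powr (- (2 / \<alpha>)))"
proof -
  have "{x. t < path_loss \<alpha> x} = ball 0 (t powr (- 1 / \<alpha>)) - {0}"
    by (simp add: less_path_loss_iff[OF assms] set_eq_iff dist_norm conj_commute del: minus_divide_left)
  also have "emeasure lborel \<dots> = emeasure lborel (ball (0 :: real^2) (t powr (- 1 / \<alpha>)))"
    by (intro emeasure_Diff_null_set) auto
  also have "\<dots> = ennreal (pi * (t powr (- 1 / \<alpha>))\<^sup>2)"
    by (simp add: emeasure_ball_plane)
  also have "(t powr (- 1 / \<alpha>))\<^sup>2 = t powr (- (2 / \<alpha>))"
    using assms by (simp add: powr_power)
  finally show ?thesis .
qed

lemma one_le_path_loss_iff:
  assumes "0 < \<alpha>"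
  shows "1 \<le> path_loss \<alpha> x \<longleftrightarrow> x \<noteq> 0 \<and> norm x \<le> 1"
proof -
  have "norm x powr (- \<alpha>) < 1" if "1 < norm x"
    using powr_less_mono2_neg[of "- \<alpha>" 1 "norm x"] assms that by simp
  moreover have "1 \<le> norm x powr (- \<alpha>)" if "norm x \<le> 1" "x \<noteq> 0"
    using powr_mono2'[of "- \<alpha>" "norm x" 1] assms that by simp
  ultimately show ?thesis
    by (cases "x = 0"; cases "norm x \<le> 1") (simp_all add: path_loss_def not_le)
qed

lemma emeasure_path_loss_ge_1:
  assumes "0 < \<alpha>"
  shows "emeasure lborel {x. 1 \<le> path_loss \<alpha> x} = ennreal pi"
proof -
  have "{x. 1 \<le> path_loss \<alpha> x} = cball 0 1 - {0}"
    by (simp add: one_le_path_loss_iff[OF assms] set_eq_iff dist_norm conj_commute)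
  also have "emeasure lborel \<dots> = emeasure lborel (cball (0 :: real^2) 1)"
    by (intro emeasure_Diff_null_set) auto
  finally show ?thesis by (simp add: emeasure_ball_plane)
qed

lemma bounded_path_loss_ge_1: "0 < \<alpha> \<Longrightarrow> bounded {x. 1 \<le> path_loss \<alpha> x}"
  by (rule boundedI[of _ 1]) (simp add: one_le_path_loss_iff)

lemma bounded_path_loss_gt:
  assumes "0 < \<alpha>" "0 < t"
  shows "bounded {x. t < path_loss \<alpha> x}"
  by (rule boundedI[of _ "t powr (- 1 / \<alpha>)"]) (simp add: less_path_loss_iff[OF assms] less_imp_le del: minus_divide_left)

text \<open>Dilating the plane by \<open>c = s powr (- 1 / \<alpha>)\<close> multiplies the path
  loss by \<open>s\<close> and areas by \<open>s powr (- 2 / \<alpha>)\<close>. This is the source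
  of stability.\<close>

lemma nn_integral_path_loss_scale:
  assumes [measurable]: "g \<in> borel_measurable borel" and "0 < \<alpha>" "0 < s"
  shows "(\<integral>\<^sup>+x. g (s * path_loss \<alpha> x) \<partial>lborel) = ennreal (s powr (2 / \<alpha>)) * (\<integral>\<^sup>+x. g (path_loss \<alpha> x) \<partial>lborel)"
proof -
  define c where "c = s powr (- 1 / \<alpha>)"
  have c: "0 < c" "c powr (- \<alpha>) = s" using assms by (simp_all add: c_def powr_powr)
  have "(\<integral>\<^sup>+x. g (path_loss \<alpha> x) \<partial>lborel) = (\<integral>\<^sup>+x. g (path_loss \<alpha> x) \<partial>density (distr lborel borel (\<lambda>x. 0 + c *\<^sub>R x)) (\<lambda>_. \<bar>c\<bar>^DIM(real^2)))"
    by (subst lborel_affine[of c 0]) (use c in auto)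
  also have "\<dots> = ennreal (c\<^sup>2) * (\<integral>\<^sup>+x. g (path_loss \<alpha> (c *\<^sub>R x)) \<partial>lborel)"
    by (simp add: nn_integral_density nn_integral_distr nn_integral_cmult)
  also have "\<dots> = ennreal (c\<^sup>2) * (\<integral>\<^sup>+x. g (s * path_loss \<alpha> x) \<partial>lborel)"
    using c by (simp add: path_loss_scaleR)
  finally have "ennreal (s powr (2 / \<alpha>)) * (\<integral>\<^sup>+x. g (path_loss \<alpha> x) \<partial>lborel) = ennreal (s powr (2 / \<alpha>) * c\<^sup>2) * (\<integral>\<^sup>+x. g (s * path_loss \<alpha> x) \<partial>lborel)"
    by (simp add: ennreal_mult'' mult.assoc)
  also have "s powr (2 / \<alpha>) * c\<^sup>2 = 1"
    using assms by (simp add: c_def powr_power flip: powr_add)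
  finally show ?thesis by simp
qed

text \<open>Dyadic comparison: a point with \<open>2^k <= norm x < 2^(k+1)\<close> has path loss at
  most \<open>2 powr (- \<alpha> * k)\<close>, and the unit disc is covered by the bound 1 at
  \<open>k = 0\<close>. The resulting series is geometric.\<close>

lemma nn_integral_min_path_loss_finite:
  assumes "2 < \<alpha>"
  shows "(\<integral>\<^sup>+x. ennreal (min 1 (path_loss \<alpha> x)) \<partial>lborel) < \<infinity>"
proof -
  \<comment> \<open>Doubling the radius multiplies the area by 4 and the bound on the path loss by
    \<open>2 powr (- \<alpha>)\<close>; the ratio is below 1 exactly when
    \<open>\<alpha> > 2\<close>.\<close>
  define q where "q = 4 * 2 powr (- \<alpha>)"
  have q: "0 \<le> q" "q < 1"
  proof -
    have "2 powr (- \<alpha>) < 2 powr (- 2)" using assms by (intro powr_less_mono) auto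
    also have "\<dots> = (1/4 :: real)" using powr_realpow[of "2 :: real" 2] by (simp add: powr_minus_divide)
    finally show "q < 1" by (simp add: q_def)
  qed (simp add: q_def)
  let ?B = "\<lambda>k. ball (0 :: real^2) (2 ^ Suc k)"
  define t where "t k x = ennreal (2 powr (- \<alpha> * real k)) * indicator (?B k) x" for k x
  have "ennreal (min 1 (path_loss \<alpha> x)) \<le> (\<Sum>k. t k x)" for x
  proof -
    obtain k where k: "norm x < 2 ^ Suc k" "min 1 (path_loss \<alpha> x) \<le> 2 powr (- \<alpha> * real k)"
    proof (cases "norm x < 1")
      case True
      then show ?thesis by (intro that[of 0]) auto
    next
      case False
      define k where "k = nat \<lfloor>log 2 (norm x)\<rfloor>"
      have x1: "1 \<le> norm x" using False by simp
      then have x: "norm x > 0" "0 \<le> log 2 (norm x)" by (simp_all del: zero_less_norm_iff)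
      then have "real k \<le> log 2 (norm x)" "log 2 (norm x) < real (Suc k)"
      proof -
        have "real k = of_int \<lfloor>log 2 (norm x)\<rfloor>" using x by (simp add: k_def)
        then show "real k \<le> log 2 (norm x)" "log 2 (norm x) < real (Suc k)" by linarith+
      qed
      then have kk: "2 powr real k \<le> norm x" "norm x < 2 powr real (Suc k)"
        using x le_log_iff[of 2 "norm x" "real k"] log_less_iff[of 2 "norm x" "real (Suc k)"] by auto
      have k: "2 powr real k \<le> norm x" "norm x < 2 ^ Suc k"
        using kk powr_realpow[of "2::real" "Suc k"] by (simp_all del: of_nat_Suc power_Suc)
      have "path_loss \<alpha> x \<le> (2 powr real k) powr (- \<alpha>)"
        unfolding path_loss_def using assms k(1) by (intro powr_mono2') auto
      then show ?thesis using k by (intro that[of k]) (auto simp: powr_powr mult.commute[of \<alpha>])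
    qed
    have "ennreal (min 1 (path_loss \<alpha> x)) \<le> t k x"
      using k by (auto simp: t_def intro: ennreal_leI)
    also have "\<dots> \<le> (\<Sum>k. t k x)"
      using sum_le_suminf[of "\<lambda>k. t k x" "{k}"] by simp
    finally show ?thesis .
  qed
  then have "(\<integral>\<^sup>+x. ennreal (min 1 (path_loss \<alpha> x)) \<partial>lborel) \<le> (\<integral>\<^sup>+x. (\<Sum>k. t k x) \<partial>lborel)"
    by (intro nn_integral_mono)
  also have "\<dots> = (\<Sum>k. ennreal (2 powr (- \<alpha> * real k)) * emeasure lborel (?B k))"
  proof -
    have "(\<integral>\<^sup>+x. (\<Sum>k. t k x) \<partial>lborel) = (\<Sum>k. \<integral>\<^sup>+x. t k x \<partial>lborel)"
      unfolding t_def by (intro nn_integral_suminf borel_measurable_times_ennreal borel_measurable_const borel_measurable_indicator) simp_all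
    then show ?thesis
      unfolding t_def by (subst (asm) nn_integral_cmult_indicator) auto
  qed
  also have "\<dots> = (\<Sum>k. ennreal (4 * pi * q ^ k))"
  proof (rule suminf_cong)
    fix k
    have e1: "2 powr (- \<alpha> * real k) = (2 powr (- \<alpha>)) ^ k" by (simp add: powr_power mult.commute[of "real k"])
    have e2: "emeasure lborel (?B k) = ennreal (pi * (2 ^ Suc k)\<^sup>2)"
      by (intro emeasure_ball_plane) simp
    have e3: "(2 powr (- \<alpha>)) ^ k * (pi * (2 ^ Suc k)\<^sup>2) = 4 * pi * q ^ k"
    proof -
      have "(2 ^ Suc k)\<^sup>2 = 4 * (4 :: real) ^ k"
        by (simp add: power2_eq_square flip: power_mult_distrib)
      then show ?thesis by (simp add: q_def power_mult_distrib)
    qed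
    show "ennreal (2 powr (- \<alpha> * real k)) * emeasure lborel (?B k) = ennreal (4 * pi * q ^ k)"
      unfolding e1 e2 e3[symmetric] by (rule ennreal_mult''[symmetric]) simp
  qed
  also have "\<dots> = ennreal (4 * pi * (1 / (1 - q)))"
    using q by (intro suminf_ennreal_eq sums_mult geometric_sums) auto
  finally show ?thesis by (simp add: le_less_trans)
qed

text \<open>The area is \<open>pi * ((1 - u) powr (- (2 / \<alpha>)) - 1)\<close>, and the power is
  at most \<open>1 / (1 - u) <= 1 + 2 * u\<close>. Linear decay in \<open>u\<close> is what later
  makes the sum over shells converge.\<close>

lemma emeasure_path_loss_shell_le:
  assumes "2 < \<alpha>" "0 < u" "u \<le> 1 / 2"
  shows "emeasure lborel {x. 1 - u < path_loss \<alpha> x \<and> path_loss \<alpha> x \<le> 1} \<le> ennreal (2 * pi * u)"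
proof -
  have "{x. 1 - u < path_loss \<alpha> x \<and> path_loss \<alpha> x \<le> 1} = {x. 1 - u < path_loss \<alpha> x} - {x. 1 < path_loss \<alpha> x}"
    by auto
  also have "emeasure lborel \<dots> = emeasure lborel {x. 1 - u < path_loss \<alpha> x} - emeasure lborel {x. 1 < path_loss \<alpha> x}"
    using assms by (intro emeasure_Diff) (auto simp: emeasure_path_loss_gt)
  also have "\<dots> = ennreal (pi * (1 - u) powr (- (2 / \<alpha>)) - pi)"
    using assms by (simp add: emeasure_path_loss_gt ennreal_minus)
  also have "pi * (1 - u) powr (- (2 / \<alpha>)) - pi \<le> 2 * pi * u"
  proof -
    have "(1 - u) powr (- (2 / \<alpha>)) \<le> (1 - u) powr (- 1)"
      using assms by (intro powr_mono') auto
    also have "\<dots> = 1 / (1 - u)" using assms by (simp add: powr_minus_divide)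
    also have "\<dots> \<le> 1 + 2 * u"
      using mult_right_mono[OF assms(3), of u] assms by (simp add: field_simps)
    finally have "pi * (1 - u) powr (- (2 / \<alpha>)) \<le> pi * (1 + 2 * u)" by (intro mult_left_mono) auto
    then show ?thesis by (simp add: algebra_simps)
  qed
  finally show ?thesis by (simp add: ennreal_leI)
qed

text \<open>For \<open>\<alpha> > 2\<close> this is \<open>pi * Gamma (1 - 2 / \<alpha>)\<close>. It
  stays symbolic because the same constant is built into \<open>stable_law\<close>.\<close>

definition laplace_const :: "real \<Rightarrow> real" where
  "laplace_const \<alpha> = enn2real (\<integral>\<^sup>+x. ennreal (1 - exp (- path_loss \<alpha> x)) \<partial>lborel)"

lemma laplace_const_nonneg: "0 \<le> laplace_const \<alpha>"
  by (simp add: laplace_const_def)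

text \<open>The bound \<open>1 - exp (- y) <= min 1 y\<close> gives finiteness, so
  \<open>enn2real\<close> in the constant loses nothing; the rest is scaling.\<close>

lemma nn_integral_one_minus_exp:
  assumes "2 < \<alpha>" "0 < s"
  shows "(\<integral>\<^sup>+x. ennreal (1 - exp (- (s * path_loss \<alpha> x))) \<partial>lborel) = ennreal (s powr (2 / \<alpha>) * laplace_const \<alpha>)"
proof -
  have "(\<integral>\<^sup>+x. ennreal (1 - exp (- path_loss \<alpha> x)) \<partial>lborel) \<le> (\<integral>\<^sup>+x. ennreal (min 1 (path_loss \<alpha> x)) \<partial>lborel)"
  proof (rule nn_integral_mono, rule ennreal_leI)
    fix x show "1 - exp (- path_loss \<alpha> x) \<le> min 1 (path_loss \<alpha> x)"
      using exp_ge_add_one_self[of "- path_loss \<alpha> x"] by simp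
  qed
  then have "(\<integral>\<^sup>+x. ennreal (1 - exp (- path_loss \<alpha> x)) \<partial>lborel) < \<infinity>"
    using nn_integral_min_path_loss_finite[OF assms(1)] by (rule le_less_trans)
  then have "ennreal (laplace_const \<alpha>) = (\<integral>\<^sup>+x. ennreal (1 - exp (- path_loss \<alpha> x)) \<partial>lborel)"
    by (simp add: laplace_const_def)
  then show ?thesis
    using nn_integral_path_loss_scale[of "\<lambda>u. ennreal (1 - exp (- u))" \<alpha> s] assms
    by (simp add: ennreal_mult laplace_const_nonneg)
qed

section \<open>Poisson point processes\<close>

text \<open>Total mass, mean and second factorial moment of the Poisson weights. Each factor taken
  from the falling factorial shifts the index by one and releases one factor
  \<open>x\<close>.\<close>

lemma poisson_sums:
  fixes x :: real
  shows "(\<lambda>k. x ^ k / fact k * exp (- x)) sums 1"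
    and "(\<lambda>k. real k * (x ^ k / fact k * exp (- x))) sums x"
    and "(\<lambda>k. real k * (real k - 1) * (x ^ k / fact k * exp (- x))) sums x\<^sup>2"
proof -
  have "(\<lambda>k. x ^ k / fact k) sums exp x"
    using exp_converges[of x] by (simp add: divide_inverse mult.commute)
  from sums_mult2[OF this, of "exp (- x)"]
  show 1: "(\<lambda>k. x ^ k / fact k * exp (- x)) sums 1"
    by (simp add: exp_minus)
  have Suc: "real (Suc k) * (x ^ Suc k / fact (Suc k) * exp (- x)) = x * (x ^ k / fact k * exp (- x))" for k
  proof -
    have "real (Suc k) / fact (Suc k) = 1 / fact k"
      by (simp del: of_nat_Suc)
    moreover have "real (Suc k) * (x ^ Suc k / fact (Suc k) * exp (- x)) = real (Suc k) / fact (Suc k) * (x ^ Suc k * exp (- x))"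
      by (simp del: of_nat_Suc fact_Suc power_Suc)
    ultimately show ?thesis by (simp only:) simp
  qed
  have "(\<lambda>k. x * (x ^ k / fact k * exp (- x))) sums (x * 1)"
    by (intro sums_mult 1)
  then have "(\<lambda>k. real (Suc k) * (x ^ Suc k / fact (Suc k) * exp (- x))) sums x"
    unfolding Suc by simp
  then show 2: "(\<lambda>k. real k * (x ^ k / fact k * exp (- x))) sums x"
    by (subst (asm) sums_Suc_iff) simp
  have "(\<lambda>k. x * (real k * (x ^ k / fact k * exp (- x)))) sums (x * x)"
    by (intro sums_mult 2)
  moreover have "x * (real k * (x ^ k / fact k * exp (- x))) 
      = real (Suc k) * (real (Suc k) - 1) * (x ^ Suc k / fact (Suc k) * exp (- x))" for k
    using Suc[of k] by (metis add_diff_cancel_left' mult.assoc mult.commute of_nat_Suc)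
  ultimately have "(\<lambda>k. real (Suc k) * (real (Suc k) - 1) * (x ^ Suc k / fact (Suc k) * exp (- x))) sums x\<^sup>2"
    by (simp only: power2_eq_square)
  then show "(\<lambda>k. real k * (real k - 1) * (x ^ k / fact k * exp (- x))) sums x\<^sup>2"
    by (subst (asm) sums_Suc_iff) simp
qed

lemma emeasure_Collect_eq_nn_integral:
  assumes "{x \<in> space M. Q x} \<in> sets M" "\<And>x. x \<in> space M \<Longrightarrow> f x = indicator {x. Q x} x"
  shows "emeasure M {x \<in> space M. Q x} = (\<integral>\<^sup>+x. f x \<partial>M)"
proof -
  have "(\<integral>\<^sup>+x. f x \<partial>M) = (\<integral>\<^sup>+x. indicator {x \<in> space M. Q x} x \<partial>M)"
    using assms(2) by (intro nn_integral_cong) (auto split: split_indicator)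
  then show ?thesis using assms(1) by simp
qed

locale PPP = prob_space P for P :: "'a measure" +
  fixes X :: "nat \<Rightarrow> 'a \<Rightarrow> 'b::euclidean_space" and \<mu> :: real
  assumes PPP: "homogeneous_PPP P X \<mu>" and mu_nonneg: "0 \<le> \<mu>"
begin

definition count :: "'b set \<Rightarrow> 'a \<Rightarrow> nat" where
  "count B \<omega> = card (points_in X B \<omega>)"

text \<open>Expresses finiteness by countable quantifiers over the measurable events that a point
  avoids \<open>B\<close>; this is the form in which measurability can be proved.\<close>

lemma finite_points_iff: "finite (points_in X B \<omega>) \<longleftrightarrow> (\<exists>n. \<forall>l\<ge>n. X l \<omega> \<notin> B)"
proof -
  have "S \<subseteq> {..<n} \<longleftrightarrow> (\<forall>l\<ge>n. l \<notin> S)" for S and n :: nat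
    by (auto simp: subset_eq simp flip: not_le)
  then show ?thesis by (simp add: finite_nat_iff_bounded points_in_def)
qed

lemma X_measurable [measurable]: "X l \<in> borel_measurable P"
  using PPP by (simp add: homogeneous_PPP_def)

lemma indep_counts:
  fixes n :: nat
  assumes "\<And>i. i < n \<Longrightarrow> B i \<in> sets borel" "\<And>i. i < n \<Longrightarrow> bounded (B i)" "disjoint_family_on B {..<n}"
  shows "indep_vars (\<lambda>_. count_space UNIV) (\<lambda>i. count (B i)) {..<n}"
  using PPP[unfolded homogeneous_PPP_def, THEN conjunct2, THEN conjunct2, rule_format, of n B] assms
  by (simp add: count_def[abs_def])

text \<open>The model states measurability of counts only implicitly, inside independence; a
  one-element family extracts it.\<close>

lemma count_measurable:
  assumes "B \<in> sets borel" "bounded B"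
  shows "count B \<in> measurable P (count_space UNIV)"
  using indep_counts[of 1 "\<lambda>_. B"] assms
  by (auto simp: disjoint_family_on_def indep_vars_def)

text \<open>The events of having finitely many points, exactly \<open>k\<close> of them, are
  disjoint and their Poisson probabilities add up to 1.\<close>

lemma AE_finite_points:
  assumes [measurable]: "B \<in> sets borel" and B: "bounded B"
  shows "AE \<omega> in P. finite (points_in X B \<omega>)"
proof -
  note [measurable] = count_measurable[OF assms]
  define E where "E k = {\<omega> \<in> space P. finite (points_in X B \<omega>) \<and> card (points_in X B \<omega>) = k}" for k
  have E: "E k \<in> events" for k
  proof -
    have "E k = {\<omega> \<in> space P. (\<exists>n. \<forall>l\<ge>n. X l \<omega> \<notin> B) \<and> count B \<omega> = k}"
      by (simp add: E_def finite_points_iff count_def)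
    also have "\<dots> \<in> events" by measurable
    finally show ?thesis .
  qed
  have "(\<lambda>k. prob (E k)) sums prob (\<Union>k. E k)"
    using E by (intro finite_measure_UNION) (auto simp: disjoint_family_on_def E_def)
  moreover have "prob (E k) = (\<mu> * measure lborel B) ^ k / fact k * exp (- (\<mu> * measure lborel B))" for k
    using PPP assms unfolding homogeneous_PPP_def E_def by blast
  ultimately have "prob (\<Union>k. E k) = 1"
    using poisson_sums(1)[of "\<mu> * measure lborel B"] by (simp add: sums_unique2)
  then have "AE \<omega> in P. \<omega> \<in> (\<Union>k. E k)"
    using E by (subst prob_eq_1[symmetric]) auto
  then show ?thesis by eventually_elim (auto simp: E_def)
qed

lemma distr_count:
  assumes [measurable]: "B \<in> sets borel" and B: "bounded B"
  defines "p \<equiv> \<lambda>k. (\<mu> * measure lborel B) ^ k / fact k * exp (- (\<mu> * measure lborel B))"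
  shows "distr P (count_space UNIV) (count B) = density (count_space UNIV) (\<lambda>k. ennreal (p k))"
proof (rule measure_eqI_countable[where A=UNIV])
  note [measurable] = count_measurable[OF assms(1,2)]
  fix k
  have "emeasure (distr P (count_space UNIV) (count B)) {k} = emeasure P {\<omega> \<in> space P. count B \<omega> = k}"
    by (subst emeasure_distr) (auto intro!: arg_cong[where f="emeasure P"])
  also have "\<dots> = ennreal (prob {\<omega> \<in> space P. count B \<omega> = k})"
    by (rule emeasure_eq_measure)
  also have "prob {\<omega> \<in> space P. count B \<omega> = k} = prob {\<omega> \<in> space P. finite (points_in X B \<omega>) \<and> card (points_in X B \<omega>) = k}"
  proof (rule prob_eq_AE)
    show "AE \<omega> in P. count B \<omega> = k \<longleftrightarrow> finite (points_in X B \<omega>) \<and> card (points_in X B \<omega>) = k"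
      using AE_finite_points[OF assms(1,2)] by eventually_elim (auto simp: count_def)
    have "{\<omega> \<in> space P. (\<exists>n. \<forall>l\<ge>n. X l \<omega> \<notin> B) \<and> count B \<omega> = k} \<in> events" by measurable
    then show "{\<omega> \<in> space P. finite (points_in X B \<omega>) \<and> card (points_in X B \<omega>) = k} \<in> events"
      by (simp only: finite_points_iff count_def)
  qed measurable
  also have "\<dots> = p k"
    using PPP[unfolded homogeneous_PPP_def, THEN conjunct2, THEN conjunct1, rule_format, of B k] assms(1,2)
    by (simp add: p_def)
  finally show "emeasure (distr P (count_space UNIV) (count B)) {k} = emeasure (density (count_space UNIV) (\<lambda>k. ennreal (p k))) {k}"
    by (simp add: emeasure_density nn_integral_count_space_indicator[symmetric])
qed auto

lemma nn_integral_count: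
  assumes "B \<in> sets borel" "bounded B"
    and "\<And>k. 0 \<le> g k" "(\<lambda>k. g k * ((\<mu> * measure lborel B) ^ k / fact k * exp (- (\<mu> * measure lborel B)))) sums s"
  shows "(\<integral>\<^sup>+\<omega>. ennreal (g (count B \<omega>)) \<partial>P) = ennreal s"
proof -
  note [measurable] = count_measurable[OF assms(1,2)]
  let ?l = "\<mu> * measure lborel B"
  have l: "0 \<le> ?l" using mu_nonneg by simp
  have "(\<integral>\<^sup>+\<omega>. ennreal (g (count B \<omega>)) \<partial>P) = (\<integral>\<^sup>+k. ennreal (g k) \<partial>distr P (count_space UNIV) (count B))"
    by (subst nn_integral_distr) auto
  also have "\<dots> = (\<Sum>k. ennreal (?l ^ k / fact k * exp (- ?l)) * ennreal (g k))"
    unfolding distr_count[OF assms(1,2)] by (simp add: nn_integral_density nn_integral_count_space_nat del: times_divide_eq_left)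
  also have "\<dots> = (\<Sum>k. ennreal (g k * (?l ^ k / fact k * exp (- ?l))))"
    using l assms(3) by (intro suminf_cong) (simp add: ennreal_mult'[symmetric] mult.commute del: times_divide_eq_left)
  also have "\<dots> = ennreal s"
    using assms(3,4) l by (intro suminf_ennreal_eq) auto
  finally show ?thesis .
qed

text \<open>Multiplying Poisson weights of parameter \<open>l\<close> by \<open>z^k\<close> gives
  those of parameter \<open>l * z\<close>, up to the factor
  \<open>exp (l * (z - 1))\<close>.\<close>

lemma nn_integral_count_pgf:
  assumes "B \<in> sets borel" "bounded B" "0 \<le> z"
  shows "(\<integral>\<^sup>+\<omega>. ennreal (z ^ count B \<omega>) \<partial>P) = ennreal (exp (\<mu> * measure lborel B * (z - 1)))"
proof (rule nn_integral_count[OF assms(1,2)])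
  let ?l = "\<mu> * measure lborel B"
  have "(\<lambda>k. (?l * z) ^ k / fact k * exp (- (?l * z)) * exp (?l * (z - 1))) sums (1 * exp (?l * (z - 1)))"
    by (intro sums_mult2 poisson_sums)
  then show "(\<lambda>k. z ^ k * (?l ^ k / fact k * exp (- ?l))) sums exp (?l * (z - 1))"
    by (simp add: mult_exp_exp algebra_simps exp_minus[symmetric] power_mult_distrib)
qed (use assms in auto)

text \<open>For a step function the sum over points is the combination of counts with weights
  \<open>y i\<close>. The counts are independent, so the expectation factors into Poisson generating
  functions at \<open>exp_neg (y i)\<close>. The value \<open>y i = \<infinity>\<close> is
  allowed.\<close>

lemma laplace_step:
  fixes y :: "nat \<Rightarrow> ennreal"
  assumes B [measurable]: "\<And>i. i < n \<Longrightarrow> B i \<in> sets borel" and bd: "\<And>i. i < n \<Longrightarrow> bounded (B i)"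
    and disj: "disjoint_family_on B {..<n}"
  defines "h \<equiv> \<lambda>x. \<Sum>i<n. y i * indicator (B i) x"
  shows "(\<integral>\<^sup>+\<omega>. ennreal (exp_neg (\<Sum>l. h (X l \<omega>))) \<partial>P) = ennreal (exp_neg (ennreal \<mu> * (\<integral>\<^sup>+x. ennreal (1 - exp_neg (h x)) \<partial>lborel)))"
proof -
  have "AE \<omega> in P. \<forall>i\<in>{..<n}. finite (points_in X (B i) \<omega>)"
    by (rule AE_finite_allI) (auto intro: AE_finite_points B bd)
  then have "AE \<omega> in P. ennreal (exp_neg (\<Sum>l. h (X l \<omega>))) = (\<Prod>i<n. ennreal (exp_neg (y i) ^ count (B i) \<omega>))"
  proof eventually_elim
    case (elim \<omega>)
    have "(\<Sum>l. y i * indicator (B i) (X l \<omega>)) = of_nat (count (B i) \<omega>) * y i" if "i < n" for i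
    proof -
      have "(\<Sum>l. y i * indicator (B i) (X l \<omega>)) = y i * (\<Sum>l. indicator (B i) (X l \<omega>))"
        by simp
      also have "(\<Sum>l. indicator (B i) (X l \<omega>)) = (\<Sum>l\<in>points_in X (B i) \<omega>. indicator (B i) (X l \<omega>) :: ennreal)"
        using elim that by (intro suminf_finite) (auto simp: points_in_def)
      also have "\<dots> = (\<Sum>l\<in>points_in X (B i) \<omega>. 1)"
        by (rule sum.cong) (auto simp: points_in_def)
      finally show ?thesis by (simp add: count_def mult.commute)
    qed
    then have "(\<Sum>l. h (X l \<omega>)) = (\<Sum>i<n. of_nat (count (B i) \<omega>) * y i)"
      unfolding h_def by (subst suminf_sum) auto
    then show ?case
      by (simp add: exp_neg_sum exp_neg_of_nat_mult prod_ennreal)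
  qed
  then have "(\<integral>\<^sup>+\<omega>. ennreal (exp_neg (\<Sum>l. h (X l \<omega>))) \<partial>P) = (\<integral>\<^sup>+\<omega>. (\<Prod>i<n. ennreal (exp_neg (y i) ^ count (B i) \<omega>)) \<partial>P)"
    by (rule nn_integral_cong_AE)
  also have "\<dots> = (\<Prod>i<n. \<integral>\<^sup>+\<omega>. ennreal (exp_neg (y i) ^ count (B i) \<omega>) \<partial>P)"
    by (intro indep_vars_nn_integral indep_vars_compose2[OF indep_counts[OF B bd disj]]) auto
  also have "\<dots> = (\<Prod>i<n. ennreal (exp (\<mu> * measure lborel (B i) * (exp_neg (y i) - 1))))"
    using B bd by (intro prod.cong) (auto intro!: nn_integral_count_pgf)
  also have "\<dots> = ennreal (exp_neg (\<Sum>i<n. ennreal (\<mu> * measure lborel (B i) * (1 - exp_neg (y i)))))"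
  proof -
    have "exp (\<mu> * measure lborel (B i) * (exp_neg (y i) - 1)) = exp_neg (ennreal (\<mu> * measure lborel (B i) * (1 - exp_neg (y i))))" for i
    proof -
      have "0 \<le> \<mu> * measure lborel (B i) * (1 - exp_neg (y i))" using mu_nonneg by simp
      from exp_neg_ennreal[OF this] show ?thesis by (simp add: algebra_simps)
    qed
    then show ?thesis by (simp add: exp_neg_sum prod_ennreal)
  qed
  also have "(\<Sum>i<n. ennreal (\<mu> * measure lborel (B i) * (1 - exp_neg (y i)))) = ennreal \<mu> * (\<Sum>i<n. ennreal (1 - exp_neg (y i)) * emeasure lborel (B i))"
  proof -
    have "emeasure lborel (B i) = ennreal (measure lborel (B i))" if "i < n" for i
      using emeasure_bounded_finite[OF bd[OF that]] by (simp add: emeasure_eq_ennreal_measure)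
    then show ?thesis
      using mu_nonneg by (simp add: sum_distrib_left ennreal_mult'[symmetric] ennreal_mult''[symmetric] mult_ac)
  qed
  also have "(\<Sum>i<n. ennreal (1 - exp_neg (y i)) * emeasure lborel (B i)) = (\<integral>\<^sup>+x. (\<Sum>i<n. ennreal (1 - exp_neg (y i)) * indicator (B i) x) \<partial>lborel)"
    by (subst nn_integral_sum) (auto simp: nn_integral_cmult_indicator)
  \<comment> \<open>The sets are disjoint, so at most one term is present at \<open>x\<close>, and
    \<open>1 - exp_neg\<close> may be taken term by term.\<close>
  also have "\<dots> = (\<integral>\<^sup>+x. ennreal (1 - exp_neg (h x)) \<partial>lborel)"
  proof (rule nn_integral_cong)
    fix x
    show "(\<Sum>i<n. ennreal (1 - exp_neg (y i)) * indicator (B i) x) = ennreal (1 - exp_neg (h x))"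
    proof (cases "\<exists>j<n. x \<in> B j")
      case True
      then obtain j where j: "j < n" "x \<in> B j" by auto
      have "x \<in> B i \<longleftrightarrow> i = j" if "i < n" for i
        using j that disj by (auto simp: disjoint_family_on_def)
      then have *: "(\<Sum>i<n. c i * indicator (B i) x) = c j" for c :: "nat \<Rightarrow> ennreal"
        using j by (subst sum.remove[of _ j]) (auto intro!: sum.neutral)
      show ?thesis unfolding h_def * ..
    next
      case False
      then have *: "(\<Sum>i<n. c i * indicator (B i) x) = 0" for c :: "nat \<Rightarrow> ennreal"
        by (auto intro!: sum.neutral)
      show ?thesis unfolding h_def * by simp
    qed
  qed
  finally show ?thesis .
qed

text \<open>Simple functions increase to \<open>h\<close>. The left side converges because
  \<open>exp_neg\<close> is bounded and continuous, the right side by monotone convergence, so no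
  summability of \<open>h\<close> along the points is required.\<close>

theorem laplace_functional:
  fixes h :: "'b \<Rightarrow> ennreal"
  assumes [measurable]: "h \<in> borel_measurable borel"
  shows "(\<integral>\<omega>. exp_neg (\<Sum>l. h (X l \<omega>)) \<partial>P) = exp_neg (ennreal \<mu> * (\<integral>\<^sup>+x. ennreal (1 - exp_neg (h x)) \<partial>lborel))"
proof -
  obtain \<phi> where \<phi>: "\<And>i. simple_function borel (\<phi> i)" "incseq \<phi>" "\<And>i x. \<phi> i x < top" "\<And>x. (SUP i. \<phi> i x) = h x"
    using borel_measurable_implies_simple_function_sequence'[OF assms] by metis
  note [measurable] = borel_measurable_simple_function[OF \<phi>(1)]
  \<comment> \<open>Cutting off at radius \<open>m\<close> makes the level sets bounded, which is
    where counts are prescribed.\<close>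
  define g where "g m x = \<phi> m x * indicator (ball 0 (real m)) x" for m x
  have g_meas [measurable]: "g m \<in> borel_measurable borel" for m
  proof -
    have [measurable]: "ball 0 (real m) \<in> sets (borel :: 'b measure)" by simp
    show ?thesis unfolding g_def by measurable
  qed
  have incg: "incseq (\<lambda>m. g m x)" for x
    using \<phi>(2) by (auto simp: g_def incseq_def le_fun_def intro!: mult_mono split: split_indicator)
  have g_SUP: "(SUP m. g m x) = h x" for x
  proof (rule antisym)
    show "(SUP m. g m x) \<le> h x"
      unfolding \<phi>(4)[symmetric] by (intro SUP_mono) (auto simp: g_def split: split_indicator)
    show "h x \<le> (SUP m. g m x)"
      unfolding \<phi>(4)[symmetric]
    proof (rule SUP_least)
      fix i
      obtain m where "norm x < real m" using reals_Archimedean2 by blast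
      then have "\<phi> i x \<le> g (max i m) x"
        using \<phi>(2) by (auto simp: g_def incseq_def le_fun_def)
      then show "\<phi> i x \<le> (SUP m. g m x)" by (rule order_trans) (auto intro: SUP_upper)
    qed
  qed
  have g_lim: "(\<lambda>m. g m x) \<longlonglongrightarrow> h x" for x
    using LIMSEQ_SUP[OF incg] by (simp add: g_SUP)
  have step: "(\<integral>\<omega>. exp_neg (\<Sum>l. g m (X l \<omega>)) \<partial>P) = exp_neg (ennreal \<mu> * (\<integral>\<^sup>+x. ennreal (1 - exp_neg (g m x)) \<partial>lborel))" for m
  proof -
    have "finite (range (\<phi> m))" using simple_functionD(1)[OF \<phi>(1)] by simp
    then obtain y where y: "bij_betw y {..<card (range (\<phi> m))} (range (\<phi> m))"
      using ex_bij_betw_nat_finite[of "range (\<phi> m)"] by (auto simp: atLeast0LessThan)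
    define n where "n = card (range (\<phi> m))"
    define B where "B i = \<phi> m -` {y i} \<inter> ball 0 (real m)" for i
    have B: "B i \<in> sets borel" "bounded (B i)" for i
    proof -
      have "\<phi> m -` {y i} \<in> sets borel" using simple_functionD(2)[OF \<phi>(1), of m "{y i}"] by simp
      then show "B i \<in> sets borel" by (simp add: B_def)
      show "bounded (B i)" by (auto simp: B_def intro: bounded_subset[OF bounded_ball])
    qed
    have inj: "inj_on y {..<n}" using y by (simp add: bij_betw_def n_def)
    have "disjoint_family_on B {..<n}"
      using inj by (auto simp: disjoint_family_on_def B_def inj_on_def)
    moreover have "g m = (\<lambda>x. \<Sum>i<n. y i * indicator (B i) x)"
    proof
      fix x
      have "\<phi> m x \<in> y ` {..<n}" using y by (simp add: bij_betw_def n_def)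
      then obtain j where j: "j < n" "\<phi> m x = y j" by auto
      have "(\<Sum>i<n. y i * indicator (B i) x) = y j * indicator (B j) x"
        using j inj by (subst sum.remove[of _ j]) (auto intro!: sum.neutral simp: B_def inj_on_def split: split_indicator)
      also have "\<dots> = g m x" using j by (auto simp: g_def B_def split: split_indicator)
      finally show "g m x = (\<Sum>i<n. y i * indicator (B i) x)" ..
    qed
    ultimately have "(\<integral>\<^sup>+\<omega>. ennreal (exp_neg (\<Sum>l. g m (X l \<omega>))) \<partial>P) = ennreal (exp_neg (ennreal \<mu> * (\<integral>\<^sup>+x. ennreal (1 - exp_neg (g m x)) \<partial>lborel)))"
      using laplace_step[of n B y] B by simp
    then show ?thesis
      by (subst integral_eq_nn_integral) auto
  qed
  have "(\<lambda>m. \<integral>\<omega>. exp_neg (\<Sum>l. g m (X l \<omega>)) \<partial>P) \<longlonglongrightarrow> (\<integral>\<omega>. exp_neg (\<Sum>l. h (X l \<omega>)) \<partial>P)"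
  proof (rule integral_dominated_convergence[where w="\<lambda>_. 1"])
    show "AE \<omega> in P. (\<lambda>m. exp_neg (\<Sum>l. g m (X l \<omega>))) \<longlonglongrightarrow> exp_neg (\<Sum>l. h (X l \<omega>))"
    proof (rule AE_I2, rule tendsto_exp_neg)
      fix \<omega>
      have "incseq (\<lambda>m. \<Sum>l. g m (X l \<omega>))"
        using incg by (auto simp: incseq_def intro!: suminf_le)
      from LIMSEQ_SUP[OF this] show "(\<lambda>m. \<Sum>l. g m (X l \<omega>)) \<longlonglongrightarrow> (\<Sum>l. h (X l \<omega>))"
        by (simp add: g_SUP[symmetric] ennreal_suminf_SUP_eq[OF incg])
    qed
  qed auto
  moreover have "(\<lambda>m. exp_neg (ennreal \<mu> * (\<integral>\<^sup>+x. ennreal (1 - exp_neg (g m x)) \<partial>lborel))) 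
      \<longlonglongrightarrow> exp_neg (ennreal \<mu> * (\<integral>\<^sup>+x. ennreal (1 - exp_neg (h x)) \<partial>lborel))"
  proof (intro tendsto_exp_neg ennreal_tendsto_cmult nn_integral_LIMSEQ)
    show "incseq (\<lambda>m x. ennreal (1 - exp_neg (g m x)))"
      using incg by (auto simp: incseq_def le_fun_def intro!: ennreal_leI exp_neg_antimono)
    show "(\<lambda>m. ennreal (1 - exp_neg (g m x))) \<longlonglongrightarrow> ennreal (1 - exp_neg (h x))" for x
      by (intro tendsto_intros tendsto_ennrealI tendsto_exp_neg g_lim)
  qed auto
  ultimately show ?thesis
    unfolding step by (rule LIMSEQ_unique)
qed

end

section \<open>Second factorial moments and the tail of the interference\<close>

text \<open>By monotonicity the pair \<open>(n, m)\<close> is dominated by the diagonal entry at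
  \<open>max n m\<close>.\<close>

lemma SUP_mult_incseq_ennreal:
  fixes f g :: "nat \<Rightarrow> ennreal"
  assumes "incseq f" "incseq g"
  shows "(SUP n. f n * g n) = (SUP n. f n) * (SUP n. g n)"
proof (rule antisym)
  show "(SUP n. f n * g n) \<le> (SUP n. f n) * (SUP n. g n)"
    by (intro SUP_least mult_mono) (auto intro: SUP_upper)
  have "f n * g m \<le> (SUP n. f n * g n)" for n m
  proof -
    have "f n * g m \<le> f (max n m) * g (max n m)"
      using assms by (intro mult_mono) (auto simp: incseq_def)
    then show ?thesis by (rule order_trans) (auto intro: SUP_upper)
  qed
  then show "(SUP n. f n) * (SUP n. g n) \<le> (SUP n. f n * g n)"
    by (auto simp: SUP_mult_left_ennreal SUP_mult_right_ennreal intro!: SUP_least)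
qed

definition pairs :: "(nat \<times> nat) set" where
  "pairs = {p. fst p \<noteq> snd p}"

text \<open>The right side is arranged so that the first two products concern disjoint sets, to
  which independence of counts applies, while the last is a factorial moment of a single
  count.\<close>

lemma card_pairs_Times:
  assumes "finite S" "finite T"
  shows "finite (pairs \<inter> S \<times> T)"
    and "real (card (pairs \<inter> S \<times> T)) = real (card (S - T)) * real (card T) 
       + (real (card (S \<inter> T)) * real (card (T - S)) + real (card (S \<inter> T)) * (real (card (S \<inter> T)) - 1))"
proof -
  show "finite (pairs \<inter> S \<times> T)" using assms by auto
  let ?I = "S \<inter> T"
  have "card (?I \<times> ?I - (\<lambda>i. (i, i)) ` ?I) = card (?I \<times> ?I) - card ((\<lambda>i. (i, i)) ` ?I)"
    using assms by (intro card_Diff_subset) auto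
  also have "card ((\<lambda>i. (i, i)) ` ?I) = card ?I" by (intro card_image) (auto simp: inj_on_def)
  also have "card (?I \<times> ?I) - card ?I = card ?I * (card ?I - 1)"
    by (simp add: card_cartesian_product right_diff_distrib')
  finally have d: "real (card (?I \<times> ?I - (\<lambda>i. (i, i)) ` ?I)) = real (card ?I) * (real (card ?I) - 1)"
    by (cases "card ?I") (auto simp: algebra_simps)
  have "pairs \<inter> S \<times> T = (S - T) \<times> T \<union> (?I \<times> (T - S) \<union> (?I \<times> ?I - (\<lambda>i. (i, i)) ` ?I))"
    by (auto simp: pairs_def)
  also have "real (card \<dots>) = real (card ((S - T) \<times> T)) + (real (card (?I \<times> (T - S))) + real (card (?I \<times> ?I - (\<lambda>i. (i, i)) ` ?I)))"
  proof -
    have "card (?I \<times> (T - S) \<union> (?I \<times> ?I - (\<lambda>i. (i, i)) ` ?I)) = card (?I \<times> (T - S)) + card (?I \<times> ?I - (\<lambda>i. (i, i)) ` ?I)"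
      using assms by (intro card_Un_disjoint) auto
    moreover have "card ((S - T) \<times> T \<union> (?I \<times> (T - S) \<union> (?I \<times> ?I - (\<lambda>i. (i, i)) ` ?I))) =
      card ((S - T) \<times> T) + card (?I \<times> (T - S) \<union> (?I \<times> ?I - (\<lambda>i. (i, i)) ` ?I))"
      using assms by (intro card_Un_disjoint) auto
    ultimately show ?thesis by (simp only: of_nat_add)
  qed
  finally show "real (card (pairs \<inter> S \<times> T)) = real (card (S - T)) * real (card T) 
       + (real (card (S \<inter> T)) * real (card (T - S)) + real (card (S \<inter> T)) * (real (card (S \<inter> T)) - 1))"
    by (simp add: d card_cartesian_product)
qed

section \<open>Second factorial moment measure of the process\<close>

context PPP begin

lemma nn_integral_count_mult:
  assumes [measurable]: "A \<in> sets borel" "B \<in> sets borel" and bd: "bounded A" "bounded B" and "A \<inter> B = {}"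
  shows "(\<integral>\<^sup>+\<omega>. ennreal (real (count A \<omega>)) * ennreal (real (count B \<omega>)) \<partial>P) = ennreal (\<mu> * measure lborel A) * ennreal (\<mu> * measure lborel B)"
proof -
  let ?C = "\<lambda>i::nat. if i = 0 then A else B"
  have "indep_vars (\<lambda>_. count_space UNIV) (\<lambda>i. count (?C i)) {..<2}"
    using assms by (intro indep_counts) (auto simp: disjoint_family_on_def less_2_cases_iff)
  then have "indep_vars (\<lambda>_. borel) (\<lambda>i \<omega>. ennreal (real (count (?C i) \<omega>))) {..<2}"
    by (rule indep_vars_compose2) auto
  then have "(\<integral>\<^sup>+\<omega>. (\<Prod>i<2. ennreal (real (count (?C i) \<omega>))) \<partial>P) = (\<Prod>i<2. \<integral>\<^sup>+\<omega>. ennreal (real (count (?C i) \<omega>)) \<partial>P)"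
    by (intro indep_vars_nn_integral) auto
  moreover have "(\<integral>\<^sup>+\<omega>. ennreal (real (count S \<omega>)) \<partial>P) = ennreal (\<mu> * measure lborel S)" 
    if "S \<in> sets borel" "bounded S" for S
    using nn_integral_count[OF that, of real, OF _ poisson_sums(2)] by simp
  ultimately show ?thesis using bd
    by (simp add: numeral_2_eq_2)
qed

text \<open>The left side is the expected number of ordered pairs of distinct points in
  \<open>A\<close> and \<open>B\<close>. Nothing is known about individual points
  \<open>X l\<close>, so the pairs are counted through \<open>A - B\<close>, \<open>B - A\<close>
  and the overlap. The Poisson factorial moment of the overlap is exactly the square that completes
  the product.\<close>

lemma factorial_moment_bounded:
  assumes [measurable]: "A \<in> sets borel" "B \<in> sets borel" and bd: "bounded A" "bounded B"
  shows "(\<integral>\<^sup>+p. emeasure P {\<omega> \<in> space P. X (fst p) \<omega> \<in> A \<and> X (snd p) \<omega> \<in> B} \<partial>count_space pairs)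
    = ennreal (\<mu> * measure lborel A) * ennreal (\<mu> * measure lborel B)"
proof -
  let ?m = "\<lambda>S. ennreal (\<mu> * measure lborel S)"
  let ?c = "\<lambda>S \<omega>. real (count S \<omega>)"
  let ?F = "\<lambda>p \<omega>. indicator A (X (fst p) \<omega>) * indicator B (X (snd p) \<omega>) :: ennreal"
  let ?C = "A \<inter> B"
  have bd': "bounded (A - B)" "bounded (B - A)" "bounded ?C"
    using bd by (auto intro: bounded_subset)
  note [measurable] = count_measurable[OF _ bd(2)] count_measurable[OF _ bd'(1)] count_measurable[OF _ bd'(2)] count_measurable[OF _ bd'(3)]
  have "(\<integral>\<^sup>+p. emeasure P {\<omega> \<in> space P. X (fst p) \<omega> \<in> A \<and> X (snd p) \<omega> \<in> B} \<partial>count_space pairs)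
    = (\<integral>\<^sup>+p. (\<integral>\<^sup>+\<omega>. ?F p \<omega> \<partial>P) \<partial>count_space pairs)"
    by (intro nn_integral_cong emeasure_Collect_eq_nn_integral) (auto split: split_indicator)
  also have "\<dots> = (\<integral>\<^sup>+\<omega>. (\<integral>\<^sup>+p. ?F p \<omega> \<partial>count_space pairs) \<partial>P)"
    by (subst nn_integral_count_space_nn_integral) auto
  also have "\<dots> = (\<integral>\<^sup>+\<omega>. ennreal (?c (A - B) \<omega>) * ennreal (?c B \<omega>)
       + (ennreal (?c ?C \<omega>) * ennreal (?c (B - A) \<omega>) + ennreal (?c ?C \<omega> * (?c ?C \<omega> - 1))) \<partial>P)"
  proof (rule nn_integral_cong_AE)
    show "AE \<omega> in P. (\<integral>\<^sup>+p. ?F p \<omega> \<partial>count_space pairs) = ennreal (?c (A - B) \<omega>) * ennreal (?c B \<omega>)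
       + (ennreal (?c ?C \<omega>) * ennreal (?c (B - A) \<omega>) + ennreal (?c ?C \<omega> * (?c ?C \<omega> - 1)))"
      using AE_finite_points[OF assms(1) bd(1)] AE_finite_points[OF assms(2) bd(2)]
    proof eventually_elim
      case (elim \<omega>)
      let ?S = "points_in X A \<omega>" and ?T = "points_in X B \<omega>"
      have "(\<integral>\<^sup>+p. ?F p \<omega> \<partial>count_space pairs) = (\<integral>\<^sup>+p. indicator (pairs \<inter> ?S \<times> ?T) p \<partial>count_space pairs)"
        by (intro nn_integral_cong) (auto simp: points_in_def split: split_indicator)
      also have "\<dots> = ennreal (real (card (pairs \<inter> ?S \<times> ?T)))"
        using card_pairs_Times(1)[OF elim] by (simp add: ennreal_of_nat_eq_real_of_nat)
      finally have *: "(\<integral>\<^sup>+p. ?F p \<omega> \<partial>count_space pairs) = \<dots>" .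
      have "?S - ?T = points_in X (A - B) \<omega>" "?T - ?S = points_in X (B - A) \<omega>" "?S \<inter> ?T = points_in X ?C \<omega>"
        by (auto simp: points_in_def)
      moreover have "0 \<le> real k * (real k - 1)" for k by (cases k) auto
      ultimately show ?case
        unfolding * card_pairs_Times(2)[OF elim] by (simp add: count_def ennreal_mult ennreal_plus)
    qed
  qed
  also have "\<dots> = ?m (A - B) * ?m B + (?m ?C * ?m (B - A) + ?m ?C * ?m ?C)"
  proof -
    have "(\<integral>\<^sup>+\<omega>. ennreal (?c ?C \<omega> * (?c ?C \<omega> - 1)) \<partial>P) = ennreal ((\<mu> * measure lborel ?C)\<^sup>2)"
    proof (rule nn_integral_count[OF _ bd'(3) _ poisson_sums(3)])
      show "0 \<le> real k * (real k - 1)" for k by (cases k) auto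
    qed auto
    also have "\<dots> = ?m ?C * ?m ?C"
      using mu_nonneg by (simp add: power2_eq_square ennreal_mult)
    moreover have "(\<integral>\<^sup>+\<omega>. ennreal (?c (A - B) \<omega>) * ennreal (?c B \<omega>) \<partial>P) = ?m (A - B) * ?m B"
      "(\<integral>\<^sup>+\<omega>. ennreal (?c ?C \<omega>) * ennreal (?c (B - A) \<omega>) \<partial>P) = ?m ?C * ?m (B - A)"
      using bd bd' by (auto intro!: nn_integral_count_mult)
    ultimately show ?thesis
      by (simp add: nn_integral_add)
  qed
  also have "\<dots> = ?m A * ?m B"
  proof -
    have add: "?m S = ?m (S - T) + ?m (S \<inter> T)" if [measurable]: "S \<in> sets borel" "T \<in> sets borel" and "bounded S" for S T
    proof -
      have "measure lborel S = measure lborel ((S - T) \<union> (S \<inter> T))" by (intro arg_cong[where f="measure lborel"]) auto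
      also have "\<dots> = measure lborel (S - T) + measure lborel (S \<inter> T)"
        using emeasure_bounded_finite[of "S - T"] emeasure_bounded_finite[of "S \<inter> T"] that
        by (intro measure_Union) (auto simp: bounded_Int bounded_diff less_top)
      finally show ?thesis using mu_nonneg by (simp add: distrib_left ennreal_plus)
    qed
    have "?m A = ?m (A - B) + ?m (A \<inter> B)" "?m B = ?m (B - A) + ?m (A \<inter> B)"
      using add[of A B] add[of B A] bd by (simp_all add: Int_commute)
    then show ?thesis by (simp add: algebra_simps)
  qed
  finally show ?thesis .
qed

text \<open>The expected counting measure \<open>Q\<close> of pairs agrees with
  \<open>L \<Otimes>\<^sub>M L\<close> on rectangles, and these determine it because
  \<open>L\<close> is sigma-finite. Products of functions are then integrated by Tonelli.\<close>

theorem second_factorial_moment: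
  fixes a b :: "'b \<Rightarrow> ennreal"
  assumes [measurable]: "a \<in> borel_measurable borel" "b \<in> borel_measurable borel"
  shows "(\<integral>\<^sup>+\<omega>. (\<integral>\<^sup>+p. a (X (fst p) \<omega>) * b (X (snd p) \<omega>) \<partial>count_space pairs) \<partial>P)
    = (ennreal \<mu> * (\<integral>\<^sup>+x. a x \<partial>lborel)) * (ennreal \<mu> * (\<integral>\<^sup>+x. b x \<partial>lborel))"
proof -
  define L :: "'b measure" where "L = density lborel (\<lambda>_. ennreal \<mu>)"
  define C where "C = count_space pairs \<Otimes>\<^sub>M P"
  define T where "T z = (X (fst (fst z)) (snd z), X (snd (fst z)) (snd z))" for z
  have [measurable]: "T \<in> measurable C (borel \<Otimes>\<^sub>M borel)"
    unfolding C_def T_def by (intro measurable_pair_measure_countable1) auto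
  define Q where "Q = distr C (borel \<Otimes>\<^sub>M borel) T"
  have Q: "(\<integral>\<^sup>+z. f z \<partial>Q) = (\<integral>\<^sup>+p. (\<integral>\<^sup>+\<omega>. f (X (fst p) \<omega>, X (snd p) \<omega>) \<partial>P) \<partial>count_space pairs)"
    if [measurable]: "f \<in> borel_measurable (borel \<Otimes>\<^sub>M borel)" for f
  proof -
    have "(\<integral>\<^sup>+z. f z \<partial>Q) = (\<integral>\<^sup>+z. f (T z) \<partial>C)"
      unfolding Q_def by (rule nn_integral_distr) auto
    also have "\<dots> = (\<integral>\<^sup>+p. (\<integral>\<^sup>+\<omega>. f (T (p, \<omega>)) \<partial>P) \<partial>count_space pairs)"
      using nn_integral_fst[of "\<lambda>z. f (T z)" "count_space pairs"] by (simp add: C_def[symmetric])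
    finally show ?thesis by (simp add: T_def)
  qed
  have eQ: "emeasure Q (A \<times> B) = (\<integral>\<^sup>+p. emeasure P {\<omega> \<in> space P. X (fst p) \<omega> \<in> A \<and> X (snd p) \<omega> \<in> B} \<partial>count_space pairs)"
    if [measurable]: "A \<in> sets borel" "B \<in> sets borel" for A B
  proof -
    have "emeasure Q (A \<times> B) = (\<integral>\<^sup>+z. indicator (A \<times> B) z \<partial>Q)"
      by (subst nn_integral_indicator) (auto simp: Q_def)
    also have "\<dots> = (\<integral>\<^sup>+p. (\<integral>\<^sup>+\<omega>. indicator (A \<times> B) (X (fst p) \<omega>, X (snd p) \<omega>) \<partial>P) \<partial>count_space pairs)"
      by (rule Q) auto
    finally show ?thesis
      by (auto intro!: nn_integral_cong emeasure_Collect_eq_nn_integral[symmetric] split: split_indicator)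
  qed
  have sets_L [simp]: "sets L = sets borel" by (simp add: L_def)
  have eL: "emeasure L A = ennreal \<mu> * emeasure lborel A" if "A \<in> sets borel" for A
    using that by (simp add: L_def emeasure_density nn_integral_cmult_indicator)
  have eLb: "emeasure L A = ennreal (\<mu> * measure lborel A)" if "A \<in> sets borel" "bounded A" for A
    using emeasure_bounded_finite[OF that(2)] mu_nonneg 
    by (simp add: eL[OF that(1)] emeasure_eq_ennreal_measure ennreal_mult)
  have sf: "sigma_finite_measure L"
    unfolding L_def by (subst sigma_finite_measure.sigma_finite_iff_density_finite[OF sigma_finite_lborel]) auto
  interpret L: sigma_finite_measure L by (rule sf)
  have "L \<Otimes>\<^sub>M L = Q"
  proof (rule pair_measure_eqI[OF sf sf])
    show "sets (L \<Otimes>\<^sub>M L) = sets Q" by (simp add: Q_def cong: sets_pair_measure_cong)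
    fix A B assume "A \<in> sets L" "B \<in> sets L"
    then have [measurable]: "A \<in> sets borel" "B \<in> sets borel" by auto
    \<comment> \<open>Arbitrary rectangles are exhausted by bounded ones, for which the formula is
      already available.\<close>
    define D where "D S n = S \<inter> ball 0 (real n)" for S :: "'b set" and n
    have D: "D S n \<in> sets borel" "bounded (D S n)" if "S \<in> sets borel" for S n
      using that by (auto simp: D_def intro: bounded_Int)
    have incD: "incseq (D S)" for S by (force simp: D_def incseq_def)
    have UD: "(\<Union>n. D S n) = S" for S
      by (auto simp: D_def) (metis reals_Archimedean2)
    have conv: "(\<lambda>n. emeasure L (D S n)) \<longlonglongrightarrow> emeasure L S" if "S \<in> sets borel" for S
      using Lim_emeasure_incseq[of "D S" L] incD D[OF that] UD by auto
    have inc: "incseq (\<lambda>n. emeasure L (D S n))" if "S \<in> sets borel" for S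
      using incD[of S] D[OF that] by (auto simp: incseq_def intro!: emeasure_mono)
    have "emeasure Q (A \<times> B) = (SUP n. emeasure Q (D A n \<times> D B n))"
    proof (subst SUP_emeasure_incseq)
      show "range (\<lambda>n. D A n \<times> D B n) \<subseteq> sets Q" using D by (auto simp: Q_def)
      show inc: "incseq (\<lambda>n. D A n \<times> D B n)" using incD[of A] incD[of B] by (fastforce simp: incseq_def)
      have "(\<Union>n. D A n \<times> D B n) = A \<times> B"
      proof safe
        fix x y assume "x \<in> A" "y \<in> B"
        then obtain n m where "x \<in> D A n" "y \<in> D B m" using UD[of A] UD[of B] by blast
        then have "x \<in> D A (max n m)" "y \<in> D B (max n m)"
          using incseqD[OF incD[of A], of n "max n m"] incseqD[OF incD[of B], of m "max n m"] by auto
        then show "(x, y) \<in> (\<Union>n. D A n \<times> D B n)" by auto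
      qed (auto simp: D_def)
      then show "emeasure Q (A \<times> B) = emeasure Q (\<Union>n. D A n \<times> D B n)" by simp
    qed
    also have "\<dots> = (SUP n. emeasure L (D A n) * emeasure L (D B n))"
      using D by (simp add: eQ factorial_moment_bounded eLb)
    also have "\<dots> = (SUP n. emeasure L (D A n)) * (SUP n. emeasure L (D B n))"
      using inc by (intro SUP_mult_incseq_ennreal) auto
    also have "\<dots> = emeasure L A * emeasure L B"
      using LIMSEQ_SUP[OF inc] conv by (metis LIMSEQ_unique \<open>A \<in> sets borel\<close> \<open>B \<in> sets borel\<close>)
    finally show "emeasure L A * emeasure L B = emeasure Q (A \<times> B)" ..
  qed
  have "(\<integral>\<^sup>+\<omega>. (\<integral>\<^sup>+p. a (X (fst p) \<omega>) * b (X (snd p) \<omega>) \<partial>count_space pairs) \<partial>P)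
    = (\<integral>\<^sup>+p. (\<integral>\<^sup>+\<omega>. a (X (fst p) \<omega>) * b (X (snd p) \<omega>) \<partial>P) \<partial>count_space pairs)"
    by (subst nn_integral_count_space_nn_integral) auto
  also have "\<dots> = (\<integral>\<^sup>+z. a (fst z) * b (snd z) \<partial>(L \<Otimes>\<^sub>M L))"
    unfolding \<open>L \<Otimes>\<^sub>M L = Q\<close> by (subst Q) auto
  also have "\<dots> = (\<integral>\<^sup>+x. (\<integral>\<^sup>+y. a x * b y \<partial>L) \<partial>L)"
    by (subst L.nn_integral_fst[symmetric]) (auto simp: measurable_cong_sets[OF sets_pair_measure_cong[OF sets_L sets_L] refl])
  also have "\<dots> = (\<integral>\<^sup>+x. a x \<partial>L) * (\<integral>\<^sup>+y. b y \<partial>L)"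
    by (simp add: nn_integral_cmult nn_integral_multc measurable_cong_sets[OF sets_L refl])
  also have "(\<integral>\<^sup>+x. a x \<partial>L) = ennreal \<mu> * (\<integral>\<^sup>+x. a x \<partial>lborel)"
    by (simp add: L_def nn_integral_density nn_integral_cmult)
  also have "(\<integral>\<^sup>+x. b x \<partial>L) = ennreal \<mu> * (\<integral>\<^sup>+x. b x \<partial>lborel)"
    by (simp add: L_def nn_integral_density nn_integral_cmult)
  finally show ?thesis .
qed

end

lemma ennreal_le_suminf: "f i \<le> (\<Sum>i. f i)" for f :: "nat \<Rightarrow> ennreal"
  using sum_le_suminf[of f "{i}"] by simp

lemma nn_integral_pairs:
  "(\<integral>\<^sup>+p. F (fst p) (snd p) \<partial>count_space pairs) = (\<Sum>i. \<Sum>j. if i = j then 0 else F i j)"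
proof -
  have "(\<integral>\<^sup>+p. F (fst p) (snd p) \<partial>count_space pairs) = (\<integral>\<^sup>+p. F (fst p) (snd p) * indicator pairs p \<partial>count_space UNIV)"
    by (simp add: nn_integral_count_space_indicator)
  also have "\<dots> = (\<integral>\<^sup>+i. \<integral>\<^sup>+j. F i j * indicator pairs (i, j) \<partial>count_space UNIV \<partial>count_space UNIV)"
    by (subst nn_integral_fst_count_space[symmetric]) simp
  also have "\<dots> = (\<Sum>i. \<Sum>j. if i = j then 0 else F i j)"
    by (auto simp: nn_integral_count_space_nat pairs_def indicator_def intro!: suminf_cong)
  finally show ?thesis .
qed

text \<open>The exponent starts at 2 so that the shells
  \<open>{1 - 2 * shell_width k <.. 1 - shell_width k}\<close> tile the open interval from 1/2 to 1;
  the first one ends at 3/4.\<close>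

definition shell_width :: "nat \<Rightarrow> real" where
  "shell_width k = (1 / 2) ^ (k + 2)"

lemma shell_width: "0 < shell_width k" "shell_width k \<le> 1 / 4"
  using power_le_one[of "1/2 :: real" k] by (simp_all add: shell_width_def)

text \<open>If all terms are below 1 but the sum exceeds 1, then at least two terms matter: either all
  are at most 1/2, or one of them lies in a shell at distance about \<open>shell_width k\<close> below 1
  and the others make up for that distance.\<close>

definition shell_pairs :: "nat \<Rightarrow> real \<Rightarrow> real \<Rightarrow> ennreal" where
  "shell_pairs k u v = indicator {1 - 2 * shell_width k <.. 1 - shell_width k} u * ennreal (min 1 (1 / shell_width k * v))"

definition small_pairs :: "real \<Rightarrow> real \<Rightarrow> ennreal" where
  "small_pairs u v = ennreal (2 * u) * indicator {..1 / 2} u * (ennreal v * indicator {..1 / 2} v)"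

lemma exists_pair_contribution:
  fixes f :: "nat \<Rightarrow> real"
  assumes f: "\<And>l. 0 \<le> f l" "\<And>l. f l < 1" and gt: "1 < (\<Sum>l. ennreal (f l))" and fin: "(\<Sum>l. ennreal (f l)) < \<infinity>"
  shows "1 \<le> (\<Sum>k. \<integral>\<^sup>+p. shell_pairs k (f (fst p)) (f (snd p)) \<partial>count_space pairs)
    + (\<integral>\<^sup>+p. small_pairs (f (fst p)) (f (snd p)) \<partial>count_space pairs)"
proof -
  have summ: "summable f" using f fin by (intro summable_suminf_not_top) auto
  define S where "S = suminf f"
  have "(\<Sum>l. ennreal (f l)) = ennreal S"
    using f summ by (simp add: S_def suminf_ennreal2)
  then have S: "1 < S" using gt by (simp add: ennreal_less_iff flip: ennreal_1)
  have rest: "(\<lambda>j. if i = j then 0 else f j) sums (S - f i)" for i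
  proof -
    have "(\<lambda>j. f j - (if j = i then f j else 0)) sums (S - f i)"
      using summ by (intro sums_diff sums_single) (simp add: S_def summable_sums)
    then show ?thesis by (rule sums_cong[THEN iffD1, rotated]) auto
  qed
  show ?thesis
  proof (cases "\<forall>i. f i \<le> 1 / 2")
    case True
    \<comment> \<open>Removing a term of at most 1/2 leaves a remainder above 1/2, and the factor 2
      in \<open>small_pairs\<close> compensates for that. Summing over \<open>i\<close> then
      recovers at least \<open>S\<close>.\<close>
    have "1 \<le> ennreal S" using S by simp
    also have "\<dots> = (\<Sum>i. ennreal (f i))" using f summ by (simp add: S_def suminf_ennreal2)
    also have "\<dots> \<le> (\<Sum>i. \<Sum>j. if i = j then 0 else small_pairs (f i) (f j))"
    proof (rule suminf_le)
      fix i
      have "(\<Sum>j. if i = j then 0 else small_pairs (f i) (f j)) = (\<Sum>j. ennreal (2 * f i) * ennreal (if i = j then 0 else f j))"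
        using True by (intro suminf_cong) (auto simp: small_pairs_def)
      also have "\<dots> = ennreal (2 * f i) * ennreal (S - f i)"
      proof -
        have "(\<Sum>j. ennreal (if i = j then 0 else f j)) = ennreal (S - f i)"
          using f by (intro suminf_ennreal_eq rest) auto
        then show ?thesis by (simp only: ennreal_suminf_cmult)
      qed
      also have "\<dots> = ennreal (2 * f i * (S - f i))"
        using f by (simp add: ennreal_mult')
      also have "\<dots> \<ge> ennreal (f i)"
      proof (rule ennreal_leI)
        have "f i * 1 \<le> f i * (2 * (S - f i))"
          using S True[rule_format, of i] f by (intro mult_left_mono) auto
        then show "f i \<le> 2 * f i * (S - f i)" by (simp only: mult_1_right mult_ac)
      qed
      finally show "ennreal (f i) \<le> (\<Sum>j. if i = j then 0 else small_pairs (f i) (f j))" .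
    qed auto
    also have "\<dots> = (\<integral>\<^sup>+p. small_pairs (f (fst p)) (f (snd p)) \<partial>count_space pairs)"
      by (rule nn_integral_pairs[symmetric])
    finally show ?thesis by (rule order_trans) simp
  next
    case False
    then obtain i where i: "1 / 2 < f i" by (auto simp: not_le)
    have "\<exists>n. (1 / 2) ^ n \<le> 1 - f i"
      using real_arch_pow_inv[of "1 - f i" "1/2"] f(2)[of i] by (auto intro: less_imp_le)
    \<comment> \<open>The distance of \<open>f i\<close> to 1 lies strictly between 0 and 1/2, so
      the least dyadic power below it has exponent at least 2; the excess over 2 is the index of the
      shell.\<close>
    define n where "n = (LEAST n. (1 / 2) ^ n \<le> 1 - f i)"
    have n: "(1 / 2) ^ n \<le> 1 - f i"
      unfolding n_def using \<open>\<exists>n. (1 / 2) ^ n \<le> 1 - f i\<close> by (rule LeastI_ex)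
    have "2 \<le> n"
    proof (rule ccontr)
      assume "\<not> 2 \<le> n"
      then have "n = 0 \<or> n = 1" by auto
      then show False using n i f(1)[of i] by auto
    qed
    then obtain k where k: "n = k + 2" by (metis add.commute le_Suc_ex)
    have "k + 1 < (LEAST n. (1 / 2) ^ n \<le> 1 - f i)" using k by (simp add: n_def)
    then have "1 - f i < (1 / 2) ^ (k + 1)" by (auto dest!: not_less_Least)
    then have in_shell: "f i \<in> {1 - 2 * shell_width k <.. 1 - shell_width k}"
      using n by (auto simp: shell_width_def k)
    let ?e = "shell_width k"
    have e: "0 < ?e" "?e \<le> 1 - f i" using shell_width in_shell by auto
    \<comment> \<open>Either another term alone saturates the minimum, or no minimum is active and
      the linear terms add up to \<open>(S - f i) / shell_width k\<close>, which is at least 1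
      because \<open>S > 1\<close>.\<close>
    have "1 \<le> (\<Sum>j. ennreal (if i = j then 0 else min 1 (1 / ?e * f j)))"
    proof (cases "\<exists>j. j \<noteq> i \<and> ?e \<le> f j")
      case True
      then obtain j where j: "j \<noteq> i" "?e \<le> f j" by auto
      have "1 = ennreal (if i = j then 0 else min 1 (1 / ?e * f j))"
        using j e by (simp add: min_def field_simps)
      also have "\<dots> \<le> (\<Sum>j. ennreal (if i = j then 0 else min 1 (1 / ?e * f j)))"
        by (rule ennreal_le_suminf)
      finally show ?thesis .
    next
      case False
      then have "(if i = j then 0 else min 1 (1 / ?e * f j)) = 1 / ?e * (if i = j then 0 else f j)" for j
        using e by (auto simp: min_def field_simps not_le)
      moreover have "(\<Sum>j. ennreal (1 / ?e * (if i = j then 0 else f j))) = ennreal (1 / ?e * (S - f i))"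
        using e f by (intro suminf_ennreal_eq sums_mult rest) auto
      moreover have "1 \<le> 1 / ?e * (S - f i)" using e S by (simp add: field_simps)
      ultimately show ?thesis by (simp add: ennreal_leI flip: ennreal_1)
    qed
    also have "\<dots> = (\<Sum>j. if i = j then 0 else shell_pairs k (f i) (f j))"
      using in_shell by (intro suminf_cong) (auto simp: shell_pairs_def)
    also have "\<dots> \<le> (\<Sum>i. \<Sum>j. if i = j then 0 else shell_pairs k (f i) (f j))"
      by (rule ennreal_le_suminf)
    also have "\<dots> = (\<integral>\<^sup>+p. shell_pairs k (f (fst p)) (f (snd p)) \<partial>count_space pairs)"
      by (rule nn_integral_pairs[symmetric])
    also have "\<dots> \<le> (\<Sum>k. \<integral>\<^sup>+p. shell_pairs k (f (fst p)) (f (snd p)) \<partial>count_space pairs)"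
      by (rule ennreal_le_suminf)
    finally show ?thesis by (rule order_trans) simp
  qed
qed

text \<open>The expected pair contribution at intensity 1, already factored by the second factorial
  moment formula. At intensity \<open>\<mu>\<close> it is multiplied by the square of
  \<open>\<mu>\<close>, which makes it the constant of the quadratic error.\<close>

definition pair_bound :: "real \<Rightarrow> ennreal" where
  "pair_bound \<alpha> = (\<Sum>k. (\<integral>\<^sup>+x. indicator {1 - 2 * shell_width k <.. 1 - shell_width k} (path_loss \<alpha> x) \<partial>lborel)
       * (\<integral>\<^sup>+x. ennreal (min 1 (1 / shell_width k * path_loss \<alpha> x)) \<partial>lborel))
     + (\<integral>\<^sup>+x. ennreal (2 * path_loss \<alpha> x) * indicator {..1 / 2} (path_loss \<alpha> x) \<partial>lborel)
       * (\<integral>\<^sup>+x. ennreal (path_loss \<alpha> x) * indicator {..1 / 2} (path_loss \<alpha> x) \<partial>lborel)"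

text \<open>A shell of width \<open>w\<close> has area of order \<open>w\<close>, while the integral
  over the partner grows like \<open>w powr (- (2 / \<alpha>))\<close>. The product
  \<open>w powr (1 - 2 / \<alpha>)\<close> is geometric in the index of the shell.\<close>

lemma pair_bound_finite:
  assumes "2 < \<alpha>"
  shows "pair_bound \<alpha> < \<infinity>"
proof -
  let ?S = "\<lambda>k. \<integral>\<^sup>+x. indicator {1 - 2 * shell_width k <.. 1 - shell_width k} (path_loss \<alpha> x) \<partial>lborel"
  let ?T = "\<lambda>k. \<integral>\<^sup>+x. ennreal (min 1 (1 / shell_width k * path_loss \<alpha> x)) \<partial>lborel"
  let ?U = "\<integral>\<^sup>+x. ennreal (path_loss \<alpha> x) * indicator {..1 / 2} (path_loss \<alpha> x) \<partial>lborel" and ?V = "\<integral>\<^sup>+x. ennreal (2 * path_loss \<alpha> x) * indicator {..1 / 2} (path_loss \<alpha> x) \<partial>lborel"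
  let ?C = "\<integral>\<^sup>+x. ennreal (min 1 (path_loss \<alpha> x)) \<partial>lborel"
  have C: "?C < \<infinity>" by (rule nn_integral_min_path_loss_finite[OF assms])
  let ?d = "2 / \<alpha>"
  have d: "0 < ?d" "?d < 1" using assms by auto
  have "?U \<le> ?C"
    by (intro nn_integral_mono) (auto intro!: ennreal_leI split: split_indicator)
  moreover have "?V \<le> (\<integral>\<^sup>+x. 2 * ennreal (min 1 (path_loss \<alpha> x)) \<partial>lborel)"
    by (intro nn_integral_mono) (auto intro!: ennreal_leI simp: ennreal_mult' split: split_indicator)
  ultimately have "?V * ?U \<le> (2 * ?C) * ?C"
    by (intro mult_mono) (auto simp: nn_integral_cmult)
  also have "\<dots> < \<infinity>" using C by (simp add: ennreal_mult_less_top)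
  finally have small: "?V * ?U < \<infinity>" .
  define q :: real where "q = (1 / 2) powr (1 - ?d)"
  have q: "0 < q" "q < 1"
  proof -
    have "(1 / 2 :: real) powr (1 - ?d) < (1/2) powr 0" using d by (intro powr_less_mono') auto
    then show "q < 1" by (simp add: q_def)
  qed (simp add: q_def)
  have "?S k * ?T k \<le> ennreal (4 * pi * q ^ (k + 2)) * ?C" for k
  proof -
    let ?e = "shell_width k"
    have "?S k
       \<le> (\<integral>\<^sup>+x. indicator {x. 1 - 2 * ?e < path_loss \<alpha> x \<and> path_loss \<alpha> x \<le> 1} x \<partial>lborel)"
      using shell_width[of k] by (intro nn_integral_mono) (auto split: split_indicator)
    also have "\<dots> = emeasure lborel {x. 1 - 2 * ?e < path_loss \<alpha> x \<and> path_loss \<alpha> x \<le> 1}"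
      by (rule nn_integral_indicator) simp
    also have "\<dots> \<le> ennreal (2 * pi * (2 * ?e))"
      using shell_width[of k] assms by (intro emeasure_path_loss_shell_le) auto
    finally have 1: "?S k \<le> ennreal (4 * pi * ?e)"
      by (simp add: mult.assoc)
    have 2: "?T k = ennreal ((1 / ?e) powr ?d) * ?C"
      using shell_width[of k] assms by (intro nn_integral_path_loss_scale[of "\<lambda>u. ennreal (min 1 u)"]) auto
    have "?e * (1 / ?e) powr ?d = ?e powr (1 - ?d)"
      using shell_width[of k] by (simp add: powr_diff powr_divide)
    also have "\<dots> = ((1 / 2) powr real (k + 2)) powr (1 - ?d)"
      unfolding shell_width_def by (subst powr_realpow) simp_all
    also have "\<dots> = q ^ (k + 2)"
      unfolding powr_powr q_def by (rule powr_power[symmetric]) simp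
    finally have 3: "4 * pi * ?e * (1 / ?e) powr ?d = 4 * pi * q ^ (k + 2)" by simp
    have "ennreal (4 * pi * ?e) * (ennreal ((1 / ?e) powr ?d) * ?C) = ennreal (4 * pi * q ^ (k + 2)) * ?C"
      unfolding 3[symmetric] using shell_width(1)[of k] by (subst (2) ennreal_mult) (auto simp: mult.assoc)
    then show ?thesis
      using mult_right_mono[OF 1, of "ennreal ((1 / ?e) powr ?d) * ?C"] unfolding 2 by simp
  qed
  then have "(\<Sum>k. ?S k * ?T k) \<le> (\<Sum>k. ennreal (4 * pi * q ^ (k + 2)) * ?C)"
    by (intro suminf_le) auto
  also have "\<dots> = ennreal (4 * pi * (q\<^sup>2 * (1 / (1 - q)))) * ?C"
  proof -
    have "(\<lambda>k. q\<^sup>2 * q ^ k) sums (q\<^sup>2 * (1 / (1 - q)))"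
      using q by (intro sums_mult geometric_sums) auto
    then have "(\<lambda>k. 4 * pi * q ^ (k + 2)) sums (4 * pi * (q\<^sup>2 * (1 / (1 - q))))"
      by (intro sums_mult) (simp add: power2_eq_square mult.assoc)
    then have "(\<Sum>k. ennreal (4 * pi * q ^ (k + 2))) = ennreal (4 * pi * (q\<^sup>2 * (1 / (1 - q))))"
      using q by (intro suminf_ennreal_eq) auto
    then show ?thesis by simp
  qed
  also have "\<dots> < \<infinity>" using C by (simp add: ennreal_mult_less_top)
  finally show ?thesis using small by (simp add: pair_bound_def)
qed

text \<open>For each \<open>s > 0\<close> the integrand is at most the indicator of finiteness, and
  the transform tends to 1 as \<open>s\<close> tends to 0.\<close>

lemma (in prob_space) AE_finite_of_laplace:
  assumes [measurable]: "Z \<in> borel_measurable M" and "0 < d"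
    and L: "\<And>s. 0 < s \<Longrightarrow> expectation (\<lambda>\<omega>. exp_neg (ennreal s * Z \<omega>)) = exp (- (c * s powr d))"
  shows "AE \<omega> in M. Z \<omega> < \<infinity>"
proof -
  define p where "p = prob {\<omega> \<in> space M. Z \<omega> = \<infinity>}"
  have "exp (- (c * s powr d)) \<le> 1 - p" if s: "0 < s" for s
  proof -
    have "exp (- (c * s powr d)) = expectation (\<lambda>\<omega>. exp_neg (ennreal s * Z \<omega>))" using L[OF s] by simp
    also have "\<dots> \<le> expectation (indicator {\<omega> \<in> space M. Z \<omega> \<noteq> \<infinity>})"
      using s by (intro integral_mono integrable_const_bound[where B=1])
        (auto split: split_indicator simp: ennreal_mult_top)
    also have "\<dots> = prob (space M - {\<omega> \<in> space M. Z \<omega> = \<infinity>})"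
      by (auto intro!: arg_cong[where f=prob])
    also have "\<dots> = 1 - p" unfolding p_def by (rule prob_compl) measurable
    finally show ?thesis .
  qed
  then have "exp (- (c * (1 / real (Suc n)) powr d)) \<le> 1 - p" for n by simp
  moreover have "(\<lambda>n. exp (- (c * (1 / real (Suc n)) powr d))) \<longlonglongrightarrow> exp (- (c * 0 powr d))"
    using \<open>0 < d\<close> LIMSEQ_inverse_real_of_nat
    by (intro tendsto_intros tendsto_powr') (auto simp: inverse_eq_divide)
  ultimately have "exp (- (c * 0 powr d)) \<le> 1 - p"
    by (intro LIMSEQ_le_const2) auto
  then have "p \<le> 0" by simp
  moreover have "0 \<le> p" by (simp add: p_def)
  ultimately have "p = 0" by simp
  then have "AE \<omega> in M. \<omega> \<notin> {\<omega> \<in> space M. Z \<omega> = \<infinity>}"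
    unfolding p_def by (subst prob_eq_0[symmetric]) auto
  then show ?thesis using AE_space by eventually_elim (auto simp: less_top)
qed

section \<open>Tail of the unmarked interference\<close>

locale planar_PPP = PPP P X \<mu>
  for P :: "'a measure" and X :: "nat \<Rightarrow> 'a \<Rightarrow> real^2" and \<mu> :: real +
  fixes \<alpha> :: real
  assumes alpha: "2 < \<alpha>"
begin

definition interference :: "'a \<Rightarrow> ennreal" where
  "interference \<omega> = (\<Sum>l. ennreal (path_loss \<alpha> (X l \<omega>)))"

lemma interference_measurable [measurable]: "interference \<in> borel_measurable P"
  unfolding interference_def[abs_def] by measurable

lemma laplace_interference:
  assumes "0 < s"
  shows "expectation (\<lambda>\<omega>. exp_neg (ennreal s * interference \<omega>)) = exp (- (\<mu> * laplace_const \<alpha> * s powr (2 / \<alpha>)))"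
proof -
  have "(\<integral>\<omega>. exp_neg (ennreal s * interference \<omega>) \<partial>P) = (\<integral>\<omega>. exp_neg (\<Sum>l. ennreal (s * path_loss \<alpha> (X l \<omega>))) \<partial>P)"
    using assms by (simp add: interference_def ennreal_mult)
  also have "\<dots> = exp_neg (ennreal \<mu> * (\<integral>\<^sup>+x. ennreal (1 - exp_neg (ennreal (s * path_loss \<alpha> x))) \<partial>lborel))"
    by (rule laplace_functional) measurable
  also have "(\<integral>\<^sup>+x. ennreal (1 - exp_neg (ennreal (s * path_loss \<alpha> x))) \<partial>lborel) = ennreal (s powr (2 / \<alpha>) * laplace_const \<alpha>)"
    using assms alpha by (simp add: exp_neg_ennreal nn_integral_one_minus_exp)
  finally show ?thesis
    using mu_nonneg laplace_const_nonneg[of \<alpha>] by (simp add: exp_neg_ennreal mult_ac flip: ennreal_mult)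
qed

lemma AE_interference_finite: "AE \<omega> in P. interference \<omega> < \<infinity>"
  using alpha by (intro AE_finite_of_laplace[where d="2 / \<alpha>" and c="\<mu> * laplace_const \<alpha>"] laplace_interference) auto

lemma prob_count_eq_0:
  assumes "B \<in> sets borel" "bounded B"
  shows "prob {\<omega> \<in> space P. count B \<omega> = 0} = exp (- (\<mu> * measure lborel B))"
proof -
  note [measurable] = count_measurable[OF assms]
  have "ennreal (prob {\<omega> \<in> space P. count B \<omega> = 0}) = (\<integral>\<^sup>+\<omega>. indicator {\<omega> \<in> space P. count B \<omega> = 0} \<omega> \<partial>P)"
    by (subst nn_integral_indicator) (auto simp: emeasure_eq_measure)
  also have "\<dots> = (\<integral>\<^sup>+\<omega>. ennreal (0 ^ count B \<omega>) \<partial>P)"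
    by (intro nn_integral_cong) (auto simp: power_0_left split: split_indicator)
  also have "\<dots> = ennreal (exp (- (\<mu> * measure lborel B)))"
    using nn_integral_count_pgf[OF assms, of 0] by simp
  finally show ?thesis by simp
qed

text \<open>One point with path loss above 1 is enough. Such points fill a punctured disc of area
  \<open>pi\<close>, which is empty with probability \<open>exp (- (pi * \<mu>))\<close>.\<close>

lemma interference_tail_lower: "1 - exp (- (pi * \<mu>)) \<le> prob {\<omega> \<in> space P. 1 < interference \<omega>}"
proof -
  let ?B = "{x. 1 < path_loss \<alpha> x}"
  have B: "?B \<in> sets borel" "bounded ?B" using alpha by (auto intro: bounded_path_loss_gt)
  note [measurable] = count_measurable[OF B]
  have mB: "measure lborel ?B = pi" using alpha by (simp add: measure_def emeasure_path_loss_gt)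
  have "1 - exp (- (pi * \<mu>)) = 1 - prob {\<omega> \<in> space P. count ?B \<omega> = 0}"
    by (simp add: prob_count_eq_0[OF B] mB mult.commute)
  also have "\<dots> = prob (space P - {\<omega> \<in> space P. count ?B \<omega> = 0})"
    by (rule prob_compl[symmetric]) measurable
  also have "\<dots> \<le> prob {\<omega> \<in> space P. 1 < interference \<omega>}"
  proof (rule finite_measure_mono)
    show "space P - {\<omega> \<in> space P. count ?B \<omega> = 0} \<subseteq> {\<omega> \<in> space P. 1 < interference \<omega>}"
    proof
      fix \<omega> assume \<omega>: "\<omega> \<in> space P - {\<omega> \<in> space P. count ?B \<omega> = 0}"
      then have "count ?B \<omega> \<noteq> 0" by simp
      then have "points_in X ?B \<omega> \<noteq> {}" by (auto simp: count_def)
      then obtain l where "1 < path_loss \<alpha> (X l \<omega>)" by (auto simp: points_in_def)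
      then have "1 < ennreal (path_loss \<alpha> (X l \<omega>))" by (simp add: ennreal_less_iff flip: ennreal_1)
      also have "\<dots> \<le> interference \<omega>"
        unfolding interference_def by (rule ennreal_le_suminf)
      finally show "\<omega> \<in> {\<omega> \<in> space P. 1 < interference \<omega>}" using \<omega> by simp
    qed
  qed measurable
  finally show ?thesis .
qed

text \<open>Without a point in the closed disc every term is strictly below 1, so a sum above 1
  forces the pair contribution \<open>Z\<close> to reach 1. Markov's inequality and the factorial
  moment bound the latter event. The closed region replaces the open one of the lower bound to
  obtain the strict inequality; its area is the same.\<close>

lemma interference_tail_upper:
  "prob {\<omega> \<in> space P. 1 < interference \<omega>} \<le> 1 - exp (- (pi * \<mu>)) + enn2real (pair_bound \<alpha>) * \<mu>\<^sup>2"
proof -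
  let ?B = "{x. 1 \<le> path_loss \<alpha> x}"
  have B: "?B \<in> sets borel" "bounded ?B" using alpha by (auto intro: bounded_path_loss_ge_1)
  note [measurable] = count_measurable[OF B]
  have mB: "measure lborel ?B = pi" using alpha by (simp add: measure_def emeasure_path_loss_ge_1)
  let ?f = "\<lambda>l \<omega>. path_loss \<alpha> (X l \<omega>)"
  define Z where "Z \<omega> = (\<Sum>k. \<integral>\<^sup>+p. shell_pairs k (?f (fst p) \<omega>) (?f (snd p) \<omega>) \<partial>count_space pairs)
    + (\<integral>\<^sup>+p. small_pairs (?f (fst p) \<omega>) (?f (snd p) \<omega>) \<partial>count_space pairs)" for \<omega>
  \<comment> \<open>Rewriting the integral over \<open>pairs\<close> as a double series makes
    measurability in the outcome visible.\<close>
  have meas1 [measurable]: "(\<lambda>\<omega>. \<integral>\<^sup>+p. shell_pairs k (?f (fst p) \<omega>) (?f (snd p) \<omega>) \<partial>count_space pairs) \<in> borel_measurable P" for k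
    unfolding nn_integral_pairs[of "\<lambda>i j. shell_pairs k (?f i \<omega>) (?f j \<omega>)" for \<omega>] unfolding shell_pairs_def by measurable
  have meas2 [measurable]: "(\<lambda>\<omega>. \<integral>\<^sup>+p. small_pairs (?f (fst p) \<omega>) (?f (snd p) \<omega>) \<partial>count_space pairs) \<in> borel_measurable P"
    unfolding nn_integral_pairs[of "\<lambda>i j. small_pairs (?f i \<omega>) (?f j \<omega>)" for \<omega>] unfolding small_pairs_def by measurable
  have [measurable]: "Z \<in> borel_measurable P" unfolding Z_def[abs_def] by measurable
  have "(\<integral>\<^sup>+\<omega>. Z \<omega> \<partial>P) = (\<Sum>k. \<integral>\<^sup>+\<omega>. \<integral>\<^sup>+p. shell_pairs k (?f (fst p) \<omega>) (?f (snd p) \<omega>) \<partial>count_space pairs \<partial>P)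
    + (\<integral>\<^sup>+\<omega>. \<integral>\<^sup>+p. small_pairs (?f (fst p) \<omega>) (?f (snd p) \<omega>) \<partial>count_space pairs \<partial>P)"
    unfolding Z_def by (simp add: nn_integral_add nn_integral_suminf)
  also have "\<dots> = (\<Sum>k. (ennreal \<mu> * (\<integral>\<^sup>+x. indicator {1 - 2 * shell_width k <.. 1 - shell_width k} (path_loss \<alpha> x) \<partial>lborel))
       * (ennreal \<mu> * (\<integral>\<^sup>+x. ennreal (min 1 (1 / shell_width k * path_loss \<alpha> x)) \<partial>lborel)))
     + (ennreal \<mu> * (\<integral>\<^sup>+x. ennreal (2 * path_loss \<alpha> x) * indicator {..1 / 2} (path_loss \<alpha> x) \<partial>lborel))
       * (ennreal \<mu> * (\<integral>\<^sup>+x. ennreal (path_loss \<alpha> x) * indicator {..1 / 2} (path_loss \<alpha> x) \<partial>lborel))"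
    unfolding shell_pairs_def small_pairs_def
    by (intro arg_cong2[where f="(+)"] suminf_cong second_factorial_moment) measurable
  also have "\<dots> = (ennreal \<mu> * ennreal \<mu>) * pair_bound \<alpha>"
    unfolding pair_bound_def by (simp add: distrib_left mult_ac flip: ennreal_suminf_cmult)
  also have "\<dots> = ennreal (enn2real (pair_bound \<alpha>) * \<mu>\<^sup>2)"
  proof -
    have "pair_bound \<alpha> = ennreal (enn2real (pair_bound \<alpha>))"
      using pair_bound_finite[OF alpha] by simp
    then show ?thesis
      using mu_nonneg by (metis ennreal_mult'' ennreal_mult enn2real_nonneg mult.commute power2_eq_square zero_le_power2)
  qed
  finally have EZ: "(\<integral>\<^sup>+\<omega>. Z \<omega> \<partial>P) = ennreal (enn2real (pair_bound \<alpha>) * \<mu>\<^sup>2)" .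
  have "emeasure P {\<omega> \<in> space P. 1 \<le> Z \<omega>} \<le> (\<integral>\<^sup>+\<omega>. Z \<omega> \<partial>P)"
    using nn_integral_Markov_inequality[of Z "space P" P 1] by (simp add: nn_integral_set_ennreal)
  then have pZ: "prob {\<omega> \<in> space P. 1 \<le> Z \<omega>} \<le> enn2real (pair_bound \<alpha>) * \<mu>\<^sup>2"
    unfolding EZ by (simp add: emeasure_eq_measure)
  have "AE \<omega> in P. \<omega> \<in> {\<omega> \<in> space P. 1 < interference \<omega>} \<longrightarrow>
      \<omega> \<in> (space P - {\<omega> \<in> space P. count ?B \<omega> = 0}) \<union> {\<omega> \<in> space P. 1 \<le> Z \<omega>}"
    using AE_interference_finite AE_finite_points[OF B]
  proof eventually_elim
    case (elim \<omega>)
    show ?case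
    proof (intro impI)
      assume \<omega>: "\<omega> \<in> {\<omega> \<in> space P. 1 < interference \<omega>}"
      show "\<omega> \<in> (space P - {\<omega> \<in> space P. count ?B \<omega> = 0}) \<union> {\<omega> \<in> space P. 1 \<le> Z \<omega>}"
      proof (cases "count ?B \<omega> = 0")
        case True
        then have "points_in X ?B \<omega> = {}" using elim by (simp add: count_def)
        then have "?f l \<omega> < 1" for l by (auto simp: points_in_def not_le)
        then have "1 \<le> Z \<omega>"
          unfolding Z_def using elim \<omega> by (intro exists_pair_contribution) (auto simp: interference_def)
        then show ?thesis using \<omega> by simp
      qed (use \<omega> in simp)
    qed
  qed
  then have "prob {\<omega> \<in> space P. 1 < interference \<omega>}
      \<le> prob ((space P - {\<omega> \<in> space P. count ?B \<omega> = 0}) \<union> {\<omega> \<in> space P. 1 \<le> Z \<omega>})"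
    by (intro finite_measure_mono_AE) measurable
  also have "\<dots> \<le> prob (space P - {\<omega> \<in> space P. count ?B \<omega> = 0}) + prob {\<omega> \<in> space P. 1 \<le> Z \<omega>}"
    by (intro measure_Un_le) measurable
  also have "prob (space P - {\<omega> \<in> space P. count ?B \<omega> = 0}) = 1 - exp (- (pi * \<mu>))"
    by (subst prob_compl) (auto simp: prob_count_eq_0[OF B] mB mult.commute)
  finally show ?thesis using pZ by simp
qed

end

section \<open>Marks and the law of the interference\<close>

text \<open>The library's \<open>indep_var\<close> forces both random variables to have the same type.\<close>

definition (in prob_space) indep_pair :: "'b measure \<Rightarrow> ('a \<Rightarrow> 'b) \<Rightarrow> 'c measure \<Rightarrow> ('a \<Rightarrow> 'c) \<Rightarrow> bool" where
  "indep_pair S A T B \<longleftrightarrow> A \<in> measurable M S \<and> B \<in> measurable M T \<and>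
     distr M (S \<Otimes>\<^sub>M T) (\<lambda>\<omega>. (A \<omega>, B \<omega>)) = distr M S A \<Otimes>\<^sub>M distr M T B"

lemma (in prob_space) indep_pair_nn_integral:
  assumes ind: "indep_pair S A T B" and [measurable]: "G \<in> borel_measurable (S \<Otimes>\<^sub>M T)"
  shows "(\<integral>\<^sup>+\<omega>. G (A \<omega>, B \<omega>) \<partial>M) = (\<integral>\<^sup>+\<omega>. (\<integral>\<^sup>+\<omega>'. G (A \<omega>, B \<omega>') \<partial>M) \<partial>M)"
proof -
  have [measurable]: "A \<in> measurable M S" "B \<in> measurable M T"
    using ind by (auto simp: indep_pair_def)
  interpret B: prob_space "distr M T B" by (rule prob_space_distr) simp
  have "(\<integral>\<^sup>+\<omega>. G (A \<omega>, B \<omega>) \<partial>M) = (\<integral>\<^sup>+z. G z \<partial>distr M (S \<Otimes>\<^sub>M T) (\<lambda>\<omega>. (A \<omega>, B \<omega>)))"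
    by (subst nn_integral_distr) auto
  also have "distr M (S \<Otimes>\<^sub>M T) (\<lambda>\<omega>. (A \<omega>, B \<omega>)) = distr M S A \<Otimes>\<^sub>M distr M T B"
    using ind by (simp add: indep_pair_def)
  also have "(\<integral>\<^sup>+z. G z \<partial>(distr M S A \<Otimes>\<^sub>M distr M T B)) = (\<integral>\<^sup>+x. (\<integral>\<^sup>+y. G (x, y) \<partial>distr M T B) \<partial>distr M S A)"
    by (rule B.nn_integral_fst[symmetric]) simp
  also have "\<dots> = (\<integral>\<^sup>+\<omega>. (\<integral>\<^sup>+y. G (A \<omega>, y) \<partial>distr M T B) \<partial>M)"
    by (subst nn_integral_distr) auto
  also have "\<dots> = (\<integral>\<^sup>+\<omega>. (\<integral>\<^sup>+\<omega>'. G (A \<omega>, B \<omega>') \<partial>M) \<partial>M)"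
    by (intro nn_integral_cong nn_integral_distr) (auto dest: measurable_space[of A M S])
  finally show ?thesis .
qed

context planar_PPP begin

text \<open>Averaging the marks given the locations replaces each mark by the deterministic factor
  \<open>\<phi> (s * path_loss)\<close>, so the marked sum has the Laplace transform of an unmarked
  sum of \<open>h = - ln \<phi>\<close>. Exchanging the integrals over plane and mark then leaves
  only the mark moment of order \<open>2 / \<alpha>\<close>.\<close>

theorem laplace_marked_interference:
  fixes \<Psi> :: "nat \<Rightarrow> 'a \<Rightarrow> real"
  assumes ind: "indep_pair (PiM UNIV (\<lambda>_. borel)) (\<lambda>\<omega> l. X l \<omega>) (PiM UNIV (\<lambda>_. borel)) (\<lambda>\<omega> l. \<Psi> l \<omega>)"
    and iid: "indep_vars (\<lambda>_. borel) \<Psi> UNIV" "\<And>l. distr P borel (\<Psi> l) = distr P borel (\<Psi> 0)"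
    and pos: "AE \<omega> in P. 0 \<le> \<Psi> 0 \<omega>" and int: "integrable P (\<lambda>\<omega>. \<Psi> 0 \<omega> powr (2 / \<alpha>))"
    and s: "0 < s"
  shows "expectation (\<lambda>\<omega>. exp_neg (ennreal s * (\<Sum>l. ennreal (path_loss \<alpha> (X l \<omega>) * \<Psi> l \<omega>))))
    = exp (- (\<mu> * expectation (\<lambda>\<omega>. \<Psi> 0 \<omega> powr (2 / \<alpha>)) * laplace_const \<alpha> * s powr (2 / \<alpha>)))"
proof -
  have [measurable]: "\<Psi> l \<in> borel_measurable P" for l
    using iid(1) by (auto simp: indep_vars_def)
  define \<phi> where "\<phi> u = expectation (\<lambda>\<omega>. exp_neg (ennreal (u * \<Psi> 0 \<omega>)))" for u
  have \<phi>_nn: "ennreal (\<phi> u) = (\<integral>\<^sup>+\<omega>. ennreal (exp_neg (ennreal (u * \<Psi> 0 \<omega>))) \<partial>P)" for u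
    unfolding \<phi>_def by (intro nn_integral_eq_integral[symmetric] integrable_const_bound[where B=1]) auto
  have \<phi>_meas [measurable]: "\<phi> \<in> borel_measurable borel"
    unfolding \<phi>_def[abs_def] by measurable
  have \<phi>1: "\<phi> u \<le> 1" for u
  proof -
    have "\<phi> u \<le> expectation (\<lambda>_. 1)"
      unfolding \<phi>_def by (intro integral_mono integrable_const_bound[where B=1]) auto
    then show ?thesis by (simp add: prob_space)
  qed
  \<comment> \<open>Positivity keeps \<open>- ln \<phi>\<close> meaningful as the function fed to
    the Laplace functional.\<close>
  have \<phi>0: "0 < \<phi> u" for u
  proof -
    have "0 \<le> \<phi> u" unfolding \<phi>_def by (intro integral_nonneg_AE) auto
    moreover have "\<phi> u \<noteq> 0"
    proof
      assume "\<phi> u = 0"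
      then have "AE \<omega> in P. exp_neg (ennreal (u * \<Psi> 0 \<omega>)) = 0"
        unfolding \<phi>_def by (subst (asm) integral_nonneg_eq_0_iff_AE) (auto intro!: integrable_const_bound[where B=1])
      then have "AE \<omega> in P. False"
        by eventually_elim (metis ennreal_neq_top exp_neg_pos infinity_ennreal_def less_irrefl)
      then show False by simp
    qed
    ultimately show ?thesis by simp
  qed
  define h where "h x = ennreal (- ln (\<phi> (s * path_loss \<alpha> x)))" for x
  have [measurable]: "h \<in> borel_measurable borel" unfolding h_def[abs_def] by measurable
  have h: "exp_neg (h x) = \<phi> (s * path_loss \<alpha> x)" for x
    using \<phi>0 \<phi>1 by (simp add: h_def exp_neg_ennreal)
  let ?m = "expectation (\<lambda>\<omega>. \<Psi> 0 \<omega> powr (2 / \<alpha>))"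
  let ?e = "\<lambda>x \<omega>. exp_neg (ennreal (s * path_loss \<alpha> x * \<Psi> 0 \<omega>))"
  let ?S = "\<lambda>\<omega>. exp_neg (\<Sum>l. ennreal (s * (path_loss \<alpha> (X l \<omega>) * \<Psi> l \<omega>)))"
  let ?t = "\<lambda>l \<omega> \<omega>'. exp_neg (ennreal (s * (path_loss \<alpha> (X l \<omega>) * \<Psi> l \<omega>')))"
  \<comment> \<open>Independence is applied to finitely many factors; the infinite product follows
    by dominated convergence, as all factors lie between 0 and 1.\<close>
  have fin: "expectation (\<lambda>\<omega>. \<Prod>l<n. ?t l \<omega> \<omega>) = expectation (\<lambda>\<omega>. \<Prod>l<n. exp_neg (h (X l \<omega>)))" for n
  proof -
    have "(\<integral>\<^sup>+\<omega>. ennreal (\<Prod>l<n. ?t l \<omega> \<omega>) \<partial>P) = (\<integral>\<^sup>+\<omega>. \<integral>\<^sup>+\<omega>'. ennreal (\<Prod>l<n. ?t l \<omega> \<omega>') \<partial>P \<partial>P)"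
      using indep_pair_nn_integral[OF ind, of "\<lambda>(x, y). ennreal (\<Prod>l<n. exp_neg (ennreal (s * (path_loss \<alpha> (x l) * y l))))"]
      by simp
    also have "\<dots> = (\<integral>\<^sup>+\<omega>. ennreal (\<Prod>l<n. exp_neg (h (X l \<omega>))) \<partial>P)"
    proof (rule nn_integral_cong)
      fix \<omega>
      have "(\<integral>\<^sup>+\<omega>'. (\<Prod>l<n. ennreal (?t l \<omega> \<omega>')) \<partial>P) = (\<Prod>l<n. \<integral>\<^sup>+\<omega>'. ennreal (?t l \<omega> \<omega>') \<partial>P)"
        using indep_vars_compose2[OF indep_vars_subset[OF iid(1) subset_UNIV], of "{..<n}" "\<lambda>l y. ennreal (exp_neg (ennreal (s * (path_loss \<alpha> (X l \<omega>) * y))))" "\<lambda>_. borel"]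
        by (intro indep_vars_nn_integral) auto
      also have "\<dots> = (\<Prod>l<n. ennreal (exp_neg (h (X l \<omega>))))"
      proof (rule prod.cong)
        fix l
        let ?g = "\<lambda>y. ennreal (exp_neg (ennreal (s * (path_loss \<alpha> (X l \<omega>) * y))))"
        have "(\<integral>\<^sup>+\<omega>'. ?g (\<Psi> l \<omega>') \<partial>P) = (\<integral>\<^sup>+y. ?g y \<partial>distr P borel (\<Psi> l))"
          by (subst nn_integral_distr) auto
        also have "\<dots> = (\<integral>\<^sup>+\<omega>'. ?g (\<Psi> 0 \<omega>') \<partial>P)"
          unfolding iid(2)[of l] by (subst nn_integral_distr) auto
        finally show "(\<integral>\<^sup>+\<omega>'. ?g (\<Psi> l \<omega>') \<partial>P) = ennreal (exp_neg (h (X l \<omega>)))"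
          by (simp add: h \<phi>_nn mult.assoc)
      qed simp
      finally show "(\<integral>\<^sup>+\<omega>'. ennreal (\<Prod>l<n. ?t l \<omega> \<omega>') \<partial>P) = ennreal (\<Prod>l<n. exp_neg (h (X l \<omega>)))"
        by (simp add: prod_ennreal)
    qed
    finally show ?thesis
      by (simp add: integral_eq_nn_integral prod_nonneg)
  qed
  have bnd: "norm (\<Prod>l<n. exp_neg (f l)) \<le> 1" for n :: nat and f
    by (auto simp: abs_prod intro!: prod_le_1)
  have "(\<lambda>n. expectation (\<lambda>\<omega>. \<Prod>l<n. ?t l \<omega> \<omega>)) \<longlonglongrightarrow> expectation (\<lambda>\<omega>. ?S \<omega>)"
    by (rule integral_dominated_convergence[where w="\<lambda>_. 1"]) (auto intro!: exp_neg_suminf_LIMSEQ bnd simp del: real_norm_def)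
  moreover have "(\<lambda>n. expectation (\<lambda>\<omega>. \<Prod>l<n. exp_neg (h (X l \<omega>)))) \<longlonglongrightarrow> expectation (\<lambda>\<omega>. exp_neg (\<Sum>l. h (X l \<omega>)))"
    by (rule integral_dominated_convergence[where w="\<lambda>_. 1"]) (auto intro!: exp_neg_suminf_LIMSEQ bnd simp del: real_norm_def)
  ultimately have "expectation (\<lambda>\<omega>. ?S \<omega>) = expectation (\<lambda>\<omega>. exp_neg (\<Sum>l. h (X l \<omega>)))"
    unfolding fin by (rule LIMSEQ_unique)
  also have "\<dots> = exp_neg (ennreal \<mu> * (\<integral>\<^sup>+x. ennreal (1 - exp_neg (h x)) \<partial>lborel))"
    by (rule laplace_functional) simp
  also have "(\<integral>\<^sup>+x. ennreal (1 - exp_neg (h x)) \<partial>lborel) = (\<integral>\<^sup>+x. \<integral>\<^sup>+\<omega>. ennreal (1 - ?e x \<omega>) \<partial>P \<partial>lborel)"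
  proof (rule nn_integral_cong)
    fix x
    have i: "integrable P (\<lambda>\<omega>. ?e x \<omega>)"
      by (intro integrable_const_bound[where B=1]) auto
    have "1 - \<phi> (s * path_loss \<alpha> x) = expectation (\<lambda>\<omega>. 1 - ?e x \<omega>)"
      unfolding \<phi>_def using i by (simp add: prob_space)
    then show "ennreal (1 - exp_neg (h x)) = (\<integral>\<^sup>+\<omega>. ennreal (1 - ?e x \<omega>) \<partial>P)"
      using i by (simp add: h nn_integral_eq_integral)
  qed
  \<comment> \<open>For a fixed mark the integral over the plane is explicit by scaling, with the
    mark absorbed into \<open>s\<close>; a mark equal to 0 contributes 0 on both sides and is
    treated apart.\<close>
  also have "\<dots> = (\<integral>\<^sup>+\<omega>. \<integral>\<^sup>+x. ennreal (1 - ?e x \<omega>) \<partial>lborel \<partial>P)"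
  proof -
    interpret pair_sigma_finite lborel P ..
    show ?thesis by (rule Fubini'[symmetric]) measurable
  qed
  also have "\<dots> = (\<integral>\<^sup>+\<omega>. ennreal (s powr (2 / \<alpha>) * laplace_const \<alpha> * \<Psi> 0 \<omega> powr (2 / \<alpha>)) \<partial>P)"
  proof (rule nn_integral_cong_AE)
    show "AE \<omega> in P. (\<integral>\<^sup>+x. ennreal (1 - ?e x \<omega>) \<partial>lborel)
      = ennreal (s powr (2 / \<alpha>) * laplace_const \<alpha> * \<Psi> 0 \<omega> powr (2 / \<alpha>))"
      using pos
    proof eventually_elim
      case (elim \<omega>)
      show ?case
      proof (cases "\<Psi> 0 \<omega> = 0")
        case False
        then have "0 < s * \<Psi> 0 \<omega>" using elim s by simp
        from nn_integral_one_minus_exp[OF alpha this]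
        have "(\<integral>\<^sup>+x. ennreal (1 - exp (- (s * path_loss \<alpha> x * \<Psi> 0 \<omega>))) \<partial>lborel) = ennreal (s powr (2 / \<alpha>) * laplace_const \<alpha> * \<Psi> 0 \<omega> powr (2 / \<alpha>))"
          using elim s by (simp add: powr_mult mult_ac)
        then show ?thesis using elim s by (simp add: exp_neg_ennreal)
      qed simp
    qed
  qed
  also have "\<dots> = ennreal (s powr (2 / \<alpha>) * laplace_const \<alpha> * ?m)"
    using int laplace_const_nonneg[of \<alpha>] by (subst nn_integral_eq_integral) auto
  finally have "expectation (\<lambda>\<omega>. ?S \<omega>)
    = exp_neg (ennreal \<mu> * ennreal (s powr (2 / \<alpha>) * laplace_const \<alpha> * ?m))" .
  also have "\<dots> = exp_neg (ennreal (\<mu> * (s powr (2 / \<alpha>) * laplace_const \<alpha> * ?m)))"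
    using mu_nonneg by (simp add: ennreal_mult')
  also have "\<dots> = exp (- (\<mu> * (s powr (2 / \<alpha>) * laplace_const \<alpha> * ?m)))"
    using mu_nonneg laplace_const_nonneg[of \<alpha>] by (intro exp_neg_ennreal mult_nonneg_nonneg integral_nonneg_AE) auto
  finally show ?thesis
    using s by (simp add: ennreal_mult' mult_ac)
qed

end

lemma (in prob_space) expectation_exp_enn2real:
  assumes fin: "AE \<omega> in M. Z \<omega> < \<infinity>" and [measurable]: "Z \<in> borel_measurable M" and s: "0 < s"
  shows "expectation (\<lambda>\<omega>. exp (- (s * enn2real (Z \<omega>)))) = expectation (\<lambda>\<omega>. exp_neg (ennreal s * Z \<omega>))"
proof (rule integral_cong_AE)
  show "AE \<omega> in M. exp (- (s * enn2real (Z \<omega>))) = exp_neg (ennreal s * Z \<omega>)"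
    using fin
  proof eventually_elim
    case (elim \<omega>)
    then show ?case using s by (cases "Z \<omega>") (auto simp: exp_neg_ennreal simp flip: ennreal_mult)
  qed
qed auto

text \<open>The positive stable law of index \<open>2 / \<alpha>\<close>, normalised to be the law
  of the unmarked interference at intensity 1. It is characterised by its Laplace transform, which
  leaves existence to be shown.\<close>

definition stable_law :: "real \<Rightarrow> real measure \<Rightarrow> bool" where
  "stable_law \<alpha> D \<longleftrightarrow> prob_space D \<and> sets D = sets borel \<and> (AE x in D. 0 \<le> x) \<and>
     (\<forall>s>0. (\<integral>x. exp (- (s * x)) \<partial>D) = exp (- (laplace_const \<alpha> * s powr (2 / \<alpha>))))"

text \<open>Scaling \<open>s\<close> by \<open>c powr (\<alpha> / 2)\<close> multiplies
  \<open>s powr (2 / \<alpha>)\<close> by \<open>c\<close>, so the transforms coincide. Applied with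
  \<open>c\<close> the intensity, and for marked points with the intensity times the mark
  moment.\<close>

lemma (in prob_space) distr_eq_scaled_stable:
  assumes D: "stable_law \<alpha> D" and alpha: "2 < \<alpha>" and c: "0 < c" and [measurable]: "Z \<in> borel_measurable M"
    and L: "\<And>s. 0 < s \<Longrightarrow> expectation (\<lambda>\<omega>. exp_neg (ennreal s * Z \<omega>)) = exp (- (c * laplace_const \<alpha> * s powr (2 / \<alpha>)))"
  shows "distr M borel (\<lambda>\<omega>. enn2real (Z \<omega>)) = distr D borel (\<lambda>x. c powr (\<alpha> / 2) * x)"
proof (rule laplace_transform_unique)
  interpret D: prob_space D using D by (simp add: stable_law_def)
  have [simp, measurable_cong]: "sets D = sets borel" using D by (simp add: stable_law_def)
  show "prob_space (distr M borel (\<lambda>\<omega>. enn2real (Z \<omega>)))" by (rule prob_space_distr) simp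
  show "prob_space (distr D borel (\<lambda>x. c powr (\<alpha> / 2) * x))" by (rule D.prob_space_distr) simp
  show "AE x in distr M borel (\<lambda>\<omega>. enn2real (Z \<omega>)). 0 \<le> x" by (subst AE_distr_iff) auto
  show "AE x in distr D borel (\<lambda>x. c powr (\<alpha> / 2) * x). 0 \<le> x"
    using D by (subst AE_distr_iff) (auto simp: stable_law_def elim: eventually_mono)
  fix s :: real assume s: "0 < s"
  have fin: "AE \<omega> in M. Z \<omega> < \<infinity>"
    using alpha L by (intro AE_finite_of_laplace[where d="2 / \<alpha>" and c="c * laplace_const \<alpha>"]) auto
  have "(\<integral>x. exp (- (s * x)) \<partial>distr M borel (\<lambda>\<omega>. enn2real (Z \<omega>))) = expectation (\<lambda>\<omega>. exp (- (s * enn2real (Z \<omega>))))"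
    by (subst integral_distr) auto
  also have "\<dots> = expectation (\<lambda>\<omega>. exp_neg (ennreal s * Z \<omega>))"
    by (rule expectation_exp_enn2real[OF fin _ s]) simp
  also have "\<dots> = exp (- (laplace_const \<alpha> * (s * c powr (\<alpha> / 2)) powr (2 / \<alpha>)))"
    using L[OF s] s c alpha by (simp add: powr_mult powr_powr mult_ac)
  also have "\<dots> = (\<integral>x. exp (- (s * c powr (\<alpha> / 2) * x)) \<partial>D)"
    using D s c by (simp add: stable_law_def)
  also have "\<dots> = (\<integral>x. exp (- (s * x)) \<partial>distr D borel (\<lambda>x. c powr (\<alpha> / 2) * x))"
    by (subst integral_distr) (auto simp: mult.assoc)
  finally show "(\<integral>x. exp (- (s * x)) \<partial>distr M borel (\<lambda>\<omega>. enn2real (Z \<omega>))) = \<dots>" .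
qed auto

lemma stable_lawD:
  assumes "stable_law \<alpha> D"
  shows "prob_space D" "sets D = sets borel" "space D = UNIV" "AE x in D. 0 \<le> x"
    and "0 < s \<Longrightarrow> (\<integral>x. exp (- (s * x)) \<partial>D) = exp (- (laplace_const \<alpha> * s powr (2 / \<alpha>)))"
  using assms sets_eq_imp_space_eq[of D borel] by (auto simp: stable_law_def)

context planar_PPP begin

text \<open>This supplies the existence of a stable law.\<close>

lemma stable_law_interference:
  assumes "\<mu> = 1"
  shows "stable_law \<alpha> (distr P borel (\<lambda>\<omega>. enn2real (interference \<omega>)))"
  using assms laplace_interference alpha
  by (auto simp: stable_law_def AE_distr_iff expectation_exp_enn2real[OF AE_interference_finite] 
      integral_distr intro: prob_space_distr)

text \<open>Interference at intensity \<open>\<mu>\<close> is the stable variable times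
  \<open>\<mu> powr (\<alpha> / 2)\<close>, so exceeding 1 at varying intensity is exceeding a
  varying threshold under one law.\<close>

lemma stable_tail_bounds:
  assumes D: "stable_law \<alpha> D" and mu: "0 < \<mu>"
  shows "1 - exp (- (pi * \<mu>)) \<le> measure D {\<mu> powr (- (\<alpha> / 2)) <..}"
    and "measure D {\<mu> powr (- (\<alpha> / 2)) <..} \<le> 1 - exp (- (pi * \<mu>)) + enn2real (pair_bound \<alpha>) * \<mu>\<^sup>2"
proof -
  note [measurable_cong] = stable_lawD(2)[OF D]
  have "prob {\<omega> \<in> space P. 1 < interference \<omega>} = prob {\<omega> \<in> space P. 1 < enn2real (interference \<omega>)}"
  proof (rule prob_eq_AE)
    show "AE \<omega> in P. 1 < interference \<omega> \<longleftrightarrow> 1 < enn2real (interference \<omega>)"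
      using AE_interference_finite
    proof eventually_elim
      case (elim \<omega>)
      then show ?case by (cases "interference \<omega>") (auto simp: ennreal_less_iff simp flip: ennreal_1)
    qed
  qed measurable
  also have "\<dots> = measure (distr P borel (\<lambda>\<omega>. enn2real (interference \<omega>))) {1<..}"
    by (subst measure_distr) (auto intro!: arg_cong[where f=prob])
  also have "distr P borel (\<lambda>\<omega>. enn2real (interference \<omega>)) = distr D borel (\<lambda>x. \<mu> powr (\<alpha> / 2) * x)"
    using mu by (intro distr_eq_scaled_stable[OF D alpha] laplace_interference) auto
  also have "measure (distr D borel (\<lambda>x. \<mu> powr (\<alpha> / 2) * x)) {1<..} = measure D {\<mu> powr (- (\<alpha> / 2)) <..}"
  proof -
    have "(\<lambda>x. \<mu> powr (\<alpha> / 2) * x) -` {1<..} = {\<mu> powr (- (\<alpha> / 2)) <..}"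
      using mu by (auto simp: powr_minus field_simps)
    then show ?thesis by (subst measure_distr) (auto simp: stable_lawD(3)[OF D])
  qed
  finally have "prob {\<omega> \<in> space P. 1 < interference \<omega>} = measure D {\<mu> powr (- (\<alpha> / 2)) <..}" .
  then show "1 - exp (- (pi * \<mu>)) \<le> measure D {\<mu> powr (- (\<alpha> / 2)) <..}"
    and "measure D {\<mu> powr (- (\<alpha> / 2)) <..} \<le> 1 - exp (- (pi * \<mu>)) + enn2real (pair_bound \<alpha>) * \<mu>\<^sup>2"
    using interference_tail_lower interference_tail_upper by auto
qed

end

section \<open>The stable law charges every interval\<close>

text \<open>The two scaled independent copies contribute the shares \<open>l\<close> and
  \<open>1 - l\<close> of the Laplace exponent, which add up to the whole.\<close>

lemma stable_convolution:
  assumes D: "stable_law \<alpha> D" and alpha: "2 < \<alpha>" and l: "0 < l" "l < 1"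
  shows "distr (D \<Otimes>\<^sub>M D) borel (\<lambda>(x, y). l powr (\<alpha> / 2) * x + (1 - l) powr (\<alpha> / 2) * y) = D"
proof (rule laplace_transform_unique)
  interpret D: prob_space D by (rule stable_lawD(1)[OF D])
  interpret DD: pair_prob_space D D ..
  note sD [measurable_cong, simp] = stable_lawD(2)[OF D]
  let ?g = "\<lambda>(x, y). l powr (\<alpha> / 2) * x + (1 - l) powr (\<alpha> / 2) * y"
  have [measurable]: "?g \<in> borel_measurable (D \<Otimes>\<^sub>M D)" by measurable
  show "prob_space (distr (D \<Otimes>\<^sub>M D) borel ?g)" by (rule DD.prob_space_distr) simp
  show "prob_space D" by (rule stable_lawD(1)[OF D])
  show "AE x in D. 0 \<le> x" by (rule stable_lawD(4)[OF D])
  have pos: "AE z in D \<Otimes>\<^sub>M D. 0 \<le> fst z \<and> 0 \<le> snd z"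
  proof (rule DD.AE_pair_measure)
    show "AE x in D. AE y in D. 0 \<le> fst (x, y) \<and> 0 \<le> snd (x, y)"
      using stable_lawD(4)[OF D]
    proof eventually_elim
      case (elim x)
      show ?case using stable_lawD(4)[OF D] by eventually_elim (use elim in simp)
    qed
  qed measurable
  then have "AE z in D \<Otimes>\<^sub>M D. 0 \<le> ?g z" by eventually_elim auto
  then show "AE x in distr (D \<Otimes>\<^sub>M D) borel ?g. 0 \<le> x" by (subst AE_distr_iff) auto
  fix s :: real assume s: "0 < s"
  let ?a = "s * l powr (\<alpha> / 2)" and ?b = "s * (1 - l) powr (\<alpha> / 2)"
  have ab: "0 < ?a" "0 < ?b" using s l by auto
  have "(\<integral>x. exp (- (s * x)) \<partial>distr (D \<Otimes>\<^sub>M D) borel ?g) = (\<integral>z. exp (- (?a * fst z)) * exp (- (?b * snd z)) \<partial>(D \<Otimes>\<^sub>M D))"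
    by (subst integral_distr) (auto simp: split_beta mult_exp_exp algebra_simps)
  also have "\<dots> = (\<integral>x. (\<integral>y. exp (- (?a * x)) * exp (- (?b * y)) \<partial>D) \<partial>D)"
  proof -
    have "integrable (D \<Otimes>\<^sub>M D) (\<lambda>z. exp (- (?a * fst z)) * exp (- (?b * snd z)))"
    proof (rule DD.integrable_const_bound[where B=1])
      show "AE z in D \<Otimes>\<^sub>M D. norm (exp (- (?a * fst z)) * exp (- (?b * snd z))) \<le> 1"
        using pos
      proof eventually_elim
        case (elim z)
        then have "0 \<le> ?a * fst z + ?b * snd z" using s by (intro add_nonneg_nonneg mult_nonneg_nonneg) auto
        then show ?case by (simp add: mult_exp_exp)
      qed
    qed measurable
    from DD.integral_fst'[OF this] show ?thesis by simp
  qed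
  also have "\<dots> = (\<integral>x. exp (- (?a * x)) \<partial>D) * (\<integral>y. exp (- (?b * y)) \<partial>D)"
    by simp
  also have "\<dots> = exp (- (laplace_const \<alpha> * (?a powr (2 / \<alpha>) + ?b powr (2 / \<alpha>))))"
    using stable_lawD(5)[OF D ab(1)] stable_lawD(5)[OF D ab(2)] by (simp add: mult_exp_exp algebra_simps)
  also have "?a powr (2 / \<alpha>) + ?b powr (2 / \<alpha>) = s powr (2 / \<alpha>)"
  proof -
    have "?a powr (2 / \<alpha>) = s powr (2 / \<alpha>) * l" "?b powr (2 / \<alpha>) = s powr (2 / \<alpha>) * (1 - l)"
      using s l alpha by (simp_all add: powr_mult powr_powr)
    then show ?thesis by (simp add: algebra_simps)
  qed
  finally show "(\<integral>x. exp (- (s * x)) \<partial>distr (D \<Otimes>\<^sub>M D) borel ?g) = (\<integral>x. exp (- (s * x)) \<partial>D)"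
    using stable_lawD(5)[OF D s] by simp
qed (use stable_lawD(2)[OF D] in auto)

text \<open>If two independent copies both lie in \<open>{u..<v}\<close>, their stable combination
  lies in the interval scaled by
  \<open>k = l powr (\<alpha> / 2) + (1 - l) powr (\<alpha> / 2)\<close>. By the intermediate value
  theorem \<open>k\<close> takes every value between \<open>2 powr (1 - \<alpha> / 2)\<close> at
  \<open>l = 1/2\<close> and 1 at \<open>l = 1\<close>. The endpoint \<open>k = 1\<close> is trivial
  and kept apart, because the convolution needs \<open>l < 1\<close>.\<close>

lemma stable_interval_contract:
  assumes D: "stable_law \<alpha> D" and alpha: "2 < \<alpha>" 
    and k: "2 powr (1 - \<alpha> / 2) \<le> k" "k \<le> 1" and pos: "0 < measure D {u..<v}"
  shows "0 < measure D {k * u..<k * v}"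
proof (cases "k = 1")
  case False
  interpret D: prob_space D by (rule stable_lawD(1)[OF D])
  interpret DD: pair_prob_space D D ..
  note sD [measurable_cong, simp] = stable_lawD(2)[OF D]
  let ?p = "\<alpha> / 2"
  have "\<exists>l\<ge>1/2. l \<le> 1 \<and> l powr ?p + (1 - l) powr ?p = k"
  proof (rule IVT')
    have "(1 / 2 :: real) powr ?p + (1 - 1 / 2) powr ?p = 2 powr (1 - ?p)"
      by (simp add: powr_divide powr_diff)
    then show "(1 / 2) powr ?p + (1 - 1 / 2) powr ?p \<le> k" using k by simp
    show "k \<le> 1 powr ?p + (1 - 1) powr ?p" using k alpha by simp
    show "continuous_on {1 / 2..1} (\<lambda>l. l powr ?p + (1 - l) powr ?p)"
      using alpha by (intro continuous_intros continuous_on_powr') auto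
  qed simp
  then obtain l where l: "1 / 2 \<le> l" "l \<le> 1" "l powr ?p + (1 - l) powr ?p = k" by auto
  then have l1: "l < 1" using False alpha by (cases "l = 1") auto
  let ?g = "\<lambda>(x, y). l powr ?p * x + (1 - l) powr ?p * y"
  have [measurable]: "?g \<in> borel_measurable (D \<Otimes>\<^sub>M D)" by measurable
  have "emeasure D {u..<v} * emeasure D {u..<v} = emeasure (D \<Otimes>\<^sub>M D) ({u..<v} \<times> {u..<v})"
    by (rule D.emeasure_pair_measure_Times[symmetric]) auto
  also have "\<dots> \<le> emeasure (D \<Otimes>\<^sub>M D) (?g -` {k * u..<k * v} \<inter> space (D \<Otimes>\<^sub>M D))"
  proof (rule emeasure_mono)
    have "0 < l powr ?p" "0 < (1 - l) powr ?p" using l l1 by auto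
    then have "k * u \<le> ?g (x, y) \<and> ?g (x, y) < k * v" if "x \<in> {u..<v}" "y \<in> {u..<v}" for x y
      using that unfolding l(3)[symmetric] distrib_right
      by (auto intro!: add_mono add_strict_mono mult_left_mono mult_strict_left_mono)
    then show "{u..<v} \<times> {u..<v} \<subseteq> ?g -` {k * u..<k * v} \<inter> space (D \<Otimes>\<^sub>M D)"
      by (auto simp: space_pair_measure stable_lawD(3)[OF D])
  qed measurable
  also have "\<dots> = emeasure (distr (D \<Otimes>\<^sub>M D) borel ?g) {k * u..<k * v}"
    by (rule emeasure_distr[symmetric]) auto
  also have "\<dots> = emeasure D {k * u..<k * v}"
    using l l1 by (subst stable_convolution[OF D alpha]) auto
  finally have "measure D {u..<v} * measure D {u..<v} \<le> measure D {k * u..<k * v}"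
    by (simp add: D.emeasure_eq_measure flip: ennreal_mult)
  then show ?thesis using pos by (meson less_le_trans mult_pos_pos)
qed (use pos in simp)

text \<open>Contractions by the smallest admissible factor \<open>c\<close> are iterated, and one
  factor between \<open>c\<close> and 1 makes up the remainder.\<close>

lemma stable_interval_scale_down:
  assumes D: "stable_law \<alpha> D" and alpha: "2 < \<alpha>" and q: "0 < q" "q \<le> 1" and pos: "0 < measure D {u..<v}"
  shows "0 < measure D {q * u..<q * v}"
proof -
  define c :: real where "c = 2 powr (1 - \<alpha> / 2)"
  have c: "0 < c" "c < 1"
  proof -
    have "(2 :: real) powr (1 - \<alpha> / 2) < 2 powr 0" using alpha by (intro powr_less_mono) auto
    then show "c < 1" by (simp add: c_def)
  qed (simp add: c_def)
  have "0 < measure D {q * u..<q * v}" if "c ^ n \<le> q" "q \<le> 1" for n q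
    using that
  proof (induction n arbitrary: q)
    case 0
    then show ?case using pos by simp
  next
    case (Suc n)
    show ?case
    proof (cases "c \<le> q")
      case True
      then show ?thesis using stable_interval_contract[OF D alpha _ _ pos] Suc by (simp add: c_def)
    next
      case False
      have "c ^ n \<le> q / c" "q / c \<le> 1" using Suc c False by (simp_all add: field_simps)
      from stable_interval_contract[OF D alpha _ _ Suc.IH[OF this], of c]
      have "0 < measure D {c * (q / c * u)..<c * (q / c * v)}"
        using c by (simp add: c_def)
      then show ?thesis using c by simp
    qed
  qed
  moreover obtain n where "c ^ n \<le> q" using real_arch_pow_inv[OF q(1) c(2)] by (auto intro: less_imp_le)
  ultimately show ?thesis using q by blast
qed

text \<open>Scaling preserves the ratio of endpoints, so the tail beyond \<open>z\<close> is cut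
  into intervals of common ratio \<open>\<tau>\<close>. One of them has mass, and scaling by
  \<open>1 / \<tau> ^ k\<close> moves it onto \<open>{z..<b}\<close>. Taking for
  \<open>\<tau>\<close> the square root of \<open>b / a\<close> puts \<open>z = a * \<tau>\<close>
  strictly inside, which handles the open left end.\<close>

theorem stable_interval_pos:
  assumes D: "stable_law \<alpha> D" and alpha: "2 < \<alpha>" and tail: "\<And>t. 0 < t \<Longrightarrow> 0 < measure D {t<..}"
    and ab: "0 < a" "a < b"
  shows "0 < measure D {a<..<b}"
proof -
  interpret D: prob_space D by (rule stable_lawD(1)[OF D])
  note sD [measurable_cong, simp] = stable_lawD(2)[OF D]
  define \<tau> where "\<tau> = sqrt (b / a)"
  define z where "z = a * \<tau>"
  have tau: "1 < \<tau>" "\<tau> * \<tau> = b / a" using ab by (auto simp: \<tau>_def)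
  have z: "0 < z" "a < z" "z * \<tau> = b" using tau ab by (auto simp: z_def mult.assoc)
  have "\<exists>k. 0 < measure D {z * \<tau> ^ k..<z * \<tau> ^ Suc k}"
  proof (rule ccontr)
    assume "\<not> ?thesis"
    then have "emeasure D {z * \<tau> ^ k..<z * \<tau> ^ Suc k} = 0" for k
      using measure_nonneg[of D] by (auto simp: D.emeasure_eq_measure not_less ennreal_eq_0_iff)
    then have "(\<Union>k. {z * \<tau> ^ k..<z * \<tau> ^ Suc k}) \<in> null_sets D"
      by (intro null_sets_UN) (auto intro!: null_setsI)
    moreover have "{z<..} \<subseteq> (\<Union>k. {z * \<tau> ^ k..<z * \<tau> ^ Suc k})"
    proof
      fix x assume x: "x \<in> {z<..}"
      obtain n where n: "x / z < \<tau> ^ n" using real_arch_pow[OF tau(1)] by blast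
      define m where "m = (LEAST n. x / z < \<tau> ^ n)"
      have m: "x / z < \<tau> ^ m" unfolding m_def using n by (rule LeastI)
      have "m \<noteq> 0" using m x z by (auto simp: field_simps intro!: gr0I)
      then obtain k where k: "m = Suc k" by (cases m) auto
      then have "k < (LEAST n. x / z < \<tau> ^ n)" by (simp add: m_def)
      then have "\<not> x / z < \<tau> ^ k" by (rule not_less_Least)
      then have "x \<in> {z * \<tau> ^ k..<z * \<tau> ^ Suc k}" using m z(1) unfolding k by (auto simp: field_simps)
      then show "x \<in> (\<Union>k. {z * \<tau> ^ k..<z * \<tau> ^ Suc k})" by blast
    qed
    ultimately have "{z<..} \<in> null_sets D"
      using null_sets_subset[of "\<Union>k. {z * \<tau> ^ k..<z * \<tau> ^ Suc k}" D "{z<..}"] by simp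
    then have "measure D {z<..} = 0" by (simp add: measure_def null_sets_def)
    then show False using tail[OF z(1)] by simp
  qed
  then obtain k where k: "0 < measure D {z * \<tau> ^ k..<z * \<tau> ^ Suc k}" by blast
  have "0 < measure D {(1 / \<tau> ^ k) * (z * \<tau> ^ k)..<(1 / \<tau> ^ k) * (z * \<tau> ^ Suc k)}"
    using tau by (intro stable_interval_scale_down[OF D alpha _ _ k]) (auto simp: one_le_power)
  also have "(1 / \<tau> ^ k) * (z * \<tau> ^ k) = z" using tau by simp
  also have "(1 / \<tau> ^ k) * (z * \<tau> ^ Suc k) = b" using tau z by simp
  also have "measure D {z..<b} \<le> measure D {a<..<b}"
    using z by (intro D.finite_measure_mono) auto
  finally show ?thesis .
qed

section \<open>Quantiles of the stable law\<close>

lemma one_minus_exp_ge: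
  fixes y :: real
  assumes "0 \<le> y"
  shows "y - y\<^sup>2 / 2 \<le> 1 - exp (- y)"
proof -
  have "(\<lambda>y. 1 - exp (- y) - (y - y\<^sup>2 / 2)) 0 \<le> (\<lambda>y. 1 - exp (- y) - (y - y\<^sup>2 / 2)) y"
  proof (rule DERIV_nonneg_imp_nondecreasing[OF assms])
    fix x :: real assume "0 \<le> x" "x \<le> y"
    have "((\<lambda>y. 1 - exp (- y) - (y - y\<^sup>2 / 2)) has_real_derivative (exp (- x) - (1 - x))) (at x)"
      by (auto intro!: derivative_eq_intros)
    moreover have "0 \<le> exp (- x) - (1 - x)" using exp_ge_add_one_self[of "- x"] by simp
    ultimately show "\<exists>d. ((\<lambda>y. 1 - exp (- y) - (y - y\<^sup>2 / 2)) has_real_derivative d) (at x) \<and> 0 \<le> d" by blast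
  qed
  then show ?thesis by simp
qed

text \<open>Separates the analysis of one law on the line from the point process that produces it.
  \<open>K\<close> stands for \<open>pair_bound\<close> read as a real number.\<close>

locale stable_tail =
  fixes D :: "real measure" and \<alpha> K :: real
  assumes D: "stable_law \<alpha> D" and alpha: "2 < \<alpha>" and K: "0 \<le> K"
    and tail: "\<And>\<mu>. 0 < \<mu> \<Longrightarrow> 1 - exp (- (pi * \<mu>)) \<le> measure D {\<mu> powr (- (\<alpha> / 2)) <..}"
      "\<And>\<mu>. 0 < \<mu> \<Longrightarrow> measure D {\<mu> powr (- (\<alpha> / 2)) <..} \<le> 1 - exp (- (pi * \<mu>)) + K * \<mu>\<^sup>2"
begin

sublocale prob_space D by (rule stable_lawD(1)[OF D])

lemma sets_D [measurable_cong, simp]: "sets D = sets borel"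
  by (rule stable_lawD(2)[OF D])

lemma space_D [simp]: "space D = UNIV"
  by (rule stable_lawD(3)[OF D])

lemma tail_bounds:
  assumes "0 < x"
  defines "u \<equiv> x powr (- (2 / \<alpha>))"
  shows "1 - exp (- (pi * u)) \<le> prob {x<..}" "prob {x<..} \<le> pi * u + K * u\<^sup>2"
proof -
  have u: "0 < u" "u powr (- (\<alpha> / 2)) = x" using assms alpha by (simp_all add: u_def powr_powr)
  show "1 - exp (- (pi * u)) \<le> prob {x<..}" using tail(1)[OF u(1)] u by simp
  show "prob {x<..} \<le> pi * u + K * u\<^sup>2"
    using tail(2)[OF u(1)] u exp_ge_add_one_self[of "- (pi * u)"] by simp
qed

lemma tail_pos: "0 < x \<Longrightarrow> 0 < prob {x<..}"
proof -
  assume x: "0 < x"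
  then have "0 < pi * x powr (- (2 / \<alpha>))" by simp
  then have "exp (- (pi * x powr (- (2 / \<alpha>)))) < 1" by (simp only: exp_less_one_iff neg_less_0_iff_less)
  then show ?thesis using tail_bounds(1)[OF x] by linarith
qed

text \<open>The lower tail bound tends to 1 as the intensity grows and the threshold shrinks to
  0.\<close>

lemma prob_pos_eq_1: "prob {0<..} = 1"
proof (rule antisym)
  have "(\<lambda>n. 1 - exp (- (pi * real (Suc n)))) \<longlonglongrightarrow> 1 - 0"
    by (intro tendsto_intros filterlim_compose[OF exp_at_bot]) real_asymp
  moreover have "1 - exp (- (pi * real (Suc n))) \<le> prob {0<..}" for n
  proof -
    have "1 - exp (- (pi * real (Suc n))) \<le> prob {real (Suc n) powr (- (\<alpha> / 2)) <..}"
      by (rule tail(1)) simp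
    also have "\<dots> \<le> prob {0<..}" by (intro finite_measure_mono) (auto intro: less_le_trans)
    finally show ?thesis .
  qed
  ultimately show "1 \<le> prob {0<..}" by (auto intro: LIMSEQ_le_const2)
qed simp

lemma AE_pos: "AE x in D. 0 < x"
  using prob_pos_eq_1 by (subst (asm) prob_eq_1) auto

text \<open>Take \<open>q\<close> as the supremum of the thresholds exceeded with probability above
  \<open>\<epsilon>\<close>. The lower tail bound, which tends to 1 at 0, makes this set nonempty,
  and the upper bound, which tends to 0 at infinity, makes it bounded. Using \<open>{x<..}\<close>
  below \<open>q\<close> and \<open>{x..}\<close> above it leaves the value at \<open>q\<close> out
  of the discussion.\<close>

lemma exists_quantile:
  assumes \<epsilon>: "0 < \<epsilon>" "\<epsilon> < 1"
  obtains q where "0 < q" "\<And>x. 0 < x \<Longrightarrow> x < q \<Longrightarrow> \<epsilon> < prob {x<..}" "\<And>x. q < x \<Longrightarrow> prob {x..} < \<epsilon>"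
    "1 - exp (- (pi * q powr (- (2 / \<alpha>)))) \<le> \<epsilon>"
    "\<epsilon> \<le> pi * q powr (- (2 / \<alpha>)) + K * (q powr (- (2 / \<alpha>)))\<^sup>2"
proof -
  define u where "u x = x powr (- (2 / \<alpha>))" for x :: real
  define S where "S = {x. 0 < x \<and> \<epsilon> < prob {x<..}}"
  have u_top: "filterlim u at_top (at_right 0)"
    unfolding u_def using alpha by real_asymp
  have u_0: "(u \<longlongrightarrow> 0) at_top"
    unfolding u_def using alpha by real_asymp
  have "((\<lambda>x. 1 - exp (- (pi * u x))) \<longlongrightarrow> 1 - 0) (at_right 0)"
    by (intro tendsto_intros filterlim_compose[OF exp_at_bot] filterlim_uminus_at_bot[THEN iffD2])
       (simp add: filterlim_tendsto_pos_mult_at_top[OF tendsto_const pi_gt_zero u_top])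
  then have "eventually (\<lambda>x. \<epsilon> < 1 - exp (- (pi * u x))) (at_right 0)"
    using \<epsilon> by (auto dest: order_tendstoD(1))
  moreover have "eventually (\<lambda>x. 0 < x) (at_right (0::real))" by (simp add: eventually_at_right_less)
  ultimately have "eventually (\<lambda>x. x \<in> S) (at_right 0)"
    by eventually_elim (use tail_bounds(1) in \<open>force simp: S_def u_def\<close>)
  then have S_ne: "S \<noteq> {}" by (auto dest: eventually_happens')
  have "((\<lambda>x. pi * u x + K * (u x)\<^sup>2) \<longlongrightarrow> pi * 0 + K * 0\<^sup>2) at_top"
    by (intro tendsto_intros u_0)
  then have "eventually (\<lambda>x. pi * u x + K * (u x)\<^sup>2 < \<epsilon>) at_top"
    using \<epsilon> by (auto dest: order_tendstoD(2))
  then obtain x0 where x0: "0 < x0" "pi * u x0 + K * (u x0)\<^sup>2 < \<epsilon>"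
    by (metis (no_types, lifting) eventually_at_top_linorder eventually_conj eventually_gt_at_top order_refl)
  have mono: "prob {y<..} \<le> prob {x<..}" if "x \<le> y" for x y
    using that by (intro finite_measure_mono) auto
  have bdd: "bdd_above S"
  proof (rule bdd_aboveI)
    fix x assume x: "x \<in> S"
    show "x \<le> x0"
    proof (rule ccontr)
      assume "\<not> x \<le> x0"
      then have "prob {x<..} \<le> prob {x0<..}" by (intro mono) simp
      then show False using tail_bounds(2)[OF x0(1)] x0(2) x by (simp add: S_def u_def)
    qed
  qed
  define q where "q = Sup S"
  have less: "\<epsilon> < prob {x<..}" if xq: "x < q" for x
  proof -
    obtain y where "y \<in> S" "x < y" using xq less_cSup_iff[OF S_ne bdd, of x] by (auto simp: q_def)
    then show ?thesis using mono[of x y] by (auto simp: S_def)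
  qed
  have q0: "0 < q"
  proof -
    obtain x where "x \<in> S" using S_ne by auto
    then show ?thesis using cSup_upper[OF _ bdd, of x] by (auto simp: S_def q_def)
  qed
  \<comment> \<open>The supremum alone gives only a weak inequality at the midpoint
    \<open>y\<close>; the positive mass between \<open>y\<close> and \<open>x\<close> makes it
    strict at \<open>x\<close>.\<close>
  have greater: "prob {x..} < \<epsilon>" if "q < x" for x
  proof -
    define y where "y = (q + x) / 2"
    have y: "q < y" "y < x" using that by (auto simp: y_def)
    then have "y \<notin> S" using cSup_upper[OF _ bdd, of y] by (auto simp: q_def)
    then have "prob {y<..} \<le> \<epsilon>" using q0 y by (auto simp: S_def)
    moreover have "prob {y<..<x} + prob {x..} = prob ({y<..<x} \<union> {x..})"
      by (intro finite_measure_Union[symmetric]) auto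
    moreover have "{y<..<x} \<union> {x..} = {y<..}" using y by auto
    moreover have "0 < prob {y<..<x}"
      using q0 y by (intro stable_interval_pos[OF D alpha] tail_pos) auto
    ultimately show ?thesis by simp
  qed
  have u_cont: "(u \<longlongrightarrow> u q) (at q within A)" for A
    unfolding u_def using q0 by (intro tendsto_intros) auto
  \<comment> \<open>The bounds on \<open>\<epsilon>\<close> at \<open>q\<close> itself are one-sided
    limits: this one from the right, the next from the left.\<close>
  have "1 - exp (- (pi * u q)) \<le> \<epsilon>"
  proof (rule tendsto_upperbound)
    show "((\<lambda>x. 1 - exp (- (pi * u x))) \<longlongrightarrow> 1 - exp (- (pi * u q))) (at_right q)"
      by (intro tendsto_intros u_cont)
    have "1 - exp (- (pi * u x)) \<le> \<epsilon>" if "q < x" for x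
    proof -
      have "1 - exp (- (pi * u x)) \<le> prob {x<..}" using that q0 tail_bounds(1)[of x] by (simp add: u_def)
      also have "\<dots> \<le> prob {x..}" by (intro finite_measure_mono) auto
      finally show ?thesis using greater[OF that] by simp
    qed
    then show "eventually (\<lambda>x. 1 - exp (- (pi * u x)) \<le> \<epsilon>) (at_right q)"
      by (simp add: eventually_at_right_less eventually_mono[OF eventually_at_right_less])
  qed simp
  moreover have "\<epsilon> \<le> pi * u q + K * (u q)\<^sup>2"
  proof (rule tendsto_lowerbound)
    show "((\<lambda>x. pi * u x + K * (u x)\<^sup>2) \<longlongrightarrow> pi * u q + K * (u q)\<^sup>2) (at_left q)"
      by (intro tendsto_intros u_cont)
    have "eventually (\<lambda>x. x \<in> {0<..<q}) (at_left q)" using q0 by (rule eventually_at_left_real)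
    then show "eventually (\<lambda>x. \<epsilon> \<le> pi * u x + K * (u x)\<^sup>2) (at_left q)"
    proof eventually_elim
      case (elim x)
      then show ?case using less[of x] tail_bounds(2)[of x] by (simp add: u_def)
    qed
  qed simp
  ultimately show ?thesis
    using that[of q] q0 less greater by (simp add: u_def)
qed

text \<open>\<open>quantile_intensity \<epsilon>\<close> is the intensity at which the unit-power interference
  exceeds 1 with probability \<open>\<epsilon>\<close>.\<close>

definition quantile_intensity :: "real \<Rightarrow> real" where
  "quantile_intensity \<epsilon> = (SOME q. 0 < q \<and> (\<forall>x. 0 < x \<and> x < q \<longrightarrow> \<epsilon> < prob {x<..}) \<and> (\<forall>x>q. prob {x..} < \<epsilon>) \<and>
    1 - exp (- (pi * q powr (- (2 / \<alpha>)))) \<le> \<epsilon> \<and>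
    \<epsilon> \<le> pi * q powr (- (2 / \<alpha>)) + K * (q powr (- (2 / \<alpha>)))\<^sup>2) powr (- (2 / \<alpha>))"

lemma quantile_intensity:
  assumes "0 < \<epsilon>" "\<epsilon> < 1"
  defines "u \<equiv> quantile_intensity \<epsilon>"
  shows "0 < u" "\<And>w. u < w \<Longrightarrow> \<epsilon> < prob {w powr (- (\<alpha> / 2)) <..}"
    "\<And>w. 0 < w \<Longrightarrow> w < u \<Longrightarrow> prob {w powr (- (\<alpha> / 2))..} < \<epsilon>"
    "1 - exp (- (pi * u)) \<le> \<epsilon>" "\<epsilon> \<le> pi * u + K * u\<^sup>2"
proof -
  let ?Q = "\<lambda>q. 0 < q \<and> (\<forall>x. 0 < x \<and> x < q \<longrightarrow> \<epsilon> < prob {x<..}) \<and> (\<forall>x>q. prob {x..} < \<epsilon>) \<and>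
    1 - exp (- (pi * q powr (- (2 / \<alpha>)))) \<le> \<epsilon> \<and>
    \<epsilon> \<le> pi * q powr (- (2 / \<alpha>)) + K * (q powr (- (2 / \<alpha>)))\<^sup>2"
  define q where "q = (SOME q. ?Q q)"
  have "\<exists>q. ?Q q" using exists_quantile[OF assms(1,2)] by metis
  then have q: "?Q q" unfolding q_def by (rule someI_ex)
  have u: "u = q powr (- (2 / \<alpha>))" by (simp add: u_def quantile_intensity_def q_def)
  then have qu: "q = u powr (- (\<alpha> / 2))" using q alpha by (simp add: powr_powr)
  show u0: "0 < u" using q u by simp
  show "\<epsilon> < prob {w powr (- (\<alpha> / 2)) <..}" if "u < w" for w
  proof -
    have "w powr (- (\<alpha> / 2)) < q" unfolding qu using that u0 alpha by (intro powr_less_mono2_neg) auto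
    then show ?thesis using q that u0 by auto
  qed
  show "prob {w powr (- (\<alpha> / 2))..} < \<epsilon>" if "0 < w" "w < u" for w
  proof -
    have "q < w powr (- (\<alpha> / 2))" unfolding qu using that alpha by (intro powr_less_mono2_neg) auto
    then show ?thesis using q by auto
  qed
  show "1 - exp (- (pi * u)) \<le> \<epsilon>" "\<epsilon> \<le> pi * u + K * u\<^sup>2" using q u by auto
qed

text \<open>The two bounds from the tail hold \<open>pi * u\<close> within a quadratic error of
  \<open>\<epsilon>\<close>: \<open>K\<close> comes from pairs of points, \<open>pi^2 / 2\<close>
  from the second-order term of the exponential, and the summand 1 from the factor
  \<open>1 - \<epsilon>\<close>.\<close>

lemma quantile_intensity_asymp:
  assumes "0 < \<epsilon>" "\<epsilon> \<le> 1 / 2"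
  shows "\<bar>quantile_intensity \<epsilon> * (1 - \<epsilon>) - \<epsilon> / pi\<bar> \<le> (K + pi\<^sup>2 / 2 + 1) * \<epsilon>\<^sup>2"
proof -
  define u where "u = quantile_intensity \<epsilon>"
  have u: "0 < u" "1 - exp (- (pi * u)) \<le> \<epsilon>" "\<epsilon> \<le> pi * u + K * u\<^sup>2"
    using quantile_intensity[of \<epsilon>] assms by (auto simp: u_def)
  \<comment> \<open>An a priori bound \<open>u <= \<epsilon>\<close> is obtained here, so that
    errors quadratic in \<open>u\<close> become quadratic in \<open>\<epsilon>\<close>; it uses
    \<open>\<epsilon> <= 1/2\<close> and \<open>pi > 2\<close>.\<close>
  have "(1 - \<epsilon>) * (1 + pi * u) \<le> exp (- (pi * u)) * exp (pi * u)"
    using u assms exp_ge_add_one_self[of "pi * u"] by (intro mult_mono) auto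
  then have "(1 - \<epsilon>) * (1 + pi * u) \<le> 1" by (simp add: mult_exp_exp)
  then have a: "(1 - \<epsilon>) * (pi * u) \<le> \<epsilon>" by (simp add: algebra_simps)
  have b: "(1 / 2) * (pi * u) \<le> (1 - \<epsilon>) * (pi * u)" using assms u by (intro mult_right_mono) auto
  have "pi * u \<le> 2 * \<epsilon>" using a b by linarith
  moreover have "2 * u \<le> pi * u" using pi_gt3 u by (intro mult_right_mono) auto
  ultimately have ue: "u \<le> \<epsilon>" by simp
  have u2: "u\<^sup>2 \<le> \<epsilon>\<^sup>2" using ue u by (intro power_mono) auto
  have "pi * u - (pi * u)\<^sup>2 / 2 \<le> \<epsilon>" using one_minus_exp_ge[of "pi * u"] u by simp
  then have "pi * u - pi\<^sup>2 / 2 * u\<^sup>2 \<le> \<epsilon>" by (simp add: power_mult_distrib)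
  moreover have "0 \<le> K * u\<^sup>2" "0 \<le> pi\<^sup>2 / 2 * u\<^sup>2" using K by auto
  ultimately have "\<bar>pi * u - \<epsilon>\<bar> \<le> K * u\<^sup>2 + pi\<^sup>2 / 2 * u\<^sup>2"
    using u(3) by linarith
  also have "\<dots> = (K + pi\<^sup>2 / 2) * u\<^sup>2" by (simp add: algebra_simps)
  also have "\<dots> \<le> (K + pi\<^sup>2 / 2) * \<epsilon>\<^sup>2" using u2 K by (intro mult_left_mono) auto
  finally have 1: "\<bar>pi * u - \<epsilon>\<bar> \<le> (K + pi\<^sup>2 / 2) * \<epsilon>\<^sup>2" .
  have "\<bar>u - \<epsilon> / pi\<bar> = \<bar>pi * u - \<epsilon>\<bar> / pi"
  proof -
    have "u - \<epsilon> / pi = (pi * u - \<epsilon>) / pi" by (simp add: field_simps)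
    then show ?thesis by (simp add: abs_divide)
  qed
  also have "\<dots> \<le> \<bar>pi * u - \<epsilon>\<bar>" using pi_gt3 by (simp add: divide_le_eq mult_le_cancel_left1)
  finally have "\<bar>u - \<epsilon> / pi\<bar> \<le> (K + pi\<^sup>2 / 2) * \<epsilon>\<^sup>2" using 1 by simp
  moreover have "\<bar>u * \<epsilon>\<bar> \<le> \<epsilon>\<^sup>2"
    using ue u assms by (simp add: power2_eq_square abs_mult mult_right_mono)
  ultimately have "\<bar>(u - \<epsilon> / pi) - u * \<epsilon>\<bar> \<le> (K + pi\<^sup>2 / 2) * \<epsilon>\<^sup>2 + \<epsilon>\<^sup>2" by linarith
  then show ?thesis by (simp add: u_def[symmetric] algebra_simps)
qed

end

section \<open>Limits of outage probabilities and of their inverses\<close>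

text \<open>Injectivity of \<open>out N\<close> is not assumed, so \<open>inv_into\<close> picks
  some preimage. Monotonicity places every preimage on the correct side of any \<open>b\<close> at
  which \<open>out N b\<close> is strictly on one side of \<open>\<epsilon>\<close>. If
  \<open>m > 0\<close>, the branch with value 0 is eventually excluded, because
  \<open>lo N <= out N b < \<epsilon>\<close> for some \<open>b\<close> below
  \<open>m\<close>.\<close>

lemma tendsto_inverse_of_mono:
  fixes out :: "nat \<Rightarrow> real \<Rightarrow> real" and lo :: "nat \<Rightarrow> real"
  assumes m: "0 \<le> m"
    and mono: "eventually (\<lambda>N. \<forall>x y. 0 < x \<longrightarrow> x \<le> y \<longrightarrow> out N x \<le> out N y) sequentially"
    and surj: "eventually (\<lambda>N. lo N < \<epsilon> \<longrightarrow> \<epsilon> \<in> out N ` {0<..}) sequentially"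
    and lo: "eventually (\<lambda>N. \<forall>x>0. lo N \<le> out N x) sequentially"
    and above: "\<And>x. m < x \<Longrightarrow> eventually (\<lambda>N. \<epsilon> < out N x) sequentially"
    and below: "\<And>x. 0 < x \<Longrightarrow> x < m \<Longrightarrow> eventually (\<lambda>N. out N x < \<epsilon>) sequentially"
  shows "(\<lambda>N. if \<epsilon> \<le> lo N then 0 else inv_into {0<..} (out N) \<epsilon>) \<longlonglongrightarrow> m"
proof (rule order_tendstoI)
  let ?x = "\<lambda>N. if \<epsilon> \<le> lo N then 0 else inv_into {0<..} (out N) \<epsilon>"
  have inv: "eventually (\<lambda>N. lo N < \<epsilon> \<longrightarrow> 0 < inv_into {0<..} (out N) \<epsilon> \<and> out N (inv_into {0<..} (out N) \<epsilon>) = \<epsilon>) sequentially"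
    using surj
  proof eventually_elim
    case (elim N)
    then show ?case using inv_into_into[of \<epsilon> "out N" "{0<..}"] f_inv_into_f[of \<epsilon> "out N" "{0<..}"] by auto
  qed
  fix a :: real
  {
    assume "a < m"
    show "eventually (\<lambda>N. a < ?x N) sequentially"
    proof (cases "a < 0")
      case True
      show ?thesis using inv by eventually_elim (use True in auto)
    next
      case False
      define b where "b = (a + m) / 2"
      have b: "a < b" "b < m" "0 < b" using False \<open>a < m\<close> by (auto simp: b_def)
      show ?thesis using inv mono lo below[OF b(3,2)]
      proof eventually_elim
        case (elim N)
        have "lo N < \<epsilon>" using elim(3,4) b by (meson le_less_trans)
        moreover have "\<not> inv_into {0<..} (out N) \<epsilon> \<le> b"
        proof
          assume "inv_into {0<..} (out N) \<epsilon> \<le> b"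
          then have "out N (inv_into {0<..} (out N) \<epsilon>) \<le> out N b"
            using elim(1,2) \<open>lo N < \<epsilon>\<close> by blast
          then show False using elim(1,4) \<open>lo N < \<epsilon>\<close> by auto
        qed
        ultimately show ?case using b by auto
      qed
    qed
  next
    assume "m < a"
    define b where "b = (a + m) / 2"
    have b: "b < a" "m < b" "0 < b" using m \<open>m < a\<close> by (auto simp: b_def)
    show "eventually (\<lambda>N. ?x N < a) sequentially"
      using inv mono above[OF b(2)]
    proof eventually_elim
      case (elim N)
      show ?case
      proof (cases "\<epsilon> \<le> lo N")
        case False
        have "\<not> b \<le> inv_into {0<..} (out N) \<epsilon>"
        proof
          assume "b \<le> inv_into {0<..} (out N) \<epsilon>"
          then have "out N b \<le> out N (inv_into {0<..} (out N) \<epsilon>)"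
            using elim(2) b by blast
          then show False using elim(1,3) False by auto
        qed
        then show ?thesis using b False by auto
      qed (use b in auto)
    qed
  }
qed

section \<open>Mixtures of distribution functions with the stable law\<close>

context stable_tail begin

lemma prob_UNIV [simp]: "prob UNIV = 1"
  using prob_space by simp

text \<open>\<open>A\<close> plays the role of the distribution function of \<open>W / \<beta> - Y - 1\<close>, so that
  \<open>mixture A c\<close> is the probability that this variable is at most \<open>c\<close> times a stable one.\<close>

definition mixture :: "(real \<Rightarrow> real) \<Rightarrow> real \<Rightarrow> real" where
  "mixture A c = expectation (\<lambda>x. A (c * x))"

text \<open>Weak enough to hold for the zero function, which later stands in at those
  \<open>N\<close> where the model gives nothing.\<close>

definition dist_fun :: "(real \<Rightarrow> real) \<Rightarrow> bool" where
  "dist_fun A \<longleftrightarrow> mono A \<and> (\<forall>x. 0 \<le> A x \<and> A x \<le> 1)"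

lemma dist_fun_measurable: "dist_fun A \<Longrightarrow> A \<in> borel_measurable borel"
  by (auto simp: dist_fun_def intro: borel_measurable_mono)

lemma dist_fun_integrable: "dist_fun A \<Longrightarrow> integrable D (\<lambda>x. A (c * x))"
  using dist_fun_measurable[of A] by (intro integrable_const_bound[where B=1]) (auto simp: dist_fun_def)

lemma mixture_mono:
  assumes A: "dist_fun A" and "c \<le> c'"
  shows "mixture A c \<le> mixture A c'"
  unfolding mixture_def
proof (rule integral_mono_AE)
  show "AE x in D. A (c * x) \<le> A (c' * x)"
    using AE_pos
  proof eventually_elim
    case (elim x)
    then show ?case using assms by (auto simp: dist_fun_def intro!: monoD[of A] mult_right_mono)
  qed
qed (use A in \<open>auto intro: dist_fun_integrable\<close>)

lemma mixture_0: "mixture A 0 = A 0"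
  by (simp add: mixture_def prob_space)

lemma mixture_tendsto:
  assumes A: "dist_fun A" and "\<And>x. 0 < x \<Longrightarrow> (\<lambda>n. A (c n * x)) \<longlonglongrightarrow> L x" and [measurable]: "L \<in> borel_measurable borel"
  shows "(\<lambda>n. mixture A (c n)) \<longlonglongrightarrow> expectation L"
  unfolding mixture_def
proof (rule integral_dominated_convergence[where w="\<lambda>_. 1"])
  show "AE x in D. (\<lambda>n. A (c n * x)) \<longlonglongrightarrow> L x" using AE_pos by eventually_elim (rule assms(2))
qed (use A dist_fun_measurable[OF A] in \<open>auto simp: dist_fun_def\<close>)

text \<open>The mixture is continuous in \<open>c\<close> by dominated convergence, starts at
  \<open>A 0\<close> and tends to 1, so the intermediate value theorem applies; \<open>c = 0\<close>
  is ruled out by \<open>A 0 < \<epsilon>\<close>.\<close>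

lemma mixture_surj:
  assumes A: "dist_fun A" and cont: "continuous_on UNIV A" and top: "(A \<longlongrightarrow> 1) at_top" and \<epsilon>: "A 0 < \<epsilon>" "\<epsilon> < 1"
  obtains c where "0 < c" "mixture A c = \<epsilon>"
proof -
  have [measurable]: "A \<in> borel_measurable borel" by (rule dist_fun_measurable[OF A])
  have "(\<lambda>n. mixture A (real n)) \<longlonglongrightarrow> expectation (\<lambda>_. 1)"
  proof (rule mixture_tendsto[OF A])
    fix x :: real assume x: "0 < x"
    have "filterlim (\<lambda>n. real n * x) at_top sequentially"
      using x by real_asymp
    then show "(\<lambda>n. A (real n * x)) \<longlonglongrightarrow> 1" by (rule filterlim_compose[OF top])
  qed simp
  then have "eventually (\<lambda>n. \<epsilon> < mixture A (real n)) sequentially"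
    using \<epsilon> by (auto simp: prob_space dest: order_tendstoD(1))
  then obtain n where n: "\<epsilon> < mixture A (real n)" by (auto simp: eventually_sequentially)
  have "isCont (mixture A) c" for c
    unfolding continuous_at_sequentially comp_def
  proof (intro allI impI)
    fix s :: "nat \<Rightarrow> real" assume s: "s \<longlonglongrightarrow> c"
    show "(\<lambda>n. mixture A (s n)) \<longlonglongrightarrow> mixture A c"
      unfolding mixture_def[of A c]
    proof (rule mixture_tendsto[OF A])
      fix x :: real
      have "isCont A (c * x)" using cont by (simp add: continuous_on_eq_continuous_at)
      then show "(\<lambda>n. A (s n * x)) \<longlonglongrightarrow> A (c * x)"
        by (rule isCont_tendsto_compose) (intro tendsto_intros s)
    qed measurable
  qed
  then obtain c where c: "0 \<le> c" "mixture A c = \<epsilon>"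
    using IVT[of "mixture A" 0 \<epsilon> "real n"] n \<epsilon> by (auto simp: mixture_0)
  moreover have "c \<noteq> 0" using c \<epsilon> by (auto simp: mixture_0)
  ultimately show ?thesis using that[of c] by simp
qed

text \<open>In the limit \<open>A N\<close> is a step at \<open>v\<close>, with its behaviour at
  \<open>v\<close> unspecified. Hence only outcomes with \<open>v < C * x\<close> are kept, and a
  point \<open>y\<close> strictly between absorbs the error of \<open>c N\<close> by
  monotonicity.\<close>

lemma mixture_limit_above:
  assumes A: "\<And>N. dist_fun (A N)" and c: "c \<longlonglongrightarrow> C"
    and one: "\<And>x. v < x \<Longrightarrow> (\<lambda>N. A N x) \<longlonglongrightarrow> 1" and \<epsilon>: "\<epsilon> < prob {x. v < C * x}"
  shows "eventually (\<lambda>N. \<epsilon> < mixture (A N) (c N)) sequentially"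
proof -
  note [measurable] = dist_fun_measurable[OF A]
  have "(\<lambda>N. expectation (\<lambda>x. A N (c N * x) * indicator {x. v < C * x} x)) \<longlonglongrightarrow> expectation (indicator {x. v < C * x})"
  proof (rule integral_dominated_convergence[where w="\<lambda>_. 1"])
    have "(\<lambda>N. A N (c N * x) * indicator {x. v < C * x} x) \<longlonglongrightarrow> indicator {x. v < C * x} x" for x
    proof (cases "v < C * x")
      case True
      define y where "y = (v + C * x) / 2"
      have y: "v < y" "y < C * x" using True by (auto simp: y_def)
      have "(\<lambda>N. c N * x) \<longlonglongrightarrow> C * x" by (intro tendsto_intros c)
      from order_tendstoD(1)[OF this y(2)] have e1: "eventually (\<lambda>N. A N y \<le> A N (c N * x)) sequentially"
        by eventually_elim (use A in \<open>auto simp: dist_fun_def intro: monoD\<close>)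
      have "(\<lambda>N. A N (c N * x)) \<longlonglongrightarrow> 1"
        by (rule tendsto_sandwich[OF e1 _ one[OF y(1)] tendsto_const]) (use A in \<open>auto simp: dist_fun_def\<close>)
      then show ?thesis using True by simp
    qed simp
    then show "AE x in D. (\<lambda>N. A N (c N * x) * indicator {x. v < C * x} x) \<longlonglongrightarrow> indicator {x. v < C * x} x"
      by simp
    show "AE x in D. norm (A N (c N * x) * indicator {x. v < C * x} x) \<le> 1" for N
      using A[of N] by (auto simp: dist_fun_def split: split_indicator)
  qed auto
  then have "eventually (\<lambda>N. \<epsilon> < expectation (\<lambda>x. A N (c N * x) * indicator {x. v < C * x} x)) sequentially"
    using \<epsilon> by (auto dest: order_tendstoD(1))
  then show ?thesis
  proof eventually_elim
    case (elim N)
    have "expectation (\<lambda>x. A N (c N * x) * indicator {x. v < C * x} x) \<le> mixture (A N) (c N)"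
      unfolding mixture_def using A[of N]
      by (intro integral_mono integrable_const_bound[where B=1] dist_fun_integrable)
         (auto simp: dist_fun_def split: split_indicator)
    then show ?case using elim by simp
  qed
qed

text \<open>The maximum with the indicator dominates \<open>A N\<close> on the boundary
  \<open>v = C * x\<close>, where no limit is available, and has the limit that is needed
  elsewhere.\<close>

lemma mixture_limit_below:
  assumes A: "\<And>N. dist_fun (A N)" and c: "c \<longlonglongrightarrow> C"
    and zero: "\<And>x. x < v \<Longrightarrow> (\<lambda>N. A N x) \<longlonglongrightarrow> 0" and \<epsilon>: "prob {x. v \<le> C * x} < \<epsilon>"
  shows "eventually (\<lambda>N. mixture (A N) (c N) < \<epsilon>) sequentially"
proof -
  note [measurable] = dist_fun_measurable[OF A]
  have "(\<lambda>N. expectation (\<lambda>x. max (A N (c N * x)) (indicator {x. v \<le> C * x} x))) \<longlonglongrightarrow> expectation (indicator {x. v \<le> C * x})"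
  proof (rule integral_dominated_convergence[where w="\<lambda>_. 1"])
    have "(\<lambda>N. max (A N (c N * x)) (indicator {x. v \<le> C * x} x)) \<longlonglongrightarrow> indicator {x. v \<le> C * x} x" for x
    proof (cases "v \<le> C * x")
      case True
      have "max (A N (c N * x)) 1 = 1" for N using A[of N] by (auto simp: dist_fun_def max_def antisym)
      then show ?thesis using True by simp
    next
      case False
      define y where "y = (v + C * x) / 2"
      have y: "y < v" "C * x < y" using False by (auto simp: y_def)
      have "(\<lambda>N. c N * x) \<longlonglongrightarrow> C * x" by (intro tendsto_intros c)
      from order_tendstoD(2)[OF this y(2)] have e1: "eventually (\<lambda>N. A N (c N * x) \<le> A N y) sequentially"
        by eventually_elim (use A in \<open>auto simp: dist_fun_def intro: monoD\<close>)
      have "(\<lambda>N. A N (c N * x)) \<longlonglongrightarrow> 0"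
        by (rule tendsto_sandwich[OF _ e1 tendsto_const zero[OF y(1)]]) (use A in \<open>auto simp: dist_fun_def\<close>)
      then have "(\<lambda>N. max (A N (c N * x)) 0) \<longlonglongrightarrow> max 0 0" by (intro tendsto_intros)
      then show ?thesis using False by simp
    qed
    then show "AE x in D. (\<lambda>N. max (A N (c N * x)) (indicator {x. v \<le> C * x} x)) \<longlonglongrightarrow> indicator {x. v \<le> C * x} x"
      by simp
    show "AE x in D. norm (max (A N (c N * x)) (indicator {x. v \<le> C * x} x)) \<le> 1" for N
      using A[of N] by (auto simp: dist_fun_def max_def split: split_indicator)
  qed auto
  then have "eventually (\<lambda>N. expectation (\<lambda>x. max (A N (c N * x)) (indicator {x. v \<le> C * x} x)) < \<epsilon>) sequentially"
    using \<epsilon> by (auto dest: order_tendstoD(2))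
  then show ?thesis
  proof eventually_elim
    case (elim N)
    have "mixture (A N) (c N) \<le> expectation (\<lambda>x. max (A N (c N * x)) (indicator {x. v \<le> C * x} x))"
      unfolding mixture_def using A[of N]
      by (intro integral_mono integrable_const_bound[where B=1] dist_fun_integrable)
         (auto simp: dist_fun_def max_def split: split_indicator)
    then show ?case using elim by simp
  qed
qed

text \<open>In the limit outage is the event that the stable variable, times
  \<open>\<rho> * x powr (\<alpha> / 2)\<close>, exceeds \<open>v\<close>. For \<open>v > 0\<close>
  its probability crosses \<open>\<epsilon>\<close> at
  \<open>(v / \<rho>) powr (2 / \<alpha>)\<close> times the quantile intensity; for
  \<open>v <= 0\<close> it is 1 at every positive intensity, which drives the inverse to 0.\<close>

theorem inverse_mixture_limit:
  fixes out :: "nat \<Rightarrow> real \<Rightarrow> real" and A :: "nat \<Rightarrow> real \<Rightarrow> real" and m :: "nat \<Rightarrow> real"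
  assumes \<rho>: "0 < \<rho>" and m: "m \<longlonglongrightarrow> \<rho> powr (2 / \<alpha>)"
    and dA: "\<And>N. dist_fun (A N)"
    and A: "eventually (\<lambda>N. continuous_on UNIV (A N) \<and> ((A N) \<longlongrightarrow> 1) at_top) sequentially"
    and out: "eventually (\<lambda>N. \<forall>\<mu>>0. out N \<mu> = mixture (A N) ((\<mu> * m N) powr (\<alpha> / 2))) sequentially"
    and lo: "eventually (\<lambda>N. lo N = A N 0) sequentially"
    and one: "\<And>x. v < x \<Longrightarrow> (\<lambda>N. A N x) \<longlonglongrightarrow> 1"
    and zero: "\<And>x. x < v \<Longrightarrow> (\<lambda>N. A N x) \<longlonglongrightarrow> 0"
    and \<epsilon>: "0 < \<epsilon>" "\<epsilon> < 1"
  shows "(\<lambda>N. if \<epsilon> \<le> lo N then 0 else inv_into {0<..} (out N) \<epsilon>)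
    \<longlonglongrightarrow> (max (v / \<rho>) 0) powr (2 / \<alpha>) * quantile_intensity \<epsilon>"
proof (rule tendsto_inverse_of_mono)
  let ?d = "2 / \<alpha>" and ?p = "\<alpha> / 2" and ?u = "quantile_intensity \<epsilon>"
  have dp: "?d * ?p = 1" using alpha by simp
  have u: "0 < ?u" using quantile_intensity(1)[OF \<epsilon>] .
  show "0 \<le> (max (v / \<rho>) 0) powr ?d * ?u" using u by simp
  have m_pos: "eventually (\<lambda>N. 0 < m N) sequentially"
    using \<rho> by (intro order_tendstoD(1)[OF m]) simp
  show "eventually (\<lambda>N. \<forall>x y. 0 < x \<longrightarrow> x \<le> y \<longrightarrow> out N x \<le> out N y) sequentially"
    using out m_pos
  proof eventually_elim
    case (elim N)
    show ?case
    proof (intro allI impI)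
      fix x y :: real assume "0 < x" "x \<le> y"
      then show "out N x \<le> out N y" 
        using elim alpha dA by (auto intro!: mixture_mono powr_mono2 mult_right_mono)
    qed
  qed
  show "eventually (\<lambda>N. lo N < \<epsilon> \<longrightarrow> \<epsilon> \<in> out N ` {0<..}) sequentially"
    using A out lo m_pos
  proof eventually_elim
    case (elim N)
    show ?case
    proof
      assume "lo N < \<epsilon>"
      then obtain c where c: "0 < c" "mixture (A N) c = \<epsilon>"
        using mixture_surj[OF dA, of N \<epsilon>] elim \<epsilon> by metis
      \<comment> \<open>The witness is the intensity solving
        \<open>(\<mu> * m N) powr (\<alpha> / 2) = c\<close>.\<close>
      have "out N (c powr ?d / m N) = mixture (A N) ((c powr ?d / m N * m N) powr ?p)"
        using elim c by simp
      also have "(c powr ?d / m N * m N) powr ?p = c"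
        using elim c dp by (simp add: powr_powr)
      finally have "out N (c powr ?d / m N) = \<epsilon>" using c by simp
      moreover have "0 < c powr ?d / m N" using c elim by simp
      ultimately show "\<epsilon> \<in> out N ` {0<..}" by force
    qed
  qed
  show "eventually (\<lambda>N. \<forall>x>0. lo N \<le> out N x) sequentially"
    using out lo
  proof eventually_elim
    case (elim N)
    then show ?case using mixture_mono[OF dA, of 0 _ N] by (auto simp: mixture_0)
  qed
  have c_lim: "(\<lambda>N. (x * m N) powr ?p) \<longlonglongrightarrow> x powr ?p * \<rho>" if "0 < x" for x
  proof -
    have "(\<lambda>N. (x * m N) powr ?p) \<longlonglongrightarrow> (x * \<rho> powr ?d) powr ?p"
      using that \<rho> by (intro tendsto_intros m) auto
    also have "(x * \<rho> powr ?d) powr ?p = x powr ?p * \<rho>"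
      using that \<rho> dp by (simp add: powr_mult powr_powr)
    finally show ?thesis .
  qed
  \<comment> \<open>Writes \<open>v\<close> as the limiting scale times the threshold belonging to
    the normalised intensity, so that the half-lines in the quantile lemma become the events about
    \<open>v\<close>.\<close>
  have thr: "v = (x powr ?p * \<rho>) * (x / (v / \<rho>) powr ?d) powr (- ?p)" if "0 < x" "0 < v" for x
  proof -
    define a where "a = v / \<rho>"
    have a: "0 < a" using that \<rho> by (simp add: a_def)
    have "(x / a powr ?d) powr (- ?p) = x powr (- ?p) / (a powr ?d) powr (- ?p)"
      by (rule powr_divide)
    also have "(a powr ?d) powr (- ?p) = 1 / a"
      using alpha a by (simp add: powr_powr powr_minus_divide)
    finally have "(x / (v / \<rho>) powr ?d) powr (- ?p) = x powr (- ?p) * (v / \<rho>)"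
      by (simp add: a_def)
    then show ?thesis using that \<rho> by (simp add: powr_minus)
  qed
  show "eventually (\<lambda>N. \<epsilon> < out N x) sequentially" if x: "(max (v / \<rho>) 0) powr ?d * ?u < x" for x
  proof -
    have x0: "0 < x" using x u by (meson le_less_trans mult_nonneg_nonneg powr_ge_zero less_imp_le)
    have C: "0 < x powr ?p * \<rho>" using x0 \<rho> by simp
    have "\<epsilon> < prob {y. v < (x powr ?p * \<rho>) * y}"
    proof (cases "0 < v")
      case True
      let ?w = "x / (v / \<rho>) powr ?d"
      have "?u < ?w" using x True \<rho> by (simp add: pos_less_divide_eq mult.commute)
      then have "\<epsilon> < prob {?w powr (- ?p) <..}" by (rule quantile_intensity(2)[OF \<epsilon>])
      also have "{?w powr (- ?p) <..} = {y. v < (x powr ?p * \<rho>) * y}"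
        by (subst thr[OF x0 True]) (use C in \<open>auto simp only: mult_less_cancel_left_pos greaterThan_def\<close>)
      finally show ?thesis .
    next
      case False
      \<comment> \<open>With \<open>v <= 0\<close> the event contains the positive half-line, which
        has probability 1.\<close>
      have "prob {0<..} \<le> prob {y. v < (x powr ?p * \<rho>) * y}"
        using C False by (intro finite_measure_mono) (auto intro: le_less_trans[of v 0] mult_pos_pos simp: not_less)
      then show ?thesis using \<epsilon> prob_pos_eq_1 by simp
    qed
    then have "eventually (\<lambda>N. \<epsilon> < mixture (A N) ((x * m N) powr ?p)) sequentially"
      by (intro mixture_limit_above[OF dA c_lim[OF x0]] one)
    with out show ?thesis by eventually_elim (use x0 in simp)
  qed
  show "eventually (\<lambda>N. out N x < \<epsilon>) sequentially" if x0: "0 < x" and x: "x < (max (v / \<rho>) 0) powr ?d * ?u" for x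
  proof -
    have v: "0 < v"
    proof (rule ccontr)
      assume "\<not> 0 < v"
      then have "max (v / \<rho>) 0 = 0" using \<rho> by (simp add: max_def divide_le_0_iff)
      then show False using x x0 by simp
    qed
    have C: "0 < x powr ?p * \<rho>" using x0 \<rho> by simp
    let ?w = "x / (v / \<rho>) powr ?d"
    have "?w < ?u" "0 < ?w" using x x0 v \<rho> by (simp_all add: pos_divide_less_eq mult.commute)
    then have "prob {?w powr (- ?p)..} < \<epsilon>" by (intro quantile_intensity(3)[OF \<epsilon>])
    also have "{?w powr (- ?p)..} = {y. v \<le> (x powr ?p * \<rho>) * y}"
      by (subst thr[OF x0 v]) (use C in \<open>auto simp only: mult_le_cancel_left_pos atLeast_def\<close>)
    finally have "prob {y. v \<le> (x powr ?p * \<rho>) * y} < \<epsilon>" .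
    then have "eventually (\<lambda>N. mixture (A N) ((x * m N) powr ?p) < \<epsilon>) sequentially"
      by (intro mixture_limit_below[OF dA c_lim[OF x0]] zero)
    with out show ?thesis by eventually_elim (use x0 in simp)
  qed
qed

end

section \<open>The random variables of the model\<close>

text \<open>The two densities can differ only at 0, a null set, so the Erlang moment formulas become
  available.\<close>

lemma (in prob_space) gamma_distributed_erlang:
  assumes "gamma_distributed M Z (real (Suc k)) \<theta>" "0 < \<theta>"
  shows "distributed M lborel Z (\<lambda>x. ennreal (erlang_density k (1 / \<theta>) x))"
proof -
  have d: "distr M lborel Z = density lborel (\<lambda>x. ennreal (gamma_density (real (Suc k)) \<theta> x))"
    and gm: "(\<lambda>x. ennreal (gamma_density (real (Suc k)) \<theta> x)) \<in> borel_measurable lborel"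
    and Z: "Z \<in> measurable M lborel"
    using assms(1) by (auto simp: gamma_distributed_def distributed_def)
  have "AE x in lborel. x \<noteq> (0::real)" by (rule AE_lborel_singleton)
  then have "AE x in lborel. ennreal (gamma_density (real (Suc k)) \<theta> x) = ennreal (erlang_density k (1 / \<theta>) x)"
    by eventually_elim (use gamma_density_eq_erlang_density[OF assms(2)] in auto)
  then have "density lborel (\<lambda>x. ennreal (gamma_density (real (Suc k)) \<theta> x)) = density lborel (\<lambda>x. ennreal (erlang_density k (1 / \<theta>) x))"
    by (intro density_cong gm) auto
  then show ?thesis using d Z by (simp add: distributed_def)
qed

lemma (in prob_space) gamma_moments:
  assumes g: "gamma_distributed M Z (real (Suc k)) \<theta>" and \<theta>: "0 < \<theta>"
  shows "AE \<omega> in M. 0 \<le> Z \<omega>" "integrable M Z" "integrable M (\<lambda>\<omega>. (Z \<omega>)\<^sup>2)"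
    and "expectation Z = real (Suc k) * \<theta>" "variance Z = real (Suc k) * \<theta>\<^sup>2"
proof -
  note e = gamma_distributed_erlang[OF assms]
  have l: "0 < 1 / \<theta>" using \<theta> by simp
  show "AE \<omega> in M. 0 \<le> Z \<omega>"
    by (subst distributed_AE2[OF e]) (auto simp: erlang_density_def)
  show "integrable M Z" "integrable M (\<lambda>\<omega>. (Z \<omega>)\<^sup>2)"
    using erlang_ith_moment_integrable[OF l e, of 1] erlang_ith_moment_integrable[OF l e, of 2] by simp_all
  show "expectation Z = real (Suc k) * \<theta>"
    using erlang_ith_moment[OF l e, of 1] by simp
  show "variance Z = real (Suc k) * \<theta>\<^sup>2"
    using erlang_distributed_variance[OF l e] by (simp add: power_divide)
qed

lemma (in prob_space) prob_distributed_eq: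
  assumes "distributed M lborel Z f"
  shows "emeasure M {\<omega> \<in> space M. Z \<omega> = (c::real)} = 0"
proof -
  have "{\<omega> \<in> space M. Z \<omega> = c} = Z -` {c} \<inter> space M" by auto
  also have "emeasure M \<dots> = (\<integral>\<^sup>+x. f x * indicator {c} x \<partial>lborel)"
    by (rule distributed_emeasure[OF assms]) simp
  also have "\<dots> = 0"
    using AE_lborel_singleton[of c] distributed_borel_measurable[OF assms]
    by (subst nn_integral_0_iff_AE) (auto elim!: eventually_mono)
  finally show ?thesis .
qed

lemma (in prob_space) indep_sets_reindex:
  assumes F: "indep_sets F UNIV" and "inj g"
  shows "indep_sets (\<lambda>i. F (g i)) UNIV"
proof (rule indep_setsI)
  show "F (g i) \<subseteq> events" for i using F by (auto simp: indep_sets_def)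
  fix A J assume J: "J \<noteq> {}" "J \<subseteq> UNIV" "finite J" and A: "\<forall>j\<in>J. A j \<in> F (g j)"
  let ?A = "\<lambda>k. A (inv g k)"
  have "prob (\<Inter>k\<in>g ` J. ?A k) = (\<Prod>k\<in>g ` J. prob (?A k))"
    using J A \<open>inj g\<close> by (intro indep_setsD[OF F]) auto
  then show "prob (\<Inter>j\<in>J. A j) = (\<Prod>j\<in>J. prob (A j))"
    using \<open>inj g\<close> by (simp add: prod.reindex inj_on_subset)
qed

text \<open>Passes from variables of a common type to functions of them with different value
  types.\<close>

lemma (in prob_space) indep_pair_compose:
  assumes ind: "indep_var S A T B" and f: "f \<in> measurable S S'" and g: "g \<in> measurable T T'"
  shows "indep_pair S' (\<lambda>\<omega>. f (A \<omega>)) T' (\<lambda>\<omega>. g (B \<omega>))"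
proof -
  have [measurable]: "A \<in> measurable M S" "B \<in> measurable M T"
    using indep_var_rv1[OF ind] indep_var_rv2[OF ind] by auto
  note [measurable] = f g
  have "distr M (S' \<Otimes>\<^sub>M T') (\<lambda>\<omega>. (f (A \<omega>), g (B \<omega>)))
    = distr (distr M (S \<Otimes>\<^sub>M T) (\<lambda>\<omega>. (A \<omega>, B \<omega>))) (S' \<Otimes>\<^sub>M T') (\<lambda>(x, y). (f x, g y))"
    by (subst distr_distr) (auto simp: comp_def)
  also have "distr M (S \<Otimes>\<^sub>M T) (\<lambda>\<omega>. (A \<omega>, B \<omega>)) = distr M S A \<Otimes>\<^sub>M distr M T B"
    using ind by (simp add: indep_var_distribution_eq)
  also have "distr (distr M S A \<Otimes>\<^sub>M distr M T B) (S' \<Otimes>\<^sub>M T') (\<lambda>(x, y). (f x, g y)) = distr (distr M S A) S' f \<Otimes>\<^sub>M distr (distr M T B) T' g"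
    by (rule pair_measure_distr[symmetric]) 
       (auto simp: distr_distr comp_def intro!: prob_space_imp_sigma_finite prob_space_distr)
  also have "\<dots> = distr M S' (\<lambda>\<omega>. f (A \<omega>)) \<Otimes>\<^sub>M distr M T' (\<lambda>\<omega>. g (B \<omega>))"
    by (simp add: distr_distr comp_def)
  finally show ?thesis by (simp add: indep_pair_def)
qed

text \<open>After dividing by \<open>\<rho>\<close> the claim is
  \<open>|t powr d - 1| <= |t - 1|\<close>, true because \<open>t powr d\<close> lies between 1 and
  \<open>t\<close>.\<close>

lemma powr_diff_le:
  fixes x \<rho> d :: real
  assumes "0 \<le> x" "0 < \<rho>" "0 < d" "d < 1"
  shows "\<bar>x powr d - \<rho> powr d\<bar> \<le> \<rho> powr (d - 1) * \<bar>x - \<rho>\<bar>"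
proof -
  have *: "\<bar>t powr d - 1\<bar> \<le> \<bar>t - 1\<bar>" if "0 \<le> t" for t :: real
  proof (cases "1 \<le> t")
    case True
    then have "1 \<le> t powr d" "t powr d \<le> t"
      using powr_mono[of 0 d t] powr_mono[of d 1 t] assms by simp_all
    then show ?thesis using True by simp
  next
    case False
    show ?thesis
    proof (cases "t = 0")
      case False
      then have "t \<le> t powr d" "t powr d \<le> 1"
        using powr_mono'[of d 1 t] powr_mono'[of 0 d t] assms that \<open>\<not> 1 \<le> t\<close> by simp_all
      then show ?thesis using that False \<open>\<not> 1 \<le> t\<close> by simp
    qed simp
  qed
  have "x powr d - \<rho> powr d = \<rho> powr d * ((x / \<rho>) powr d - 1)"
    using assms by (simp add: powr_divide field_simps)
  then have "\<bar>x powr d - \<rho> powr d\<bar> = \<rho> powr d * \<bar>(x / \<rho>) powr d - 1\<bar>" by (simp add: abs_mult)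
  also have "\<dots> \<le> \<rho> powr d * \<bar>x / \<rho> - 1\<bar>" using *[of "x / \<rho>"] assms by (intro mult_left_mono) auto
  also have "\<bar>x / \<rho> - 1\<bar> = \<bar>x - \<rho>\<bar> / \<rho>"
  proof -
    have "x / \<rho> - 1 = (x - \<rho>) / \<rho>" using assms by (simp add: field_simps)
    then show ?thesis using assms by (simp add: abs_divide)
  qed
  also have "\<rho> powr d * (\<bar>x - \<rho>\<bar> / \<rho>) = \<rho> powr (d - 1) * \<bar>x - \<rho>\<bar>"
    using assms by (simp add: powr_diff)
  finally show ?thesis .
qed

text \<open>Bounds a first absolute moment by a variance; the best order results when
  \<open>\<eta>\<close> is the standard deviation.\<close>

lemma abs_le_quadratic:
  fixes y \<eta> :: real
  assumes "0 < \<eta>"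
  shows "\<bar>y\<bar> \<le> \<eta> + y\<^sup>2 / \<eta>"
proof (cases "\<bar>y\<bar> \<le> \<eta>")
  case False
  then have "\<bar>y\<bar> * \<eta> \<le> \<bar>y\<bar> * \<bar>y\<bar>" by (intro mult_left_mono) auto
  then have "\<bar>y\<bar> \<le> y\<^sup>2 / \<eta>" using assms by (simp add: pos_le_divide_eq power2_eq_square)
  then show ?thesis using assms by simp
qed (use assms in \<open>simp add: add_increasing2\<close>)

lemma events_of_compose:
  assumes f: "f \<in> measurable S T" and Z: "\<And>\<omega>. Z \<omega> \<in> space S" and A: "A \<in> sets T"
  shows "(\<lambda>\<omega>. f (Z \<omega>)) -` A \<inter> space P \<in> events_of P Z S"
proof -
  have "(\<lambda>\<omega>. f (Z \<omega>)) -` A \<inter> space P = Z -` (f -` A \<inter> space S) \<inter> space P" using Z by auto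
  then show ?thesis using measurable_sets[OF f A] unfolding events_of_def by blast
qed

text \<open>At least two streams, so that \<open>Y\<close> has a gamma density and the degenerate
  case \<open>Y = 0\<close> is excluded. Since the number of streams grows with \<open>N\<close>,
  all large \<open>N\<close> are covered.\<close>

locale mrc_system = planar_PPP P X \<mu> \<alpha>
  for P :: "'a measure" and X :: "nat \<Rightarrow> 'a \<Rightarrow> real^2" and \<mu> \<alpha> :: real +
  fixes N M :: nat and \<rho> r \<beta> :: real and W Y :: "'a \<Rightarrow> real" and \<Psi> :: "nat \<Rightarrow> 'a \<Rightarrow> real"
  assumes model: "mrc_model N M \<alpha> \<rho> r \<mu> P W Y X \<Psi>"
    and N: "1 \<le> N" and M: "2 \<le> M" and rho: "0 < \<rho>" and r: "0 < r" and beta: "0 < \<beta>" and mu: "0 < \<mu>"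
begin

definition scale :: real where "scale = \<rho> / (real M * r powr \<alpha>)"

lemma scale_pos: "0 < scale"
  using rho r M by (simp add: scale_def)

lemma gammas:
  "gamma_distributed P W (real (Suc (N - 1))) scale"
  "gamma_distributed P Y (real (Suc (M - 2))) scale"
  "gamma_distributed P (\<Psi> l) (real (Suc (M - 1))) (\<rho> / real M)"
proof -
  have "real M - 1 = real (Suc (M - 2))" using M by simp
  then show "gamma_distributed P W (real (Suc (N - 1))) scale"
    "gamma_distributed P Y (real (Suc (M - 2))) scale"
    "gamma_distributed P (\<Psi> l) (real (Suc (M - 1))) (\<rho> / real M)"
    using model N M by (auto simp: mrc_model_def scale_def)
qed

lemma mark_scale_pos: "0 < \<rho> / real M" using rho M by simp

lemmas W_moments = gamma_moments[OF gammas(1) scale_pos]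
lemmas Y_moments = gamma_moments[OF gammas(2) scale_pos]
lemmas \<Psi>_moments = gamma_moments[OF gammas(3) mark_scale_pos]

lemma rvs [measurable]: "W \<in> borel_measurable P" "Y \<in> borel_measurable P" "\<Psi> l \<in> borel_measurable P"
  using W_moments(2) Y_moments(2) \<Psi>_moments(2) by auto

text \<open>A common value space for all sources: scalars sit in the first component, the location
  sequence in the second, and the other component is constant. This lets one family
  \<open>indep_vars\<close> carry the mutual independence.\<close>

definition source_space :: "(real \<times> (nat \<Rightarrow> real^2)) measure" where
  "source_space = borel \<Otimes>\<^sub>M PiM UNIV (\<lambda>_. borel)"

definition source_var :: "source \<Rightarrow> 'a \<Rightarrow> real \<times> (nat \<Rightarrow> real^2)" where
  "source_var s \<omega> = (case s of
      Signal \<Rightarrow> (W \<omega>, \<lambda>_. 0)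
    | Self_Interference \<Rightarrow> (Y \<omega>, \<lambda>_. 0)
    | Interferer_Locations \<Rightarrow> (0, \<lambda>l. X l \<omega>)
    | Interferer_Fading l \<Rightarrow> (\<Psi> l \<omega>, \<lambda>_. 0))"

lemma indep_sources: "indep_sets (sources_events P W Y X \<Psi>) UNIV"
  using model by (simp add: mrc_model_def)

lemma zero_in_space_PiM [simp]: "(\<lambda>_::nat. 0::real^2) \<in> space (PiM UNIV (\<lambda>_. borel))"
  by (simp add: space_PiM)

text \<open>Padding by a constant creates no new events: a preimage under
  \<open>source_var s\<close> is a preimage under the original source.\<close>

lemma indep_source_vars: "indep_vars (\<lambda>_. source_space) source_var UNIV"
  unfolding indep_vars_def2
proof (intro conjI ballI)
  fix s
  show "source_var s \<in> measurable P source_space"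
  proof -
    have [measurable]: "(\<lambda>\<omega> l. X l \<omega>) \<in> measurable P (PiM UNIV (\<lambda>_. borel))"
      by (rule measurable_PiM_single') auto
    show ?thesis
      by (cases s; simp add: source_var_def[abs_def] source_space_def; measurable)
  qed
next
  show "indep_sets (\<lambda>s. {source_var s -` A \<inter> space P |A. A \<in> sets source_space}) UNIV"
  proof (rule indep_sets_mono_sets[OF indep_sources], safe)
    fix s A assume A: "A \<in> sets source_space"
    have f: "(\<lambda>w. (w, \<lambda>_. 0)) \<in> measurable borel source_space" and g: "Pair 0 \<in> measurable (PiM UNIV (\<lambda>_. borel)) source_space"
      unfolding source_space_def by measurable
    note compose = events_of_compose[OF f _ A] events_of_compose[OF g _ A]
    show "source_var s -` A \<inter> space P \<in> sources_events P W Y X \<Psi> s"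
      using compose by (cases s) (simp_all add: sources_events_def source_var_def[abs_def] space_PiM)
  qed
qed

lemma source_proj_measurable:
  assumes "s \<in> I"
  shows "(\<lambda>z. fst (z s)) \<in> borel_measurable (PiM I (\<lambda>_. source_space))"
    and "(\<lambda>z. snd (z s)) \<in> measurable (PiM I (\<lambda>_. source_space)) (PiM UNIV (\<lambda>_. borel))"
proof -
  have [measurable]: "(\<lambda>z. z s) \<in> measurable (PiM I (\<lambda>_. source_space)) (borel \<Otimes>\<^sub>M PiM UNIV (\<lambda>_. borel))"
    using measurable_component_singleton[OF assms, of "\<lambda>_. source_space"] by (simp add: source_space_def)
  show "(\<lambda>z. fst (z s)) \<in> borel_measurable (PiM I (\<lambda>_. source_space))"
    "(\<lambda>z. snd (z s)) \<in> measurable (PiM I (\<lambda>_. source_space)) (PiM UNIV (\<lambda>_. borel))"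
    by measurable
qed

lemma indep_marks_locations: 
  "indep_pair (PiM UNIV (\<lambda>_. borel)) (\<lambda>\<omega> l. X l \<omega>) (PiM UNIV (\<lambda>_. borel)) (\<lambda>\<omega> l. \<Psi> l \<omega>)"
proof -
  let ?B = "range Interferer_Fading"
  have "indep_pair (PiM UNIV (\<lambda>_. borel)) (\<lambda>\<omega>. snd (restrict (\<lambda>s. source_var s \<omega>) {Interferer_Locations} Interferer_Locations))
      (PiM UNIV (\<lambda>_. borel)) (\<lambda>\<omega> l. fst (restrict (\<lambda>s. source_var s \<omega>) ?B (Interferer_Fading l)))"
    by (rule indep_pair_compose[OF indep_var_restrict[OF indep_source_vars]])
       (auto intro!: source_proj_measurable measurable_PiM_single')
  then show ?thesis by (simp add: source_var_def)
qed

text \<open>The interference level that the link tolerates: outage occurs, almost surely, exactly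
  when the interference is at least \<open>margin\<close>. This separates the gamma variables from
  the stable one.\<close>

definition margin :: "'a \<Rightarrow> real" where
  "margin \<omega> = W \<omega> / \<beta> - Y \<omega> - 1"

lemma margin_measurable [measurable]: "margin \<in> borel_measurable P"
  unfolding margin_def[abs_def] by measurable

definition marked_interference :: "'a \<Rightarrow> ennreal" where
  "marked_interference \<omega> = (\<Sum>l. ennreal (path_loss \<alpha> (X l \<omega>) * \<Psi> l \<omega>))"

lemma marked_interference_measurable [measurable]: "marked_interference \<in> borel_measurable P"
  unfolding marked_interference_def[abs_def] by measurable

lemma indep_interference_margin: "indep_pair borel marked_interference borel margin"
proof -
  let ?A = "{Signal, Self_Interference}" and ?B = "insert Interferer_Locations (range Interferer_Fading)"
  let ?f = "\<lambda>z. fst (z Signal) / \<beta> - fst (z Self_Interference) - 1 :: real"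
  let ?g = "\<lambda>z. \<Sum>l. ennreal (path_loss \<alpha> (snd (z Interferer_Locations) l) * fst (z (Interferer_Fading l)))"
  have [measurable]: "(\<lambda>z. snd (z Interferer_Locations) l) \<in> borel_measurable (PiM ?B (\<lambda>_. source_space))" for l
    using source_proj_measurable(2)[of Interferer_Locations ?B]
    by (rule measurable_compose[where N="PiM UNIV (\<lambda>_. borel)"]) (auto intro: measurable_component_singleton)
  have [measurable]: "(\<lambda>z. fst (z (Interferer_Fading l))) \<in> borel_measurable (PiM ?B (\<lambda>_. source_space))" for l
    by (rule source_proj_measurable) simp
  have [measurable]: "(\<lambda>z. fst (z s)) \<in> borel_measurable (PiM ?A (\<lambda>_. source_space))" if "s \<in> ?A" for s
    using that by (rule source_proj_measurable)
  have "indep_pair borel (\<lambda>\<omega>. ?g (restrict (\<lambda>s. source_var s \<omega>) ?B)) borel (\<lambda>\<omega>. ?f (restrict (\<lambda>s. source_var s \<omega>) ?A))"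
    by (rule indep_pair_compose[OF indep_var_restrict[OF indep_source_vars]]) (measurable; auto)+
  then show ?thesis by (simp add: source_var_def margin_def[abs_def] marked_interference_def[abs_def])
qed

lemma indep_Y_W: "indep_pair borel Y borel W"
proof -
  have "indep_pair borel (\<lambda>\<omega>. fst (restrict (\<lambda>s. source_var s \<omega>) {Self_Interference} Self_Interference))
      borel (\<lambda>\<omega>. fst (restrict (\<lambda>s. source_var s \<omega>) {Signal} Signal))"
    by (rule indep_pair_compose[OF indep_var_restrict[OF indep_source_vars]])
       (auto intro!: source_proj_measurable)
  then show ?thesis by (simp add: source_var_def)
qed

lemma indep_marks: "indep_vars (\<lambda>_. borel) \<Psi> UNIV"
proof -
  have "indep_sets (\<lambda>l. sources_events P W Y X \<Psi> (Interferer_Fading l)) UNIV"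
    by (rule indep_sets_reindex[OF indep_sources]) (simp add: inj_def)
  then show ?thesis by (simp add: indep_vars_def2 sources_events_def events_of_def)
qed

lemma distr_marks: "distr P borel (\<Psi> l) = distr P borel (\<Psi> 0)"
proof -
  have "distr P borel (\<Psi> l) = distr P lborel (\<Psi> l)" for l by (intro distr_cong) auto
  then show ?thesis
    using gammas(3)[of l] gammas(3)[of 0] by (simp add: gamma_distributed_def distributed_def)
qed

definition mark_moment :: real where
  "mark_moment = expectation (\<lambda>\<omega>. \<Psi> 0 \<omega> powr (2 / \<alpha>))"

lemma integrable_mark_powr: "integrable P (\<lambda>\<omega>. \<Psi> 0 \<omega> powr (2 / \<alpha>))"
proof (rule Bochner_Integration.integrable_bound)
  show "integrable P (\<lambda>\<omega>. 1 + \<Psi> 0 \<omega>)" using \<Psi>_moments(2) by auto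
  show "AE \<omega> in P. norm (\<Psi> 0 \<omega> powr (2 / \<alpha>)) \<le> norm (1 + \<Psi> 0 \<omega>)"
    using \<Psi>_moments(1)[of 0]
  proof eventually_elim
    case (elim \<omega>)
    have "\<Psi> 0 \<omega> powr (2 / \<alpha>) \<le> (1 + \<Psi> 0 \<omega>) powr (2 / \<alpha>)" using elim alpha by (intro powr_mono2) auto
    also have "\<dots> \<le> (1 + \<Psi> 0 \<omega>) powr 1" using elim alpha by (intro powr_mono) auto
    finally show ?case using elim by simp
  qed
qed simp

text \<open>A mark has mean \<open>\<rho>\<close> and standard deviation
  \<open>\<rho> / sqrt M\<close>. Linearising the power at \<open>\<rho>\<close> reduces the claim
  to the first absolute deviation, which is at most twice the standard deviation.\<close>

lemma mark_moment_bound: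
  "\<bar>mark_moment - \<rho> powr (2 / \<alpha>)\<bar> \<le> \<rho> powr (2 / \<alpha> - 1) * (2 * (\<rho> / sqrt (real M)))"
proof -
  let ?d = "2 / \<alpha>"
  have d: "0 < ?d" "?d < 1" using alpha by auto
  let ?\<eta> = "\<rho> / sqrt (real M)"
  have eta: "0 < ?\<eta>" using rho M by simp
  have E: "expectation (\<Psi> 0) = \<rho>" using \<Psi>_moments(4)[of 0] M by simp
  have V: "expectation (\<lambda>\<omega>. (\<Psi> 0 \<omega> - \<rho>)\<^sup>2) = ?\<eta>\<^sup>2"
    using \<Psi>_moments(5)[of 0] M E by (simp add: power_divide power2_eq_square)
  have i1: "integrable P (\<lambda>\<omega>. \<bar>\<Psi> 0 \<omega> - \<rho>\<bar>)" using \<Psi>_moments(2)[of 0] by auto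
  have i2: "integrable P (\<lambda>\<omega>. (\<Psi> 0 \<omega> - \<rho>)\<^sup>2)"
    using \<Psi>_moments(2,3)[of 0] by (simp add: power2_diff)
  have "mark_moment - \<rho> powr ?d = expectation (\<lambda>\<omega>. \<Psi> 0 \<omega> powr ?d - \<rho> powr ?d)"
    using integrable_mark_powr by (simp add: mark_moment_def prob_space)
  then have "\<bar>mark_moment - \<rho> powr ?d\<bar> \<le> expectation (\<lambda>\<omega>. \<bar>\<Psi> 0 \<omega> powr ?d - \<rho> powr ?d\<bar>)"
    by (simp add: integral_abs_bound)
  also have "\<dots> \<le> expectation (\<lambda>\<omega>. \<rho> powr (?d - 1) * \<bar>\<Psi> 0 \<omega> - \<rho>\<bar>)"
  proof (rule integral_mono_AE)
    show "AE \<omega> in P. \<bar>\<Psi> 0 \<omega> powr ?d - \<rho> powr ?d\<bar> \<le> \<rho> powr (?d - 1) * \<bar>\<Psi> 0 \<omega> - \<rho>\<bar>"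
      using \<Psi>_moments(1)[of 0] by eventually_elim (intro powr_diff_le rho d)
  qed (use i1 integrable_mark_powr in auto)
  also have "\<dots> = \<rho> powr (?d - 1) * expectation (\<lambda>\<omega>. \<bar>\<Psi> 0 \<omega> - \<rho>\<bar>)" by simp
  also have "\<dots> \<le> \<rho> powr (?d - 1) * (2 * ?\<eta>)"
  proof (rule mult_left_mono)
    have "expectation (\<lambda>\<omega>. \<bar>\<Psi> 0 \<omega> - \<rho>\<bar>) \<le> expectation (\<lambda>\<omega>. ?\<eta> + (\<Psi> 0 \<omega> - \<rho>)\<^sup>2 / ?\<eta>)"
      using i1 i2 by (intro integral_mono abs_le_quadratic eta) auto
    also have "\<dots> = ?\<eta> + expectation (\<lambda>\<omega>. (\<Psi> 0 \<omega> - \<rho>)\<^sup>2) / ?\<eta>"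
      using i2 by (simp add: prob_space del: times_divide_eq_right)
    also have "\<dots> = 2 * ?\<eta>"
    proof -
      have "h + h\<^sup>2 / h = 2 * h" if "0 < h" for h :: real using that by (simp add: power2_eq_square)
      then show ?thesis unfolding V using eta by blast
    qed
    finally show "expectation (\<lambda>\<omega>. \<bar>\<Psi> 0 \<omega> - \<rho>\<bar>) \<le> 2 * ?\<eta>" .
  qed simp
  finally show ?thesis .
qed

text \<open>The real series in \<open>sinr\<close> is meaningful only when it converges, so the
  extended sum is the object studied. Its Laplace transform shows that it is finite almost surely,
  and with nonnegative marks the two then agree.\<close>

lemma AE_marked_interference:
  "AE \<omega> in P. marked_interference \<omega> < \<infinity> \<and> (\<Sum>l. norm (X l \<omega>) powr (- \<alpha>) * \<Psi> l \<omega>) = enn2real (marked_interference \<omega>)"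
proof -
  have "AE \<omega> in P. marked_interference \<omega> < \<infinity>"
    using laplace_marked_interference[OF indep_marks_locations indep_marks distr_marks \<Psi>_moments(1) integrable_mark_powr] alpha
    by (intro AE_finite_of_laplace[where d="2 / \<alpha>" and c="\<mu> * mark_moment * laplace_const \<alpha>"])
       (auto simp: mark_moment_def marked_interference_def)
  moreover have "AE \<omega> in P. \<forall>l. 0 \<le> \<Psi> l \<omega>"
    using \<Psi>_moments(1) by (simp add: AE_all_countable)
  ultimately show ?thesis
  proof eventually_elim
    case (elim \<omega>)
    let ?f = "\<lambda>l. path_loss \<alpha> (X l \<omega>) * \<Psi> l \<omega>"
    have nn: "0 \<le> ?f l" for l using elim by simp
    have "(\<Sum>l. ennreal (?f l)) \<noteq> \<top>"
      using elim(1) unfolding marked_interference_def by (simp only: infinity_ennreal_def less_top)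
    from summable_suminf_not_top[OF nn this] have sf: "summable ?f" .
    have "marked_interference \<omega> = ennreal (suminf ?f)"
      unfolding marked_interference_def by (rule suminf_ennreal2[OF nn sf])
    moreover have "0 \<le> suminf ?f" by (rule suminf_nonneg[OF sf nn])
    ultimately show ?case using elim(1) by (simp add: path_loss_def)
  qed
qed

abbreviation margin_cdf :: "real \<Rightarrow> real" where
  "margin_cdf \<equiv> cdf (distr P borel margin)"

lemma margin_cdf_eq: "margin_cdf x = prob {\<omega> \<in> space P. margin \<omega> \<le> x}"
  by (simp add: cdf_def2 measure_distr) (intro arg_cong[where f=prob], auto)

lemma margin_real_distribution: "real_distribution (distr P borel margin)"
  by simp

lemma min_outage_prob_eq: "min_outage_prob \<beta> P W Y = margin_cdf 0"
  unfolding min_outage_prob_def margin_cdf_eq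
proof (rule prob_eq_AE)
  show "AE \<omega> in P. W \<omega> / (Y \<omega> + 1) \<le> \<beta> \<longleftrightarrow> margin \<omega> \<le> 0"
    using Y_moments(1)
  proof eventually_elim
    case (elim \<omega>)
    then show ?case using beta by (auto simp: margin_def field_simps)
  qed
qed measurable

text \<open>Given \<open>Y\<close>, the margin equals \<open>a\<close> only if \<open>W\<close> hits
  one point, which has probability 0 because \<open>W\<close> has a density. Hence there are no
  atoms.\<close>

lemma margin_cdf_continuous: "continuous_on UNIV margin_cdf"
proof -
  interpret V: real_distribution "distr P borel margin" by (rule margin_real_distribution)
  have "measure (distr P borel margin) {a} = 0" for a
  proof -
    have "emeasure P {\<omega> \<in> space P. margin \<omega> = a} = (\<integral>\<^sup>+\<omega>. indicator {(y, w). w / \<beta> - y - 1 = a} (Y \<omega>, W \<omega>) \<partial>P)"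
      by (intro emeasure_Collect_eq_nn_integral) (auto simp: margin_def split: split_indicator)
    also have "\<dots> = (\<integral>\<^sup>+\<omega>. \<integral>\<^sup>+\<omega>'. indicator {(y, w). w / \<beta> - y - 1 = a} (Y \<omega>, W \<omega>') \<partial>P \<partial>P)"
      by (rule indep_pair_nn_integral[OF indep_Y_W]) measurable
    also have "\<dots> = (\<integral>\<^sup>+\<omega>. 0 \<partial>P)"
    proof (rule nn_integral_cong)
      fix \<omega>
      have "(\<integral>\<^sup>+\<omega>'. indicator {(y, w). w / \<beta> - y - 1 = a} (Y \<omega>, W \<omega>') \<partial>P)
        = (\<integral>\<^sup>+\<omega>'. indicator {\<omega>' \<in> space P. W \<omega>' = \<beta> * (a + 1 + Y \<omega>)} \<omega>' \<partial>P)"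
        using beta by (intro nn_integral_cong) (auto simp: field_simps split: split_indicator)
      also have "\<dots> = emeasure P {\<omega>' \<in> space P. W \<omega>' = \<beta> * (a + 1 + Y \<omega>)}"
        by (rule nn_integral_indicator) measurable
      also have "\<dots> = 0"
        by (rule prob_distributed_eq[OF gamma_distributed_erlang[OF gammas(1) scale_pos]])
      finally show "(\<integral>\<^sup>+\<omega>'. indicator {(y, w). w / \<beta> - y - 1 = a} (Y \<omega>, W \<omega>') \<partial>P) = 0" .
    qed
    finally have "emeasure P {\<omega> \<in> space P. margin \<omega> = a} = 0" by simp
    moreover have "margin -` {a} \<inter> space P = {\<omega> \<in> space P. margin \<omega> = a}" by auto
    ultimately show ?thesis by (simp add: emeasure_distr measure_def)
  qed
  then show ?thesis by (simp add: continuous_on_eq_continuous_at V.isCont_cdf)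
qed

text \<open>By independence the outage probability is the average of the margin's distribution
  function over the law of the interference, and that law is the stable one scaled by the intensity
  times the mark moment.\<close>

lemma outage_eq:
  assumes D: "stable_law \<alpha> D" and m: "0 < mark_moment"
  shows "prob {\<omega> \<in> space P. sinr \<alpha> W Y X \<Psi> \<omega> \<le> \<beta>}
    = (\<integral>x. margin_cdf ((\<mu> * mark_moment) powr (\<alpha> / 2) * x) \<partial>D)"
proof -
  interpret D: prob_space D by (rule stable_lawD(1)[OF D])
  interpret V: real_distribution "distr P borel margin" by (rule margin_real_distribution)
  note [measurable_cong] = stable_lawD(2)[OF D]
  let ?c = "(\<mu> * mark_moment) powr (\<alpha> / 2)"
  have [measurable]: "margin_cdf \<in> borel_measurable borel"
    by (rule borel_measurable_continuous_onI[OF margin_cdf_continuous])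
  have "prob {\<omega> \<in> space P. sinr \<alpha> W Y X \<Psi> \<omega> \<le> \<beta>} = prob {\<omega> \<in> space P. margin \<omega> \<le> enn2real (marked_interference \<omega>)}"
  proof (rule prob_eq_AE)
    show "AE \<omega> in P. sinr \<alpha> W Y X \<Psi> \<omega> \<le> \<beta> \<longleftrightarrow> margin \<omega> \<le> enn2real (marked_interference \<omega>)"
      using AE_marked_interference Y_moments(1)
    proof eventually_elim
      case (elim \<omega>)
      then have "0 < Y \<omega> + enn2real (marked_interference \<omega>) + 1" by (intro add_nonneg_pos add_nonneg_nonneg) auto
      then show ?case using beta elim by (auto simp: margin_def sinr_def field_simps)
    qed
    show "{\<omega> \<in> space P. sinr \<alpha> W Y X \<Psi> \<omega> \<le> \<beta>} \<in> events" unfolding sinr_def by measurable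
  qed measurable
  also have "ennreal \<dots> = (\<integral>\<^sup>+\<omega>. indicator {(z, v). v \<le> enn2real z} (marked_interference \<omega>, margin \<omega>) \<partial>P)"
    unfolding emeasure_eq_measure[symmetric]
    by (intro emeasure_Collect_eq_nn_integral) (auto split: split_indicator)
  also have "\<dots> = (\<integral>\<^sup>+\<omega>. \<integral>\<^sup>+\<omega>'. indicator {(z, v). v \<le> enn2real z} (marked_interference \<omega>, margin \<omega>') \<partial>P \<partial>P)"
    by (rule indep_pair_nn_integral[OF indep_interference_margin]) measurable
  also have "\<dots> = (\<integral>\<^sup>+\<omega>. ennreal (margin_cdf (enn2real (marked_interference \<omega>))) \<partial>P)"
  proof (rule nn_integral_cong)
    fix \<omega>
    have "emeasure P {\<omega>' \<in> space P. margin \<omega>' \<le> enn2real (marked_interference \<omega>)}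
      = (\<integral>\<^sup>+\<omega>'. indicator {(z, v). v \<le> enn2real z} (marked_interference \<omega>, margin \<omega>') \<partial>P)"
      by (rule emeasure_Collect_eq_nn_integral) (measurable, auto split: split_indicator)
    then show "(\<integral>\<^sup>+\<omega>'. indicator {(z, v). v \<le> enn2real z} (marked_interference \<omega>, margin \<omega>') \<partial>P) = ennreal (margin_cdf (enn2real (marked_interference \<omega>)))"
      by (simp add: margin_cdf_eq emeasure_eq_measure)
  qed
  also have "\<dots> = (\<integral>\<^sup>+z. ennreal (margin_cdf z) \<partial>distr P borel (\<lambda>\<omega>. enn2real (marked_interference \<omega>)))"
    by (subst nn_integral_distr) auto
  also have "distr P borel (\<lambda>\<omega>. enn2real (marked_interference \<omega>)) = distr D borel (\<lambda>x. ?c * x)"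
    using laplace_marked_interference[OF indep_marks_locations indep_marks distr_marks \<Psi>_moments(1) integrable_mark_powr] mu m
    by (intro distr_eq_scaled_stable[OF D alpha]) (auto simp: mark_moment_def marked_interference_def)
  also have "(\<integral>\<^sup>+z. ennreal (margin_cdf z) \<partial>distr D borel (\<lambda>x. ?c * x)) = (\<integral>\<^sup>+x. ennreal (margin_cdf (?c * x)) \<partial>D)"
    by (subst nn_integral_distr) auto
  also have "\<dots> = ennreal (\<integral>x. margin_cdf (?c * x) \<partial>D)"
    by (intro nn_integral_eq_integral D.integrable_const_bound[where B=1])
       (auto simp: V.cdf_nonneg V.cdf_bounded_prob)
  finally show ?thesis
    by (simp add: V.cdf_nonneg integral_nonneg_AE)
qed

definition margin_mean :: real where
  "margin_mean = real N * scale / \<beta> - (real M - 1) * scale - 1"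

text \<open>Twice the sum of the variances of \<open>W / \<beta>\<close> and \<open>Y\<close>. It
  bounds the mean square deviation through \<open>(a - b)^2 <= 2 * a^2 + 2 * b^2\<close>, which
  avoids any covariance.\<close>

definition margin_var :: real where
  "margin_var = 2 * (real N * scale\<^sup>2 / \<beta>\<^sup>2) + 2 * ((real M - 1) * scale\<^sup>2)"

lemma margin_concentration:
  assumes \<eta>: "0 < \<eta>"
  shows "prob {\<omega> \<in> space P. \<eta> \<le> \<bar>margin \<omega> - margin_mean\<bar>} \<le> margin_var / \<eta>\<^sup>2"
proof -
  have EW: "expectation W = real N * scale" "expectation (\<lambda>\<omega>. (W \<omega> - real N * scale)\<^sup>2) = real N * scale\<^sup>2"
    using W_moments(4,5) N by simp_all
  have "real (Suc (M - 2)) = real M - 1" using M by simp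
  then have EY: "expectation Y = (real M - 1) * scale" "expectation (\<lambda>\<omega>. (Y \<omega> - (real M - 1) * scale)\<^sup>2) = (real M - 1) * scale\<^sup>2"
    using Y_moments(4,5) by simp_all
  have i: "integrable P (\<lambda>\<omega>. (W \<omega> - real N * scale)\<^sup>2)" "integrable P (\<lambda>\<omega>. (Y \<omega> - (real M - 1) * scale)\<^sup>2)"
    using W_moments(2,3) Y_moments(2,3) by (simp_all add: power2_diff)
  let ?B = "\<lambda>\<omega>. 2 * ((W \<omega> - real N * scale)\<^sup>2 / \<beta>\<^sup>2) + 2 * (Y \<omega> - (real M - 1) * scale)\<^sup>2"
  have iB: "integrable P ?B" using i by simp
  have "{\<omega> \<in> space P. \<eta> \<le> \<bar>margin \<omega> - margin_mean\<bar>} \<subseteq> {\<omega> \<in> space P. \<eta>\<^sup>2 \<le> ?B \<omega>}"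
  proof safe
    fix \<omega> assume "\<eta> \<le> \<bar>margin \<omega> - margin_mean\<bar>"
    then have "\<eta>\<^sup>2 \<le> \<bar>margin \<omega> - margin_mean\<bar>\<^sup>2" using \<eta> by (intro power_mono) auto
    also have "margin \<omega> - margin_mean = (W \<omega> - real N * scale) / \<beta> - (Y \<omega> - (real M - 1) * scale)"
      by (simp add: margin_def margin_mean_def diff_divide_distrib)
    also have "\<bar>(W \<omega> - real N * scale) / \<beta> - (Y \<omega> - (real M - 1) * scale)\<bar>\<^sup>2 = ((W \<omega> - real N * scale) / \<beta> - (Y \<omega> - (real M - 1) * scale))\<^sup>2"
      by (rule power2_abs)
    also have "\<dots> \<le> 2 * ((W \<omega> - real N * scale) / \<beta>)\<^sup>2 + 2 * (Y \<omega> - (real M - 1) * scale)\<^sup>2"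
    proof -
      have "(a - b)\<^sup>2 \<le> 2 * a\<^sup>2 + 2 * b\<^sup>2" for a b :: real
        using sum_squares_bound[of a "- b"] by (simp add: power2_diff)
      then show ?thesis .
    qed
    finally show "\<eta>\<^sup>2 \<le> ?B \<omega>" by (simp add: power_divide)
  qed
  then have "prob {\<omega> \<in> space P. \<eta> \<le> \<bar>margin \<omega> - margin_mean\<bar>} \<le> prob {\<omega> \<in> space P. \<eta>\<^sup>2 \<le> ?B \<omega>}"
    by (rule finite_measure_mono) measurable
  also have "\<dots> \<le> expectation ?B / \<eta>\<^sup>2"
    using iB \<eta> by (intro integral_Markov_inequality_measure[where A="{}"]) auto
  also have "expectation ?B = margin_var"
    using i by (simp add: EW EY margin_var_def)
  finally show ?thesis .
qed

lemma margin_cdf_above: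
  assumes "margin_mean < x"
  shows "1 - margin_var / (x - margin_mean)\<^sup>2 \<le> margin_cdf x"
proof -
  let ?\<eta> = "x - margin_mean"
  have "1 - margin_cdf x = prob (space P - {\<omega> \<in> space P. margin \<omega> \<le> x})"
    unfolding margin_cdf_eq by (rule prob_compl[symmetric]) measurable
  also have "\<dots> \<le> prob {\<omega> \<in> space P. ?\<eta> \<le> \<bar>margin \<omega> - margin_mean\<bar>}"
    by (rule finite_measure_mono) auto
  also have "\<dots> \<le> margin_var / ?\<eta>\<^sup>2" using assms by (intro margin_concentration) simp
  finally show ?thesis by simp
qed

lemma margin_cdf_below:
  assumes "x < margin_mean"
  shows "margin_cdf x \<le> margin_var / (margin_mean - x)\<^sup>2"
proof -
  let ?\<eta> = "margin_mean - x"
  have "margin_cdf x \<le> prob {\<omega> \<in> space P. ?\<eta> \<le> \<bar>margin \<omega> - margin_mean\<bar>}"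
    unfolding margin_cdf_eq by (rule finite_measure_mono) auto
  also have "\<dots> \<le> margin_var / ?\<eta>\<^sup>2" using assms by (intro margin_concentration) simp
  finally show ?thesis .
qed

end

section \<open>The limit of many antennas\<close>

lemma tendsto_of_abs_diff_less_1:
  fixes M :: "nat \<Rightarrow> nat"
  assumes M: "\<And>N. \<bar>real (M N) - \<kappa> * real N\<bar> < 1" and k: "0 < \<kappa>"
  shows "(\<lambda>N. real (M N) / real N) \<longlonglongrightarrow> \<kappa>"
    and "filterlim (\<lambda>N. real (M N)) at_top sequentially"
proof -
  show "(\<lambda>N. real (M N) / real N) \<longlonglongrightarrow> \<kappa>"
  proof (rule LIM_zero_cancel, rule Lim_null_comparison)
    show "eventually (\<lambda>N. norm (real (M N) / real N - \<kappa>) \<le> 1 / real N) sequentially"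
      using eventually_gt_at_top[of 0]
    proof eventually_elim
      case (elim N)
      have "real (M N) / real N - \<kappa> = (real (M N) - \<kappa> * real N) / real N" using elim by (simp add: field_simps)
      then have "norm (real (M N) / real N - \<kappa>) = \<bar>real (M N) - \<kappa> * real N\<bar> / real N" by simp
      also have "\<dots> \<le> 1 / real N" using M[of N] by (intro divide_right_mono) auto
      finally show ?case .
    qed
  qed real_asymp
  show "filterlim (\<lambda>N. real (M N)) at_top sequentially"
  proof (rule filterlim_at_top_mono)
    show "filterlim (\<lambda>N. \<kappa> * real N - 1) at_top sequentially" using k by real_asymp
    show "eventually (\<lambda>N. \<kappa> * real N - 1 \<le> real (M N)) sequentially"
    proof (rule always_eventually, rule allI)
      fix N show "\<kappa> * real N - 1 \<le> real (M N)" using M[of N] by linarith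
    qed
  qed
qed

text \<open>\<open>M N\<close> is a rounding of \<open>\<kappa> * N\<close>, which need not be an
  integer. The limit \<open>c \<epsilon>\<close> factors into a constant depending on
  \<open>\<beta>\<close> and the product of the quantile intensity with
  \<open>1 - \<epsilon>\<close>, so the order term reduces to the behaviour of that product near
  0.\<close>

theorem corollary6:
  fixes P :: "'a measure"
    and W Y :: "nat \<Rightarrow> 'a \<Rightarrow> real"
    and X :: "real \<Rightarrow> nat \<Rightarrow> 'a \<Rightarrow> real^2"
    and \<Psi> :: "nat \<Rightarrow> nat \<Rightarrow> 'a \<Rightarrow> real"
    and M :: "nat \<Rightarrow> nat"
    and H :: "real \<Rightarrow> real"
    and \<alpha> \<rho> r \<beta> \<kappa> :: real
  assumes "\<alpha> > 2" and "\<rho> > 0" and "r > 0" and "\<beta> > 0"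
    and "0 < \<kappa>" and "\<kappa> \<le> 1"
    and M: "\<And>N. \<bar>real (M N) - \<kappa> * real N\<bar> < 1"
    and model: "\<And>N \<mu>. 1 \<le> M N \<Longrightarrow> 0 < \<mu> \<Longrightarrow>
           mrc_model N (M N) \<alpha> \<rho> r \<mu> P (W N) (Y N) (X \<mu>) (\<Psi> N)"
    and H_neg: "\<And>x. x < 0 \<Longrightarrow> H x = 0" and H_pos: "\<And>x. x > 0 \<Longrightarrow> H x = 1"
  shows "\<exists>c :: real \<Rightarrow> real.
     (\<forall>\<epsilon>\<in>{0<..<1}.
        (\<lambda>N. capacity_MRC (M N) \<alpha> \<beta> P (W N) (Y N) X (\<Psi> N) \<epsilon> / real N) \<longlonglongrightarrow> c \<epsilon>) \<and>
     (\<lambda>\<epsilon>. c \<epsilon> -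
        \<kappa> * (r powr \<alpha> / \<rho> + 1) powr (2 / \<alpha>) * (max (beta_bar_MRC \<alpha> \<rho> r \<kappa> - \<beta>) 0) powr (2 / \<alpha>) *
        (max (\<epsilon> - H (\<beta> - beta_bar_MRC \<alpha> \<rho> r \<kappa>)) 0 / (pi * r\<^sup>2 * \<beta> powr (2 / \<alpha>))))
     \<in> O[at (H (\<beta> - beta_bar_MRC \<alpha> \<rho> r \<kappa>)) within {0<..<1}](
         \<lambda>\<epsilon>. max ((\<epsilon> - H (\<beta> - beta_bar_MRC \<alpha> \<rho> r \<kappa>))\<^sup>2) 0)"
proof -
  note M_ratio = tendsto_of_abs_diff_less_1(1)[of M, OF M \<open>0 < \<kappa>\<close>]
  note M_top = tendsto_of_abs_diff_less_1(2)[of M, OF M \<open>0 < \<kappa>\<close>]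
  let ?d = "2 / \<alpha>"
  let ?b = "beta_bar_MRC \<alpha> \<rho> r \<kappa>"
  have M2: "eventually (\<lambda>N. 2 \<le> M N) sequentially"
    using filterlim_at_top[THEN iffD1, OF M_top, rule_format, of 2] by eventually_elim linarith
  have N1: "eventually (\<lambda>N. 1 \<le> (N::nat)) sequentially" by (rule eventually_ge_at_top)
  \<comment> \<open>The processes \<open>X \<mu>\<close> do not depend on \<open>N\<close>, so a
    single \<open>N0\<close> yields their Poisson property for every positive intensity.\<close>
  obtain N0 where N0: "2 \<le> M N0" using M2 by (auto simp: eventually_sequentially)
  have PPP_X: "planar_PPP P (X \<mu>) \<mu> \<alpha>" if "0 < \<mu>" for \<mu>
    using model[of N0 \<mu>] N0 that \<open>\<alpha> > 2\<close>
    by (auto simp: mrc_model_def planar_PPP_def planar_PPP_axioms_def PPP_def PPP_axioms_def)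
  define D where "D = distr P borel (\<lambda>\<omega>. enn2real (planar_PPP.interference (X 1) \<alpha> \<omega>))"
  have D: "stable_law \<alpha> D"
    unfolding D_def by (rule planar_PPP.stable_law_interference[OF PPP_X]) simp_all
  define K where "K = enn2real (pair_bound \<alpha>)"
  interpret ST: stable_tail D \<alpha> K
  proof
    fix \<mu> :: real assume "0 < \<mu>"
    then show "1 - exp (- (pi * \<mu>)) \<le> measure D {\<mu> powr (- (\<alpha> / 2)) <..}"
      "measure D {\<mu> powr (- (\<alpha> / 2)) <..} \<le> 1 - exp (- (pi * \<mu>)) + K * \<mu>\<^sup>2"
      using planar_PPP.stable_tail_bounds[OF PPP_X D] by (auto simp: K_def)
  qed (use D \<open>\<alpha> > 2\<close> in \<open>auto simp: K_def\<close>)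
  have sys: "mrc_system P (X \<mu>) \<mu> \<alpha> N (M N) \<rho> r \<beta> (W N) (Y N) (\<Psi> N)" if "2 \<le> M N" "1 \<le> N" "0 < \<mu>" for N \<mu>
    using PPP_X[OF that(3)] model[of N \<mu>] that assms by (simp add: mrc_system_def mrc_system_axioms_def)
  have ev: "eventually (\<lambda>N. mrc_system P (X 1) 1 \<alpha> N (M N) \<rho> r \<beta> (W N) (Y N) (\<Psi> N)) sequentially"
    using M2 N1 by eventually_elim (rule sys, auto)
  \<comment> \<open>The default 0 makes \<open>dist_fun\<close> hold for every \<open>N\<close>; the
    other properties are needed only eventually.\<close>
  define A where "A N = (if mrc_system P (X 1) 1 \<alpha> N (M N) \<rho> r \<beta> (W N) (Y N) (\<Psi> N)
    then cdf (distr P borel (mrc_system.margin \<beta> (W N) (Y N))) else (\<lambda>_. 0))" for N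
  define m where "m N = mrc_system.mark_moment P \<alpha> (\<Psi> N)" for N
  define e where "e N = mrc_system.margin_mean \<alpha> N (M N) \<rho> r \<beta>" for N
  define w where "w N = mrc_system.margin_var \<alpha> N (M N) \<rho> r \<beta>" for N
  \<comment> \<open>The limit of the mean of the margin: \<open>N * scale\<close> tends to
    \<open>\<rho> / (\<kappa> * r powr \<alpha>)\<close> and \<open>(M - 1) * scale\<close> to
    \<open>\<rho> / r powr \<alpha>\<close>.\<close>
  define v where "v = \<rho> / (\<kappa> * r powr \<alpha>) / \<beta> - \<rho> / r powr \<alpha> - 1"
  have ra: "0 < r powr \<alpha>" using \<open>r > 0\<close> by simp

  have inv_M: "(\<lambda>N. 1 / real (M N)) \<longlonglongrightarrow> 0"
    using tendsto_inverse_0_at_top[OF M_top] by (simp add: inverse_eq_divide)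
  have ratio: "(\<lambda>N. real N / real (M N)) \<longlonglongrightarrow> 1 / \<kappa>"
    using tendsto_inverse[OF M_ratio] \<open>0 < \<kappa>\<close> by (simp add: inverse_eq_divide)
  have M_over_M: "(\<lambda>N. (real (M N) - 1) / real (M N)) \<longlonglongrightarrow> 1"
  proof -
    have "(\<lambda>N. 1 - 1 / real (M N)) \<longlonglongrightarrow> 1 - 0" by (intro tendsto_intros inv_M)
    then have "(\<lambda>N. 1 - 1 / real (M N)) \<longlonglongrightarrow> 1" by simp
    then show ?thesis
      by (rule Lim_transform_eventually) (use M2 in eventually_elim, simp add: field_simps)
  qed
  have e_lim: "e \<longlonglongrightarrow> v"
  proof -
    have "(\<lambda>N. real N / real (M N) * (\<rho> / r powr \<alpha>) / \<beta> - (real (M N) - 1) / real (M N) * (\<rho> / r powr \<alpha>) - 1)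
      \<longlonglongrightarrow> 1 / \<kappa> * (\<rho> / r powr \<alpha>) / \<beta> - 1 * (\<rho> / r powr \<alpha>) - 1"
      by (intro tendsto_intros ratio M_over_M) (use \<open>\<beta> > 0\<close> in auto)
    also have "1 / \<kappa> * (\<rho> / r powr \<alpha>) / \<beta> - 1 * (\<rho> / r powr \<alpha>) - 1 = v" by (simp add: v_def)
    finally show ?thesis
    proof (rule Lim_transform_eventually)
      show "eventually (\<lambda>N. real N / real (M N) * (\<rho> / r powr \<alpha>) / \<beta> - (real (M N) - 1) / real (M N) * (\<rho> / r powr \<alpha>) - 1 = e N) sequentially"
        using ev
      proof eventually_elim
        case (elim N)
        then show ?case by (simp add: e_def mrc_system.margin_mean_def mrc_system.scale_def)
      qed
    qed
  qed
  \<comment> \<open>\<open>N\<close> times the square of the scale is of order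
    \<open>1 / M N\<close>, so the margin concentrates.\<close>
  have w_lim: "w \<longlonglongrightarrow> 0"
  proof -
    let ?q = "\<rho> / r powr \<alpha>"
    have "(\<lambda>N. 2 * (real N / real (M N) * (1 / real (M N)) * ?q\<^sup>2 / \<beta>\<^sup>2) + 2 * ((real (M N) - 1) / real (M N) * (1 / real (M N)) * ?q\<^sup>2))
      \<longlonglongrightarrow> 2 * (1 / \<kappa> * 0 * ?q\<^sup>2 / \<beta>\<^sup>2) + 2 * (1 * 0 * ?q\<^sup>2)"
      by (intro tendsto_intros ratio M_over_M inv_M) (use \<open>\<beta> > 0\<close> in auto)
    then have "(\<lambda>N. 2 * (real N / real (M N) * (1 / real (M N)) * ?q\<^sup>2 / \<beta>\<^sup>2) + 2 * ((real (M N) - 1) / real (M N) * (1 / real (M N)) * ?q\<^sup>2)) \<longlonglongrightarrow> 0"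
      by simp
    then show ?thesis
    proof (rule Lim_transform_eventually)
      show "eventually (\<lambda>N. 2 * (real N / real (M N) * (1 / real (M N)) * ?q\<^sup>2 / \<beta>\<^sup>2) + 2 * ((real (M N) - 1) / real (M N) * (1 / real (M N)) * ?q\<^sup>2) = w N) sequentially"
        using ev
      proof eventually_elim
        case (elim N)
        have "(mrc_system.scale \<alpha> (M N) \<rho> r)\<^sup>2 = 1 / real (M N) * (1 / real (M N)) * ?q\<^sup>2"
          by (simp add: mrc_system.scale_def[OF elim] power_divide power_mult_distrib power2_eq_square)
        then show ?case by (simp add: w_def mrc_system.margin_var_def[OF elim])
      qed
    qed
  qed
  have m_lim: "m \<longlonglongrightarrow> \<rho> powr ?d"
  proof (rule LIM_zero_cancel, rule Lim_null_comparison)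
    have "filterlim (\<lambda>N. sqrt (real (M N))) at_top sequentially"
      by (rule filterlim_compose[OF sqrt_at_top M_top])
    then have "(\<lambda>N. inverse (sqrt (real (M N)))) \<longlonglongrightarrow> 0" by (rule tendsto_inverse_0_at_top)
    then have "(\<lambda>N. \<rho> powr (?d - 1) * (2 * (\<rho> * inverse (sqrt (real (M N)))))) \<longlonglongrightarrow> \<rho> powr (?d - 1) * (2 * (\<rho> * 0))"
      by (intro tendsto_intros)
    then show "(\<lambda>N. \<rho> powr (?d - 1) * (2 * (\<rho> / sqrt (real (M N))))) \<longlonglongrightarrow> 0"
      by (simp add: divide_inverse)
    show "eventually (\<lambda>N. norm (m N - \<rho> powr ?d) \<le> \<rho> powr (?d - 1) * (2 * (\<rho> / sqrt (real (M N))))) sequentially"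
      using ev
    proof eventually_elim
      case (elim N)
      then show ?case using mrc_system.mark_moment_bound by (fastforce simp: m_def)
    qed
  qed
  have V: "real_distribution (distr P borel (mrc_system.margin \<beta> (W N) (Y N)))"
    if "mrc_system P (X 1) 1 \<alpha> N (M N) \<rho> r \<beta> (W N) (Y N) (\<Psi> N)" for N
    using that by (rule mrc_system.margin_real_distribution)
  have dA: "ST.dist_fun (A N)" for N
    using V[of N] by (auto simp: A_def ST.dist_fun_def mono_def real_distribution.cdf_bounded_prob
      intro: finite_borel_measure.cdf_nondecreasing finite_borel_measure.cdf_nonneg real_distribution.finite_borel_measure_M)
  have A: "eventually (\<lambda>N. continuous_on UNIV (A N) \<and> ((A N) \<longlongrightarrow> 1) at_top) sequentially"
    using ev by eventually_elim
      (simp add: A_def mrc_system.margin_cdf_continuous real_distribution.cdf_lim_at_top_prob V)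
  have one: "(\<lambda>N. A N x) \<longlonglongrightarrow> 1" if x: "v < x" for x
  proof (rule tendsto_sandwich[OF _ _ _ tendsto_const])
    have "(\<lambda>N. 1 - w N / (x - e N)\<^sup>2) \<longlonglongrightarrow> 1 - 0 / (x - v)\<^sup>2"
      using x by (intro tendsto_intros w_lim e_lim) auto
    then show "(\<lambda>N. 1 - w N / (x - e N)\<^sup>2) \<longlonglongrightarrow> 1" by simp
    show "eventually (\<lambda>N. 1 - w N / (x - e N)\<^sup>2 \<le> A N x) sequentially"
      using ev order_tendstoD(2)[OF e_lim x]
    proof eventually_elim
      case (elim N)
      show ?case using mrc_system.margin_cdf_above[OF elim(1), of x] elim by (simp add: A_def e_def w_def)
    qed
    show "eventually (\<lambda>N. A N x \<le> 1) sequentially"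
      using dA by (simp add: ST.dist_fun_def)
  qed
  have zero: "(\<lambda>N. A N x) \<longlonglongrightarrow> 0" if x: "x < v" for x
  proof (rule tendsto_sandwich[OF _ _ tendsto_const])
    have "(\<lambda>N. w N / (e N - x)\<^sup>2) \<longlonglongrightarrow> 0 / (v - x)\<^sup>2"
      using x by (intro tendsto_intros w_lim e_lim) auto
    then show "(\<lambda>N. w N / (e N - x)\<^sup>2) \<longlonglongrightarrow> 0" by simp
    show "eventually (\<lambda>N. A N x \<le> w N / (e N - x)\<^sup>2) sequentially"
      using ev order_tendstoD(1)[OF e_lim x]
    proof eventually_elim
      case (elim N)
      show ?case using mrc_system.margin_cdf_below[OF elim(1), of x] elim by (simp add: A_def e_def w_def)
    qed
    show "eventually (\<lambda>N. 0 \<le> A N x) sequentially"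
      using dA by (simp add: ST.dist_fun_def)
  qed
  have m_pos: "eventually (\<lambda>N. 0 < m N) sequentially"
    using \<open>\<rho> > 0\<close> by (intro order_tendstoD(1)[OF m_lim]) simp
  have out: "eventually (\<lambda>N. \<forall>\<mu>>0. outage_prob \<alpha> \<beta> P (W N) (Y N) X (\<Psi> N) \<mu> = ST.mixture (A N) ((\<mu> * m N) powr (\<alpha> / 2))) sequentially"
    using M2 N1 m_pos
  proof eventually_elim
    case (elim N)
    show ?case
    proof (intro allI impI)
      fix \<mu> :: real assume "0 < \<mu>"
      from mrc_system.outage_eq[OF sys[OF elim(1,2) this] D] elim(3) sys[OF elim(1,2), of 1]
      show "outage_prob \<alpha> \<beta> P (W N) (Y N) X (\<Psi> N) \<mu> = ST.mixture (A N) ((\<mu> * m N) powr (\<alpha> / 2))"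
        by (simp add: outage_prob_def ST.mixture_def A_def m_def)
    qed
  qed
  have lo: "eventually (\<lambda>N. min_outage_prob \<beta> P (W N) (Y N) = A N 0) sequentially"
    using ev
  proof eventually_elim
    case (elim N)
    then show ?case by (simp add: mrc_system.min_outage_prob_eq A_def)
  qed
  define c where "c \<epsilon> = \<kappa> * ((max (v / \<rho>) 0) powr ?d * ST.quantile_intensity \<epsilon>) * (1 - \<epsilon>)" for \<epsilon>
  have lim: "(\<lambda>N. capacity_MRC (M N) \<alpha> \<beta> P (W N) (Y N) X (\<Psi> N) \<epsilon> / real N) \<longlonglongrightarrow> c \<epsilon>" if "\<epsilon> \<in> {0<..<1}" for \<epsilon>
  proof -
    let ?x = "\<lambda>N. if \<epsilon> \<le> min_outage_prob \<beta> P (W N) (Y N) then 0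
      else inv_into {0<..} (outage_prob \<alpha> \<beta> P (W N) (Y N) X (\<Psi> N)) \<epsilon>"
    have "?x \<longlonglongrightarrow> (max (v / \<rho>) 0) powr ?d * ST.quantile_intensity \<epsilon>"
      using that by (intro ST.inverse_mixture_limit[OF \<open>\<rho> > 0\<close> m_lim dA A out lo one zero]) auto
    then have "(\<lambda>N. real (M N) / real N * ?x N * (1 - \<epsilon>)) \<longlonglongrightarrow> c \<epsilon>"
      unfolding c_def by (intro tendsto_intros M_ratio)
    moreover have "real (M N) / real N * ?x N * (1 - \<epsilon>) = capacity_MRC (M N) \<alpha> \<beta> P (W N) (Y N) X (\<Psi> N) \<epsilon> / real N" for N
      by (simp add: capacity_MRC_def)
    ultimately show ?thesis by (simp only:)
  qed
  define G where "G = \<kappa> * (max (v / \<rho>) 0) powr ?d"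
  \<comment> \<open>Here the critical threshold appears: \<open>v\<close> is a positive multiple of
    \<open>beta_bar_MRC \<alpha> \<rho> r \<kappa> - \<beta>\<close>.\<close>
  have vr: "v / \<rho> = (r powr \<alpha> / \<rho> + 1) * (?b - \<beta>) / (r powr \<alpha> * \<beta>)"
  proof -
    have b: "(r powr \<alpha> / \<rho> + 1) * ?b = 1 / \<kappa>"
    proof -
      have "r powr \<alpha> / \<rho> + 1 \<noteq> 0" using ra \<open>\<rho> > 0\<close> by (simp add: add_pos_pos less_imp_neq[symmetric])
      then show ?thesis by (simp add: beta_bar_MRC_def)
    qed
    have "(r powr \<alpha> / \<rho> + 1) * (?b - \<beta>) / (r powr \<alpha> * \<beta>) = (1 / \<kappa> - (r powr \<alpha> / \<rho> + 1) * \<beta>) / (r powr \<alpha> * \<beta>)"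
      by (simp only: right_diff_distrib b)
    also have "\<dots> = v / \<rho>"
      using ra assms(2,4,5) by (simp add: v_def field_simps)
    finally show ?thesis ..
  qed
  have G: "G = \<kappa> * (r powr \<alpha> / \<rho> + 1) powr ?d * (max (?b - \<beta>) 0) powr ?d / (r\<^sup>2 * \<beta> powr ?d)"
  proof -
    have pos: "0 < (r powr \<alpha> / \<rho> + 1) / (r powr \<alpha> * \<beta>)"
      using ra assms(2,4) by (intro divide_pos_pos add_pos_pos mult_pos_pos) auto
    have "max (v / \<rho>) 0 = (r powr \<alpha> / \<rho> + 1) / (r powr \<alpha> * \<beta>) * max (?b - \<beta>) 0"
    proof -
      have "v / \<rho> = (r powr \<alpha> / \<rho> + 1) / (r powr \<alpha> * \<beta>) * (?b - \<beta>)" unfolding vr by simp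
      moreover have "max (k * y) 0 = k * max y 0" if "0 < k" for k y :: real
        using that by (cases "y \<le> 0") (auto simp: max_def mult_le_0_iff)
      ultimately show ?thesis using pos by metis
    qed
    then have "(max (v / \<rho>) 0) powr ?d = ((r powr \<alpha> / \<rho> + 1) / (r powr \<alpha> * \<beta>)) powr ?d * (max (?b - \<beta>) 0) powr ?d"
      using pos by (simp only: powr_mult)
    also have "((r powr \<alpha> / \<rho> + 1) / (r powr \<alpha> * \<beta>)) powr ?d = (r powr \<alpha> / \<rho> + 1) powr ?d / (r powr \<alpha> * \<beta>) powr ?d"
      by (rule powr_divide)
    also have "(r powr \<alpha> * \<beta>) powr ?d = r\<^sup>2 * \<beta> powr ?d"
      using assms(1,3) by (simp add: powr_mult powr_powr)
    finally show ?thesis by (simp add: G_def)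
  qed
  let ?h = "H (\<beta> - ?b)"
  let ?err = "\<lambda>\<epsilon>. c \<epsilon> - \<kappa> * (r powr \<alpha> / \<rho> + 1) powr ?d * (max (?b - \<beta>) 0) powr ?d *
        (max (\<epsilon> - ?h) 0 / (pi * r\<^sup>2 * \<beta> powr ?d))"
  have err: "?err \<epsilon> = G * (ST.quantile_intensity \<epsilon> * (1 - \<epsilon>) - max (\<epsilon> - ?h) 0 / pi)" for \<epsilon>
  proof -
    have "c \<epsilon> = G * (ST.quantile_intensity \<epsilon> * (1 - \<epsilon>))" by (simp add: c_def G_def)
    moreover have "\<kappa> * (r powr \<alpha> / \<rho> + 1) powr ?d * (max (?b - \<beta>) 0) powr ?d * (max (\<epsilon> - ?h) 0 / (pi * r\<^sup>2 * \<beta> powr ?d))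
      = G * (max (\<epsilon> - ?h) 0 / pi)" unfolding G by simp
    ultimately show ?thesis by (simp add: right_diff_distrib)
  qed
  have "?err \<in> O[at ?h within {0<..<1}](\<lambda>\<epsilon>. max ((\<epsilon> - ?h)\<^sup>2) 0)"
  proof (cases "\<beta> < ?b")
    case True
    then have h: "?h = 0" by (intro H_neg) simp
    have "0 \<le> G" using \<open>0 < \<kappa>\<close> by (simp add: G_def)
    show ?thesis
    proof (rule bigoI[where c="G * (K + pi\<^sup>2 / 2 + 1)"])
      have "eventually (\<lambda>\<epsilon>. \<epsilon> \<in> {0<..<1} \<and> \<epsilon> < 1 / 2) (at (0::real) within {0<..<1})"
        by (auto simp: eventually_at dist_real_def intro!: exI[of _ "1/2"])
      then show "eventually (\<lambda>\<epsilon>. norm (?err \<epsilon>) \<le> G * (K + pi\<^sup>2 / 2 + 1) * norm (max ((\<epsilon> - ?h)\<^sup>2) 0)) (at ?h within {0<..<1})"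
        unfolding h
      proof eventually_elim
        case (elim \<epsilon>)
        have "\<bar>ST.quantile_intensity \<epsilon> * (1 - \<epsilon>) - \<epsilon> / pi\<bar> \<le> (K + pi\<^sup>2 / 2 + 1) * \<epsilon>\<^sup>2"
          using elim by (intro ST.quantile_intensity_asymp) auto
        then have "G * \<bar>ST.quantile_intensity \<epsilon> * (1 - \<epsilon>) - \<epsilon> / pi\<bar> \<le> G * ((K + pi\<^sup>2 / 2 + 1) * \<epsilon>\<^sup>2)"
          using \<open>0 \<le> G\<close> by (intro mult_left_mono)
        then show ?case
          using err[of \<epsilon>] elim \<open>0 \<le> G\<close> unfolding h by (simp add: abs_mult mult.assoc)
      qed
    qed
  next
    case False
    \<comment> \<open>At or above the critical threshold the limit capacity and the main term carry
      the same factor 0, so the error vanishes identically. This settles the approach to 1 and also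
      equality, where the value \<open>H 0\<close> is left open.\<close>
    then have "G = 0" unfolding G by (simp add: max_def)
    then have "?err = (\<lambda>_. 0)" unfolding err by simp
    then show ?thesis by (simp only: zero_in_bigo)
  qed
  with lim show ?thesis by (intro exI[of _ c]) blast
qed

end
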